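(* Let $(x_1^{a_1},\dots,x_j^{a_j})$ ($j\ge0$) be a marked centre at $p$ that is $j$-semi-associated to $\mathcal I$ but not $\mathcal I$-admissible. Then the next entry $a_{j+1}$ (that is, the $(j+1)$-st entry) of the invariant $\mathrm{inv}(p)$ of $\mathcal I$ at $p$ is equal to $$\min_{\beta\in\mathbb Z_{\ge0}^{j+1}}\left\{\frac{\beta_{j+1}}{1-\sum_{i=1}^j\frac{\beta_i}{a_i}}\ :\ \sum_{i=1}^j\frac{\beta_i}{a_i}<1\ \text{ and }\ \mathcal D[\beta]=(1)\right\},$$ where $\mathcal D[\beta]=\mathcal D[\beta;x_1,\dots,x_j,\mathcal I]$.
   Context: $\Bbbk$ is a field of characteristic zero, $Y$ a smooth variety (separated, reduced, finite type over $\Bbbk$) of dimension $n$, $\mathcal I\subset\mathcal O_Y$ a coherent ideal such that $X=V(\mathcal I)$ has pure and positive codimension, and $p\in X$ a closed point. Everything is considered at $p$, in local rings. Parameters at $p$ are functions $x_1,\dots,x_k$ near $p$, vanishing at $p$, with $dx_1\wedge\dots\wedge dx_k$ nowhere vanishing near $p$; a system of parameters has $k=n$. A weighting at $p$ with weights $w_1\ge\dots\ge w_k>0$ (integers, $0\le k\le n$) is a filtration $\mathcal F_\bullet$ of $\mathcal O_{Y,p}$ for which there are parameters $x_1,\dots,x_k$ at $p$ with $\mathcal F_i$ generated by the monomials $x_1^{\beta_1}\cdots x_k^{\beta_k}$ with $\sum_l\beta_lw_l\ge i$; such parameters (in this order), or any system of parameters at $p$ extending them, are called compatible. It is a smooth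 centre if $\gcd(w_1,\dots,w_k)=1$. A marked centre at $p$ is a pair $\mathcal J=(\mathcal F_\bullet,d)$ of a smooth centre and an integer $d>0$; its invariant is $\mathrm{inv}(\mathcal J)=(d/w_1,\dots,d/w_k)$, a non-decreasing sequence; its compatible parameters are those of $\mathcal F_\bullet$. For parameters $x_1,\dots,x_k$ and rationals $0<a_1\le\dots\le a_k$, $(x_1^{a_1},\dots,x_k^{a_k})$ denotes the marked centre with compatible parameters $x_1,\dots,x_k$, weights $w_i=d/a_i$, and $d$ the unique positive integer making the $w_i$ coprime integers. For $k=0$, $()$ is the zero marked centre: $\mathcal F_i=0$ for $i\geq1$, $d=1$. A pre-invariant is a non-decreasing sequence of positive rationals of length at most $n$ (the empty sequence is allowed when a length $0$ sequence is considered). Pre-invariants are ordered lexicographically with truncated sequences considered larger (i.e. pad with $\infty$ to length $n$). $\mathcal J=(\mathcal F_\bullet,d)$ is $\mathcal I$-admissible if $\mathcal I\subset\mathcal F_d$; a pre-invariant is admissible if it is the invariant of an $\mathcal I$-admissible marked centre at $p$. A pre-invariant of length $l\ge j$ dominates one of length $j$ if their first $j$ entries agree. $\mathcal J'$ dominates $\mathcal J$ if $\mathrm{inv}(\mathcal J')$ dominates $\mathrm{inv}(\mathcal J)$ and they have a common compatible system of parameters. A pre-invariant of length $j$ is $j$-semi-admissible if it is dominated by an admissible pre-invariant. $\mathcal J$ is $j$-semi-associated if (1) the maximal $j$-semi-admissible pre-invariant exists and equals $\mathrm{inv}(\mathcal J)$, and (2) every $\mathcal I$-admissible $\mathcal J'$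 whose invariant dominates $\mathrm{inv}(\mathcal J)$ dominates $\mathcal J$. Among $\mathcal I$-admissible marked centres at $p$ there is a unique one with maximal invariant; it is the associated marked centre to $\mathcal I$ at $p$, and its invariant is $\mathrm{inv}(p)$, the invariant of $\mathcal I$ at $p$. For an ideal $\mathcal A$ on a smooth variety, $\mathcal D^{\le m}\mathcal A$ is the ideal generated by all $\Phi(f)$, $f\in\mathcal A$, $\Phi$ a $\Bbbk$-linear differential operator of order $\le m$ on that variety. For local parameters $x_1,\dots,x_j$ and a multi-index $\beta$ (non-negative integers) of length $l\le j+1$, the ideal $\mathcal D[\beta]=\mathcal D[\beta;x_1,\dots,x_j,\mathcal I]$ on $V(x_1,\dots,x_{l-1})$ is defined recursively by $\mathcal D[(\beta_1)]=\mathcal D^{\le\beta_1}\mathcal I$ and, for $l\ge2$, $\mathcal D[\beta]=\mathcal D^{\le\beta_l}\big(\mathcal D[(\beta_1,\dots,\beta_{l-1})]|_{V(x_{l-1})}\big)$, where $|$ denotes restriction of ideals (image in the structure sheaf) and the outer derivative is taken on $V(x_1,\dots,x_{l-1})$. *)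

theory Defs
  imports
    "HOL-Algebra.Algebra"
    "HOL-Combinatorics.Permutations"
    "HOL-Library.Extended"
    "HOL-Library.Extended_Nat"
begin

section \<open>Local rings of smooth varieties\<close>

definition prime_chains :: "('a, 'b) ring_scheme \<Rightarrow> 'a set list set" where
  "prime_chains R = {Ps. Ps \<noteq> [] \<and> sorted_wrt (\<subset>) Ps \<and> (\<forall>P\<in>set Ps. primeideal P R)}"

definition krull_dim :: "('a, 'b) ring_scheme \<Rightarrow> enat" where
  "krull_dim R = (SUP Ps\<in>prime_chains R. enat (length Ps - 1))"

definition ideal_height :: "('a, 'b) ring_scheme \<Rightarrow> 'a set \<Rightarrow> enat" where
  "ideal_height R P = (SUP Ps\<in>{Ps \<in> prime_chains R. last Ps = P}. enat (length Ps - 1))"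

definition minimal_primes_over :: "('a, 'b) ring_scheme \<Rightarrow> 'a set \<Rightarrow> 'a set set" where
  "minimal_primes_over R I = {P. primeideal P R \<and> I \<subseteq> P \<and>
     (\<forall>Q. primeideal Q R \<and> I \<subseteq> Q \<and> Q \<subseteq> P \<longrightarrow> Q = P)}"

text \<open>The germ at the point of \<open>V(I)\<close> has pure and positive codimension.\<close>

definition pure_positive_codim :: "('a, 'b) ring_scheme \<Rightarrow> 'a set \<Rightarrow> bool" where
  "pure_positive_codim R I \<longleftrightarrow>
     (\<exists>c::nat. 0 < c \<and> (\<forall>P\<in>minimal_primes_over R I. ideal_height R P = enat c))"

locale regular_local_ring = cring R + noetherian_ring R for R (structure) +
  fixes M :: "'a set" and n :: nat
  assumes maximal: "maximalideal M R"
    and maximal_unique: "maximalideal N R \<Longrightarrow> N = M"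
    and dim: "krull_dim R = enat n"
    and regular: "\<exists>xs. length xs = n \<and> set xs \<subseteq> carrier R \<and> M = Idl (set xs)"

text \<open>
  \<open>R\<close> is the local ring, with maximal ideal \<open>M\<close>, of a smooth \<open>n\<close>-dimensional variety over a field
  \<open>K\<close> of characteristic zero at a closed point. Smoothness means that the local ring is regular
  (over a field of characteristic zero this is smoothness over \<open>K\<close>). As the local ring is a
  domain, a sufficiently small affine neighbourhood of the point has a coordinate ring
  \<open>A = K[S]\<close> that embeds into \<open>R\<close>; \<open>R\<close> is its localisation at the maximal ideal \<open>q\<close> of the point.
\<close>

locale smooth_local_ring = regular_local_ring R M n
  for R (structure) and K :: "'a set" and M :: "'a set" and n :: nat +
  assumes base_field: "subfield K R"
    and char_zero: "0 < (m::nat) \<Longrightarrow> [m] \<cdot> \<one> \<noteq> \<zero>"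
    and finite_type_localisation:
      "\<exists>S q. finite S \<and> S \<subseteq> carrier R \<and>
         maximalideal q (R\<lparr>carrier := generate_ring R (K \<union> S)\<rparr>) \<and>
         generate_ring R (K \<union> S) - q \<subseteq> Units R \<and>
         (\<forall>r\<in>carrier R. \<exists>a\<in>generate_ring R (K \<union> S). \<exists>s\<in>generate_ring R (K \<union> S) - q. r \<otimes> s = a)"


section \<open>Differential operators and vector fields\<close>

definition linear_endos :: "('a, 'b) ring_scheme \<Rightarrow> 'a set \<Rightarrow> ('a \<Rightarrow> 'a) set" where
  "linear_endos R K = {\<Phi>. \<Phi> \<in> carrier R \<rightarrow> carrier R \<and>
     (\<forall>a\<in>carrier R. \<forall>b\<in>carrier R. \<Phi> (a \<oplus> b) = \<Phi> a \<oplus> \<Phi> b) \<and>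
     (\<forall>c\<in>K. \<forall>a\<in>carrier R. \<Phi> (c \<otimes> a) = c \<otimes> \<Phi> a)}"
  for R (structure)

text \<open>\<open>diff_ops R K m\<close>: the \<open>K\<close>-linear differential operators \<open>R \<rightarrow> R\<close> of order at most \<open>m\<close>
  in the sense of Grothendieck.\<close>

primrec diff_ops :: "('a, 'b) ring_scheme \<Rightarrow> 'a set \<Rightarrow> nat \<Rightarrow> ('a \<Rightarrow> 'a) set" where
  "diff_ops R K 0 = {\<Phi> \<in> linear_endos R K.
     \<forall>f\<in>carrier R. \<forall>g\<in>carrier R. \<Phi> (f \<otimes>\<^bsub>R\<^esub> g) = f \<otimes>\<^bsub>R\<^esub> \<Phi> g}"
| "diff_ops R K (Suc m) = {\<Phi> \<in> linear_endos R K.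
     \<forall>f\<in>carrier R. (\<lambda>g. \<Phi> (f \<otimes>\<^bsub>R\<^esub> g) \<ominus>\<^bsub>R\<^esub> f \<otimes>\<^bsub>R\<^esub> \<Phi> g) \<in> diff_ops R K m}"

definition diff_ideal :: "('a, 'b) ring_scheme \<Rightarrow> 'a set \<Rightarrow> nat \<Rightarrow> 'a set \<Rightarrow> 'a set" where
  "diff_ideal R K m A = Idl\<^bsub>R\<^esub> {\<Phi> f |\<Phi> f. \<Phi> \<in> diff_ops R K m \<and> f \<in> A}"

definition vector_fields :: "('a, 'b) ring_scheme \<Rightarrow> 'a set \<Rightarrow> ('a \<Rightarrow> 'a) set" where
  "vector_fields R K = {\<delta> \<in> linear_endos R K.
     \<forall>a\<in>carrier R. \<forall>b\<in>carrier R. \<delta> (a \<otimes> b) = a \<otimes> \<delta> b \<oplus> b \<otimes> \<delta> a}"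
  for R (structure)

text \<open>The value \<open>det (\<partial>\<^sub>i x\<^sub>l)\<close> of the form \<open>dx\<^sub>1 \<and> \<dots> \<and> dx\<^sub>k\<close> on the vector fields
  \<open>\<partial>\<^sub>1, \<dots>, \<partial>\<^sub>k\<close>.\<close>

definition wedge_d :: "('a, 'b) ring_scheme \<Rightarrow> 'a list \<Rightarrow> ('a \<Rightarrow> 'a) list \<Rightarrow> 'a" where
  "wedge_d R xs ds = (\<Oplus>\<sigma>\<in>{\<sigma>. \<sigma> permutes {..<length xs}}.
     (if evenperm \<sigma> then \<one> else \<ominus> \<one>) \<otimes> (\<Otimes>i\<in>{..<length xs}. (ds ! i) (xs ! \<sigma> i)))"
  for R (structure)

text \<open>The tangent sheaf of a smooth variety is locally free with dual the cotangent sheaf, so that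
  a form does not vanish at the point (equivalently, nowhere near it) iff its value on some
  vector fields near the point is not in \<open>M\<close>.\<close>

definition parameters :: "('a, 'b) ring_scheme \<Rightarrow> 'a set \<Rightarrow> 'a set \<Rightarrow> 'a list \<Rightarrow> bool" where
  "parameters R K M xs \<longleftrightarrow> set xs \<subseteq> M \<and>
     (\<exists>ds. length ds = length xs \<and> set ds \<subseteq> vector_fields R K \<and> wedge_d R xs ds \<notin> M)"

definition parameter_system ::
    "('a, 'b) ring_scheme \<Rightarrow> 'a set \<Rightarrow> 'a set \<Rightarrow> nat \<Rightarrow> 'a list \<Rightarrow> bool" where
  "parameter_system R K M n xs \<longleftrightarrow> parameters R K M xs \<and> length xs = n"


section \<open>Weightings and marked centres\<close>

definition monomial_filtration ::
    "('a, 'b) ring_scheme \<Rightarrow> 'a list \<Rightarrow> nat list \<Rightarrow> nat \<Rightarrow> 'a set" where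
  "monomial_filtration R xs w i = Idl {(\<Otimes>l\<in>{..<length xs}. (xs ! l) [^] (\<beta> l)) |\<beta> :: nat \<Rightarrow> nat.
     i \<le> (\<Sum>l<length xs. \<beta> l * w ! l)}"
  for R (structure)

text \<open>The weights are recorded along with the filtration and the mark \<open>d\<close>.\<close>

record 'a marked_centre =
  filt :: "nat \<Rightarrow> 'a set"
  wts :: "nat list"
  mark :: nat

definition weighting ::
    "('a, 'b) ring_scheme \<Rightarrow> 'a set \<Rightarrow> 'a set \<Rightarrow> nat \<Rightarrow> (nat \<Rightarrow> 'a set) \<Rightarrow> nat list \<Rightarrow> bool" where
  "weighting R K M n F w \<longleftrightarrow>
     length w \<le> n \<and> sorted_wrt (\<ge>) w \<and> (\<forall>v\<in>set w. 0 < v) \<and>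
     (\<exists>xs. parameters R K M xs \<and> length xs = length w \<and> F = monomial_filtration R xs w)"

text \<open>The zero weighting is a smooth centre by convention, its mark is normalised to 1.\<close>

definition is_marked_centre ::
    "('a, 'b) ring_scheme \<Rightarrow> 'a set \<Rightarrow> 'a set \<Rightarrow> nat \<Rightarrow> 'a marked_centre \<Rightarrow> bool" where
  "is_marked_centre R K M n J \<longleftrightarrow>
     weighting R K M n (filt J) (wts J) \<and> 0 < mark J \<and>
     (if wts J = [] then mark J = 1 else Gcd (set (wts J)) = 1)"

definition centre_inv :: "'a marked_centre \<Rightarrow> rat list" where
  "centre_inv J = map (\<lambda>v. of_nat (mark J) / of_nat v) (wts J)"

text \<open>Compatible families of parameters: the \<open>k\<close> parameters themselves, or a system of parameters
  extending them.\<close>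

definition compatible_parameters ::
    "('a, 'b) ring_scheme \<Rightarrow> 'a set \<Rightarrow> 'a set \<Rightarrow> nat \<Rightarrow> 'a marked_centre \<Rightarrow> 'a list \<Rightarrow> bool" where
  "compatible_parameters R K M n J xs \<longleftrightarrow>
     parameters R K M xs \<and> (length xs = length (wts J) \<or> length xs = n) \<and>
     length (wts J) \<le> length xs \<and>
     filt J = monomial_filtration R (take (length (wts J)) xs) (wts J)"

text \<open>\<open>J\<close> is the marked centre \<open>(x\<^sub>1\<^bsup>a\<^sub>1\<^esup>, \<dots>, x\<^sub>j\<^bsup>a\<^sub>j\<^esup>)\<close>; since the weights of \<open>J\<close> are coprime,
  its mark and its weights are determined by \<open>a\<close>.\<close>

definition is_centre_of ::
    "('a, 'b) ring_scheme \<Rightarrow> 'a set \<Rightarrow> 'a set \<Rightarrow> nat \<Rightarrow> 'a list \<Rightarrow> rat list \<Rightarrow> 'a marked_centre \<Rightarrow> bool"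
  where
  "is_centre_of R K M n xs a J \<longleftrightarrow>
     is_marked_centre R K M n J \<and> length xs = length a \<and>
     compatible_parameters R K M n J xs \<and> centre_inv J = a"


section \<open>Invariants and admissibility\<close>

definition pre_invariant :: "nat \<Rightarrow> rat list \<Rightarrow> bool" where
  "pre_invariant n a \<longleftrightarrow> length a \<le> n \<and> sorted a \<and> (\<forall>r\<in>set a. 0 < r)"

definition pad :: "nat \<Rightarrow> rat list \<Rightarrow> rat extended list" where
  "pad n a = map Fin a @ replicate (n - length a) Pinf"

definition preinv_le :: "nat \<Rightarrow> rat list \<Rightarrow> rat list \<Rightarrow> bool" where
  "preinv_le n a b \<longleftrightarrow> lexordp_eq (pad n a) (pad n b)"

definition admissible :: "'a set \<Rightarrow> 'a marked_centre \<Rightarrow> bool" where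
  "admissible I J \<longleftrightarrow> I \<subseteq> filt J (mark J)"

definition admissible_preinv ::
    "('a, 'b) ring_scheme \<Rightarrow> 'a set \<Rightarrow> 'a set \<Rightarrow> nat \<Rightarrow> 'a set \<Rightarrow> rat list \<Rightarrow> bool" where
  "admissible_preinv R K M n I a \<longleftrightarrow> pre_invariant n a \<and>
     (\<exists>J. is_marked_centre R K M n J \<and> admissible I J \<and> centre_inv J = a)"

definition preinv_dominates :: "rat list \<Rightarrow> rat list \<Rightarrow> bool" where
  "preinv_dominates b a \<longleftrightarrow> length a \<le> length b \<and> take (length a) b = a"

definition centre_dominates ::
    "('a, 'b) ring_scheme \<Rightarrow> 'a set \<Rightarrow> 'a set \<Rightarrow> nat \<Rightarrow> 'a marked_centre \<Rightarrow> 'a marked_centre \<Rightarrow> bool"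
  where
  "centre_dominates R K M n J' J \<longleftrightarrow>
     preinv_dominates (centre_inv J') (centre_inv J) \<and>
     (\<exists>ys. parameter_system R K M n ys \<and>
        compatible_parameters R K M n J' ys \<and> compatible_parameters R K M n J ys)"

definition semi_admissible ::
    "('a, 'b) ring_scheme \<Rightarrow> 'a set \<Rightarrow> 'a set \<Rightarrow> nat \<Rightarrow> 'a set \<Rightarrow> nat \<Rightarrow> rat list \<Rightarrow> bool" where
  "semi_admissible R K M n I j a \<longleftrightarrow> pre_invariant n a \<and> length a = j \<and>
     (\<exists>b. admissible_preinv R K M n I b \<and> preinv_dominates b a)"

definition semi_associated ::
    "('a, 'b) ring_scheme \<Rightarrow> 'a set \<Rightarrow> 'a set \<Rightarrow> nat \<Rightarrow> 'a set \<Rightarrow> nat \<Rightarrow> 'a marked_centre \<Rightarrow> bool" where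
  "semi_associated R K M n I j J \<longleftrightarrow>
     is_marked_centre R K M n J \<and>
     semi_admissible R K M n I j (centre_inv J) \<and>
     (\<forall>b. semi_admissible R K M n I j b \<longrightarrow> preinv_le n b (centre_inv J)) \<and>
     (\<forall>J'. is_marked_centre R K M n J' \<and> admissible I J' \<and>
        preinv_dominates (centre_inv J') (centre_inv J) \<longrightarrow> centre_dominates R K M n J' J)"

text \<open>\<open>J\<close> is the associated marked centre of \<open>I\<close>, and \<open>centre_inv J\<close> is the invariant of \<open>I\<close>
  at the point.\<close>

definition associated_centre ::
    "('a, 'b) ring_scheme \<Rightarrow> 'a set \<Rightarrow> 'a set \<Rightarrow> nat \<Rightarrow> 'a set \<Rightarrow> 'a marked_centre \<Rightarrow> bool" where
  "associated_centre R K M n I J \<longleftrightarrow>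
     is_marked_centre R K M n J \<and> admissible I J \<and>
     (\<forall>J'. is_marked_centre R K M n J' \<and> admissible I J' \<longrightarrow>
        preinv_le n (centre_inv J') (centre_inv J))"


section \<open>The iterated derivatives\<close>

text \<open>\<open>sub_ring R xs l\<close> is the local ring of \<open>V(x\<^sub>1, \<dots>, x\<^sub>l)\<close>. For \<open>l = 0\<close> it is
  \<open>R\<close> modulo the zero ideal, so that all of these rings have elements of the same type.
  \<open>sub_class\<close> is the class of an element of \<open>R\<close> in it.\<close>

definition sub_ring :: "('a, 'b) ring_scheme \<Rightarrow> 'a list \<Rightarrow> nat \<Rightarrow> 'a set ring" where
  "sub_ring R xs l = R Quot (Idl\<^bsub>R\<^esub> (set (take l xs)))"

definition sub_class :: "('a, 'b) ring_scheme \<Rightarrow> 'a list \<Rightarrow> nat \<Rightarrow> 'a \<Rightarrow> 'a set" where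
  "sub_class R xs l f = (Idl\<^bsub>R\<^esub> (set (take l xs))) +>\<^bsub>R\<^esub> f"

text \<open>\<open>iter_diff R K xs I \<beta> l\<close> is \<open>\<D>[(\<beta>\<^sub>1, \<dots>, \<beta>\<^sub>l\<^sub>+\<^sub>1)]\<close>, an ideal of \<open>sub_ring R xs l\<close>.
  Its restriction to \<open>V(x\<^sub>1, \<dots>, x\<^sub>l\<^sub>+\<^sub>1)\<close> is formed by the classes there of all representatives
  in \<open>R\<close> of its elements.\<close>

primrec iter_diff ::
    "('a, 'b) ring_scheme \<Rightarrow> 'a set \<Rightarrow> 'a list \<Rightarrow> 'a set \<Rightarrow> nat list \<Rightarrow> nat \<Rightarrow> 'a set set" where
  "iter_diff R K xs I \<beta> 0 =
     diff_ideal (sub_ring R xs 0) (sub_class R xs 0 ` K) (\<beta> ! 0) (sub_class R xs 0 ` I)"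
| "iter_diff R K xs I \<beta> (Suc l) =
     diff_ideal (sub_ring R xs (Suc l)) (sub_class R xs (Suc l) ` K) (\<beta> ! Suc l)
       (sub_class R xs (Suc l) ` \<Union> (iter_diff R K xs I \<beta> l))"

definition next_entries ::
    "('a, 'b) ring_scheme \<Rightarrow> 'a set \<Rightarrow> 'a list \<Rightarrow> rat list \<Rightarrow> 'a set \<Rightarrow> rat set" where
  "next_entries R K xs a I =
     {of_nat (\<beta> ! length a) / (1 - (\<Sum>i<length a. of_nat (\<beta> ! i) / a ! i)) |\<beta> :: nat list.
        length \<beta> = Suc (length a) \<and> (\<Sum>i<length a. of_nat (\<beta> ! i) / a ! i) < 1 \<and>
        iter_diff R K xs I \<beta> (length a) = carrier (sub_ring R xs (length a))}"

end

theory Submission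
  imports Defs
begin

text \<open>
  Write \<open>J\<close> for the centre \<open>(x\<^sub>1\<^bsup>a\<^sub>1\<^esup>, \<dots>, x\<^sub>j\<^bsup>a\<^sub>j\<^esup>)\<close> and \<open>J\<^sub>p\<close> for the associated centre.
  The invariant of \<open>J\<^sub>p\<close> dominates \<open>a\<close>, hence \<open>J\<^sub>p\<close> dominates \<open>J\<close>, is longer than \<open>J\<close>, and has
  compatible parameters starting with \<open>x\<^sub>1, \<dots>, x\<^sub>j\<close>.

  Lower bound: a differential operator of order \<open>m\<close> on \<open>V(x\<^sub>1, \<dots>, x\<^sub>l)\<close> lowers the weighted order by
  at most \<open>m\<close> times the largest remaining weight, so \<open>\<D>[\<beta>] = (1)\<close> forces
  \<open>\<Sum>\<^sub>i \<beta>\<^sub>i w\<^sub>i \<ge> d\<close>.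

  Attainment: let \<open>m\<close> be the minimum (or any large number, if there is no \<open>\<beta>\<close>). If an \<open>f \<in> I\<close> were not
  in the filtration of \<open>(x\<^sub>1\<^bsup>a\<^sub>1\<^esup>, \<dots>, x\<^sub>j\<^bsup>a\<^sub>j\<^esup>, x\<^bsub>j+1\<^esub>\<^bsup>m\<^esup>, \<dots>, x\<^sub>n\<^bsup>m\<^esup>)\<close>, some monomial of
  too small a weight would occur in its expansion; the corresponding iterated partial derivative of
  \<open>f\<close> would be a unit and give a \<open>\<beta>\<close> with a value below \<open>m\<close>. So this centre is admissible, and maximality of
  the invariant of \<open>J\<^sub>p\<close> bounds its next entry by \<open>m\<close>.
\<close>

section \<open>Monomial filtrations\<close>

text \<open>The domination of \<open>J\<close> by \<open>Jp\<close> supplies a system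
  \<open>ys\<close> compatible with both centres, but the ideals \<open>\<D>[\<beta>]\<close> are
  formed with the given \<open>xs\<close>. So \<open>xs\<close> has to replace the first
  \<open>j\<close> members of \<open>ys\<close>: each \<open>xs ! l\<close> has positive weight for
  \<open>J\<close>, hence lies in the ideal of these members, and this keeps the Jacobian triangular
  modulo \<open>M\<close>. All expansions take place in the local ring itself, one weight at a time:
  an element is a leading form plus a remainder of larger weight. The coefficients are ring
  elements, and the only question asked about them is whether they lie in \<open>M\<close>.
  Characteristic zero enters because derivatives multiply them by exponents, and because a
  determinant with a repeated entry is seen only to be its own negative. In the test centre all
  remaining parameters get one common weight, since the last operator of
  \<open>\<D>[\<beta>]\<close> may differentiate in any of their directions and only its order is
  recorded. If the common exponent is \<open>u * mark J / v\<close> with \<open>u\<close>,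
  \<open>v\<close> coprime, the old weights times \<open>u\<close>, the new weight \<open>v\<close>
  and the mark \<open>u * mark J\<close> describe it by coprime integers.\<close>

definition power_product :: "('a, 'b) ring_scheme \<Rightarrow> 'a list \<Rightarrow> (nat \<Rightarrow> nat) \<Rightarrow> 'a" where
  "power_product R xs \<beta> = (\<Otimes>l\<in>{..<length xs}. (xs ! l) [^] (\<beta> l))" for R (structure)

definition weight :: "nat list \<Rightarrow> nat \<Rightarrow> (nat \<Rightarrow> nat) \<Rightarrow> nat" where
  "weight w k \<beta> = (\<Sum>l<k. \<beta> l * w ! l)"

lemma monomial_filtration_alt:
  "monomial_filtration R xs w i =
     Idl\<^bsub>R\<^esub> {power_product R xs \<beta> |\<beta>. i \<le> weight w (length xs) \<beta>}"
  by (simp add: monomial_filtration_def power_product_def weight_def)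

context cring
begin

text \<open>The elements all of whose multiples satisfy \<open>P\<close> form an ideal that contains
  \<open>S\<close>. So \<open>P\<close> need only be stable under sums, which suits properties of
  \<open>\<Phi> f\<close> for a map \<open>\<Phi>\<close> that is additive but not linear over the
  ring.\<close>

lemma genideal_induct:
  assumes "f \<in> Idl S" "S \<subseteq> carrier R" "P \<zero>"
    and add: "\<And>a b. a \<in> carrier R \<Longrightarrow> b \<in> carrier R \<Longrightarrow> P a \<Longrightarrow> P b \<Longrightarrow> P (a \<oplus> b)"
    and gen: "\<And>r s. r \<in> carrier R \<Longrightarrow> s \<in> S \<Longrightarrow> P (r \<otimes> s)"
  shows "P f"
proof -
  let ?T = "{f \<in> carrier R. \<forall>r\<in>carrier R. P (r \<otimes> f)}"
  have "ideal ?T R"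
  proof (rule idealI)
    show "ring R" by (rule ring_axioms)
    show "subgroup ?T (add_monoid R)"
    proof
      fix x y assume "x \<in> ?T" "y \<in> ?T"
      then show "x \<otimes>\<^bsub>add_monoid R\<^esub> y \<in> ?T" using add by (auto simp: r_distr)
    next
      fix x assume x: "x \<in> ?T"
      have "P (r \<otimes> \<ominus> x)" if "r \<in> carrier R" for r
      proof -
        have "r \<otimes> \<ominus> x = \<ominus> r \<otimes> x" using x that by (simp add: l_minus r_minus)
        then show ?thesis using x that by simp
      qed
      then show "inv\<^bsub>add_monoid R\<^esub> x \<in> ?T" using x by (simp add: a_inv_def[symmetric])
    qed (use assms in auto)
    fix a x assume a: "a \<in> ?T" and x: "x \<in> carrier R"
    have *: "r \<otimes> (x \<otimes> a) = (r \<otimes> x) \<otimes> a" if "r \<in> carrier R" for r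
      using a x that by (simp add: m_assoc)
    show "x \<otimes> a \<in> ?T" using a x by (auto simp: *)
    then show "a \<otimes> x \<in> ?T" using a x by (simp add: m_comm)
  qed
  moreover have "S \<subseteq> ?T" using assms by auto
  ultimately have "Idl S \<subseteq> ?T" by (rule genideal_minimal)
  then have "f \<in> carrier R" "P (\<one> \<otimes> f)" using assms(1) by auto
  then show ?thesis by simp
qed

lemma power_product_closed [simp]:
  "set xs \<subseteq> carrier R \<Longrightarrow> power_product R xs \<beta> \<in> carrier R"
  unfolding power_product_def by (rule finprod_closed) (auto dest: nth_mem)

lemma power_product_mult:
  assumes "set xs \<subseteq> carrier R"
  shows "power_product R xs \<beta> \<otimes> power_product R xs \<gamma> = power_product R xs (\<lambda>l. \<beta> l + \<gamma> l)"
proof -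
  have *: "xs ! l \<in> carrier R" if "l < length xs" for l using assms that by (auto dest: nth_mem)
  have "power_product R xs (\<lambda>l. \<beta> l + \<gamma> l)
      = (\<Otimes>l\<in>{..<length xs}. (xs ! l) [^] (\<beta> l) \<otimes> (xs ! l) [^] (\<gamma> l))"
    unfolding power_product_def by (rule finprod_cong') (auto simp: * nat_pow_mult)
  also have "\<dots> = power_product R xs \<beta> \<otimes> power_product R xs \<gamma>"
    unfolding power_product_def by (rule finprod_multf) (auto simp: *)
  finally show ?thesis ..
qed

lemma power_product_0: "power_product R xs (\<lambda>_. 0) = \<one>"
  by (simp add: power_product_def)

lemma power_product_single:
  assumes "set xs \<subseteq> carrier R" "l < length xs"
  shows "power_product R xs ((\<lambda>_. 0)(l := 1)) = xs ! l"
proof -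
  have *: "xs ! l \<in> carrier R" if "l < length xs" for l using assms that by (auto dest: nth_mem)
  have "power_product R xs ((\<lambda>_. 0)(l := 1)) = (\<Otimes>i\<in>{..<length xs}. if l = i then xs ! i else \<one>)"
    unfolding power_product_def by (rule finprod_cong') (auto simp: *)
  also have "\<dots> = xs ! l"
    by (rule finprod_singleton) (use assms * in auto)
  finally show ?thesis .
qed

lemma power_product_step:
  assumes "set xs \<subseteq> carrier R" "l < length xs" "0 < \<beta> l"
  shows "power_product R xs \<beta> = xs ! l \<otimes> power_product R xs (\<beta>(l := \<beta> l - 1))"
proof -
  have "(\<lambda>i. ((\<lambda>_. 0)(l := 1)) i + (\<beta>(l := \<beta> l - 1)) i) = \<beta>"
    using assms(3) by (auto simp: fun_eq_iff)
  then show ?thesis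
    using power_product_mult[OF assms(1), of "(\<lambda>_. 0)(l := 1)" "\<beta>(l := \<beta> l - 1)"]
      power_product_single[OF assms(1,2)] by simp
qed

end

lemma weight_add: "weight w k (\<lambda>l. \<beta> l + \<gamma> l) = weight w k \<beta> + weight w k \<gamma>"
  by (simp add: weight_def sum.distrib add_mult_distrib)

lemma weight_single: "l < k \<Longrightarrow> weight w k ((\<lambda>_. 0)(l := 1)) = w ! l"
proof -
  assume "l < k"
  have "weight w k ((\<lambda>_. 0)(l := 1)) = (\<Sum>i<k. if i = l then w ! i else 0)"
    unfolding weight_def by (rule sum.cong) auto
  then show ?thesis using \<open>l < k\<close> by simp
qed

lemma weight_step:
  assumes "l < k" "0 < \<beta> l"
  shows "weight w k \<beta> = w ! l + weight w k (\<beta>(l := \<beta> l - 1))"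
proof -
  have "\<beta> = (\<lambda>i. ((\<lambda>_. 0)(l := 1)) i + (\<beta>(l := \<beta> l - 1)) i)"
    using assms(2) by (auto simp: fun_eq_iff)
  then show ?thesis
    using weight_add[of w k "(\<lambda>_. 0)(l := 1)" "\<beta>(l := \<beta> l - 1)"] weight_single[OF assms(1), of w]
    by metis
qed

context cring
begin

lemma monomials_closed:
  "set xs \<subseteq> carrier R \<Longrightarrow> {power_product R xs \<beta> |\<beta>. Q \<beta>} \<subseteq> carrier R"
  by auto

lemma filtration_ideal: "set xs \<subseteq> carrier R \<Longrightarrow> ideal (monomial_filtration R xs w i) R"
  unfolding monomial_filtration_alt by (rule genideal_ideal) (rule monomials_closed)

lemma filtration_closed:
  "set xs \<subseteq> carrier R \<Longrightarrow> f \<in> monomial_filtration R xs w i \<Longrightarrow> f \<in> carrier R"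
  using ideal.Icarr[OF filtration_ideal] .

lemma power_product_in_filtration:
  assumes "set xs \<subseteq> carrier R" "i \<le> weight w (length xs) \<beta>"
  shows "power_product R xs \<beta> \<in> monomial_filtration R xs w i"
  unfolding monomial_filtration_alt
  by (rule subsetD[OF genideal_self[OF monomials_closed[OF assms(1)]]]) (use assms(2) in blast)

lemma filtration_antimono:
  assumes "set xs \<subseteq> carrier R" "i \<le> i'"
  shows "monomial_filtration R xs w i' \<subseteq> monomial_filtration R xs w i"
  unfolding monomial_filtration_alt[of R xs w i']
  by (rule genideal_minimal[OF filtration_ideal[OF assms(1)]])
    (use assms in \<open>auto intro!: power_product_in_filtration\<close>)

lemma filtration_0:
  assumes "set xs \<subseteq> carrier R"
  shows "monomial_filtration R xs w 0 = carrier R"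
proof -
  have "power_product R xs (\<lambda>_. 0) \<in> monomial_filtration R xs w 0"
    using assms by (rule power_product_in_filtration) simp
  then show ?thesis
    using ideal.one_imp_carrier[OF filtration_ideal[OF assms]] by (simp add: power_product_0)
qed

lemma filtration_induct:
  assumes "f \<in> monomial_filtration R xs w i" "set xs \<subseteq> carrier R" "P \<zero>"
    and "\<And>a b. a \<in> carrier R \<Longrightarrow> b \<in> carrier R \<Longrightarrow> P a \<Longrightarrow> P b \<Longrightarrow> P (a \<oplus> b)"
    and "\<And>r \<beta>. r \<in> carrier R \<Longrightarrow> i \<le> weight w (length xs) \<beta> \<Longrightarrow> P (r \<otimes> power_product R xs \<beta>)"
  shows "P f"
proof (rule genideal_induct[OF assms(1)[unfolded monomial_filtration_alt] monomials_closed[OF assms(2)] assms(3,4)])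
  fix r s assume "r \<in> carrier R" "s \<in> {power_product R xs \<beta> |\<beta>. i \<le> weight w (length xs) \<beta>}"
  then show "P (r \<otimes> s)" using assms(5) by blast
qed

lemma filtration_mult:
  assumes xs: "set xs \<subseteq> carrier R"
    and f: "f \<in> monomial_filtration R xs w i" and g: "g \<in> monomial_filtration R xs w k"
  shows "f \<otimes> g \<in> monomial_filtration R xs w (i + k)"
proof -
  interpret F: ideal "monomial_filtration R xs w (i + k)" R using xs by (rule filtration_ideal)
  have gc: "g \<in> carrier R" using filtration_closed[OF xs g] .
  have *: "power_product R xs \<beta> \<otimes> g \<in> monomial_filtration R xs w (i + k)"
    if "i \<le> weight w (length xs) \<beta>" for \<beta>
    using g xs
  proof (rule filtration_induct)
    fix r \<gamma> assume r: "r \<in> carrier R" and \<gamma>: "k \<le> weight w (length xs) \<gamma>"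
    have "power_product R xs (\<lambda>l. \<beta> l + \<gamma> l) \<in> monomial_filtration R xs w (i + k)"
      using xs by (rule power_product_in_filtration) (use that \<gamma> in \<open>simp add: weight_add\<close>)
    then have "r \<otimes> (power_product R xs \<beta> \<otimes> power_product R xs \<gamma>) \<in> monomial_filtration R xs w (i + k)"
      using r xs by (simp add: power_product_mult F.I_l_closed)
    then show "power_product R xs \<beta> \<otimes> (r \<otimes> power_product R xs \<gamma>) \<in> monomial_filtration R xs w (i + k)"
      using r xs by (simp add: m_lcomm)
  qed (use xs in \<open>auto simp: r_distr\<close>)
  show ?thesis using f xs
  proof (rule filtration_induct)
    fix r \<beta> assume "r \<in> carrier R" "i \<le> weight w (length xs) \<beta>"
    then show "r \<otimes> power_product R xs \<beta> \<otimes> g \<in> monomial_filtration R xs w (i + k)"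
      using * gc xs by (simp add: m_assoc F.I_l_closed)
  qed (use gc in \<open>auto simp: l_distr\<close>)
qed

lemma parameter_in_filtration:
  assumes "set xs \<subseteq> carrier R" "l < length xs"
  shows "xs ! l \<in> monomial_filtration R xs w (w ! l)"
  using power_product_in_filtration[OF assms(1), of "w ! l" w "(\<lambda>_. 0)(l := 1)"]
  by (simp add: power_product_single assms weight_single del: One_nat_def)

lemma filtration_nat_pow:
  assumes "set xs \<subseteq> carrier R" "f \<in> monomial_filtration R xs w i"
  shows "f [^] (m::nat) \<in> monomial_filtration R xs w (m * i)"
proof (induction m)
  case (Suc m)
  then show ?case using filtration_mult[OF assms(1) Suc assms(2)] by (simp add: add.commute)
qed (simp add: filtration_0 assms)

lemma filtration_finprod:
  assumes xs: "set xs \<subseteq> carrier R" and "finite A"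
    and "\<And>l. l \<in> A \<Longrightarrow> f l \<in> monomial_filtration R xs w (i l)"
  shows "(\<Otimes>l\<in>A. f l) \<in> monomial_filtration R xs w (\<Sum>l\<in>A. i l)"
  using assms(2,3)
proof (induction A rule: finite_induct)
  case (insert x A)
  have "f \<in> insert x A \<rightarrow> carrier R" using insert filtration_closed[OF xs] by blast
  then show ?case
    using insert filtration_mult[OF xs, of "f x" w "i x" "(\<Otimes>l\<in>A. f l)"] by (auto simp: finprod_insert)
qed (simp add: filtration_0 xs)

text \<open>Filtrations are multiplicative, so it suffices to know a place \<open>q l\<close> of
  each \<open>us ! l\<close> in the target and to compare weights. This serves both for rescaling
  weights and for changing parameters.\<close>

lemma filtration_subset:
  assumes us: "set us \<subseteq> carrier R" and vs: "set vs \<subseteq> carrier R"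
    and mem: "\<And>l. l < length us \<Longrightarrow> us ! l \<in> monomial_filtration R vs v (q l)"
    and wt: "\<And>\<beta>. i \<le> weight w (length us) \<beta> \<Longrightarrow> i' \<le> (\<Sum>l<length us. \<beta> l * q l)"
  shows "monomial_filtration R us w i \<subseteq> monomial_filtration R vs v i'"
  unfolding monomial_filtration_alt[of R us]
proof (rule genideal_minimal[OF filtration_ideal[OF vs]], clarify)
  fix \<beta> assume \<beta>: "i \<le> weight w (length us) \<beta>"
  have "power_product R us \<beta> \<in> monomial_filtration R vs v (\<Sum>l<length us. \<beta> l * q l)"
    unfolding power_product_def
    by (rule filtration_finprod[OF vs]) (use filtration_nat_pow[OF vs mem] in auto)
  then show "power_product R us \<beta> \<in> monomial_filtration R vs v i'"
    using filtration_antimono[OF vs wt[OF \<beta>]] by blast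
qed

end

section \<open>Filtrations under surjective homomorphisms\<close>

lemma (in ring_hom_cring) hom_power_product:
  assumes "set xs \<subseteq> carrier R"
  shows "h (power_product R xs \<beta>) = power_product S (map h xs) \<beta>"
proof -
  have *: "xs ! l \<in> carrier R" if "l < length xs" for l using assms that by (auto dest: nth_mem)
  show ?thesis unfolding power_product_def
    by (subst hom_finprod) (auto simp: * hom_nat_pow intro!: S.finprod_cong')
qed

text \<open>Surjectivity lifts the coefficients. Parameters that become zero stay in the list, so
  restriction to a subvariety needs no renumbering of the weights.\<close>

lemma (in ring_hom_cring) hom_filtration:
  assumes xs: "set xs \<subseteq> carrier R" and surj: "h ` carrier R = carrier S"
  shows "monomial_filtration S (map h xs) w i = h ` monomial_filtration R xs w i"
proof
  have hxs: "set (map h xs) \<subseteq> carrier S" using xs by auto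
  interpret F: ideal "monomial_filtration R xs w i" R using R.filtration_ideal[OF xs] .
  interpret G: ideal "monomial_filtration S (map h xs) w i" S using S.filtration_ideal[OF hxs] .
  show "monomial_filtration S (map h xs) w i \<subseteq> h ` monomial_filtration R xs w i"
  proof
    fix f assume "f \<in> monomial_filtration S (map h xs) w i"
    then show "f \<in> h ` monomial_filtration R xs w i"
    using hxs
    proof (rule S.filtration_induct)
      show "\<zero>\<^bsub>S\<^esub> \<in> h ` monomial_filtration R xs w i" using F.zero_closed by (metis hom_zero imageI)
      show "a \<oplus>\<^bsub>S\<^esub> b \<in> h ` monomial_filtration R xs w i"
        if "a \<in> h ` monomial_filtration R xs w i" "b \<in> h ` monomial_filtration R xs w i" for a b
      proof -
        from that obtain a' b' where *: "a' \<in> monomial_filtration R xs w i" "a = h a'"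
            "b' \<in> monomial_filtration R xs w i" "b = h b'" by blast
        then have "a \<oplus>\<^bsub>S\<^esub> b = h (a' \<oplus>\<^bsub>R\<^esub> b')" by (simp add: F.a_Hcarr)
        then show ?thesis using * F.a_closed by blast
      qed
      fix r \<beta> assume "r \<in> carrier S" and \<beta>: "i \<le> weight w (length (map h xs)) \<beta>"
      then obtain s where s: "s \<in> carrier R" "r = h s" using surj by blast
      have "s \<otimes> power_product R xs \<beta> \<in> monomial_filtration R xs w i"
        using R.power_product_in_filtration[OF xs] \<beta> s by (auto intro!: F.I_l_closed)
      moreover have "r \<otimes>\<^bsub>S\<^esub> power_product S (map h xs) \<beta> = h (s \<otimes> power_product R xs \<beta>)"
        using s xs by (simp add: hom_power_product)
      ultimately show "r \<otimes>\<^bsub>S\<^esub> power_product S (map h xs) \<beta> \<in> h ` monomial_filtration R xs w i"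
        by blast
    qed
  qed
  show "h ` monomial_filtration R xs w i \<subseteq> monomial_filtration S (map h xs) w i"
  proof (rule image_subsetI)
    fix f assume "f \<in> monomial_filtration R xs w i"
    then show "h f \<in> monomial_filtration S (map h xs) w i"
    using xs
    proof (rule R.filtration_induct)
      fix r \<beta> assume "r \<in> carrier R" "i \<le> weight w (length xs) \<beta>"
      then show "h (r \<otimes> power_product R xs \<beta>) \<in> monomial_filtration S (map h xs) w i"
        using xs S.power_product_in_filtration[OF hxs, of i w \<beta>]
        by (simp add: hom_power_product G.I_l_closed)
    qed auto
  qed
qed

section \<open>Differential operators\<close>

context cring
begin

lemma add_minus_cancel: "x \<in> carrier R \<Longrightarrow> y \<in> carrier R \<Longrightarrow> x \<oplus> y \<ominus> x = y"
  by (metis a_comm a_inv_closed a_assoc minus_eq r_neg r_zero)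

lemma linear_endosI:
  assumes "\<And>a. a \<in> carrier R \<Longrightarrow> \<Phi> a \<in> carrier R"
    and "\<And>a b. a \<in> carrier R \<Longrightarrow> b \<in> carrier R \<Longrightarrow> \<Phi> (a \<oplus> b) = \<Phi> a \<oplus> \<Phi> b"
    and "\<And>c a. c \<in> K \<Longrightarrow> a \<in> carrier R \<Longrightarrow> \<Phi> (c \<otimes> a) = c \<otimes> \<Phi> a"
  shows "\<Phi> \<in> linear_endos R K"
  using assms by (auto simp: linear_endos_def)

lemma linear_endos_closed:
  "\<Phi> \<in> linear_endos R K \<Longrightarrow> a \<in> carrier R \<Longrightarrow> \<Phi> a \<in> carrier R"
  by (auto simp: linear_endos_def)

lemma linear_endos_add:
  "\<Phi> \<in> linear_endos R K \<Longrightarrow> a \<in> carrier R \<Longrightarrow> b \<in> carrier R \<Longrightarrow> \<Phi> (a \<oplus> b) = \<Phi> a \<oplus> \<Phi> b"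
  by (auto simp: linear_endos_def)

lemma linear_endos_scale:
  "\<Phi> \<in> linear_endos R K \<Longrightarrow> c \<in> K \<Longrightarrow> a \<in> carrier R \<Longrightarrow> \<Phi> (c \<otimes> a) = c \<otimes> \<Phi> a"
  by (auto simp: linear_endos_def)

lemma linear_endos_zero:
  assumes "\<Phi> \<in> linear_endos R K"
  shows "\<Phi> \<zero> = \<zero>"
proof -
  have c: "\<Phi> \<zero> \<in> carrier R" using linear_endos_closed[OF assms] by simp
  have "\<Phi> \<zero> \<oplus> \<Phi> \<zero> = \<Phi> \<zero> \<oplus> \<zero>" using linear_endos_add[OF assms, of \<zero> \<zero>] c by simp
  then show ?thesis using c by (simp only: add.l_cancel zero_closed)
qed

lemma linear_endos_minus:
  assumes "\<Phi> \<in> linear_endos R K" "a \<in> carrier R"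
  shows "\<Phi> (\<ominus> a) = \<ominus> \<Phi> a"
proof -
  have "\<Phi> (\<ominus> a) \<oplus> \<Phi> a = \<zero>"
    using linear_endos_add[OF assms(1), of "\<ominus> a" a] assms linear_endos_zero[OF assms(1)]
    by (simp add: l_neg)
  then show ?thesis
    using linear_endos_closed[OF assms(1)] assms(2) by (simp add: minus_equality)
qed

lemma linear_endos_id: "K \<subseteq> carrier R \<Longrightarrow> id \<in> linear_endos R K"
  by (auto simp: linear_endos_def)

lemma linear_endos_cong:
  assumes "\<Phi> \<in> linear_endos R K" "\<And>a. a \<in> carrier R \<Longrightarrow> \<Psi> a = \<Phi> a" "K \<subseteq> carrier R"
  shows "\<Psi> \<in> linear_endos R K"
  using assms by (auto simp: linear_endos_def subset_eq)

lemma linear_endos_comp: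
  "\<Phi> \<in> linear_endos R K \<Longrightarrow> \<Psi> \<in> linear_endos R K \<Longrightarrow> (\<lambda>a. \<Phi> (\<Psi> a)) \<in> linear_endos R K"
  by (auto simp: linear_endos_def Pi_iff)

lemma linear_endos_sum:
  assumes "\<Phi> \<in> linear_endos R K" "\<Psi> \<in> linear_endos R K" "K \<subseteq> carrier R"
  shows "(\<lambda>a. \<Phi> a \<oplus> \<Psi> a) \<in> linear_endos R K"
proof (rule linear_endosI)
  fix c a assume "c \<in> K" "a \<in> carrier R"
  then show "\<Phi> (c \<otimes> a) \<oplus> \<Psi> (c \<otimes> a) = c \<otimes> (\<Phi> a \<oplus> \<Psi> a)"
    using assms by (simp add: linear_endos_scale linear_endos_closed r_distr subset_eq)
qed (use assms in \<open>auto simp: linear_endos_add linear_endos_closed a_ac\<close>)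

lemma linear_endos_smult:
  assumes "\<Phi> \<in> linear_endos R K" "r \<in> carrier R" "K \<subseteq> carrier R"
  shows "(\<lambda>a. r \<otimes> \<Phi> a) \<in> linear_endos R K"
proof (rule linear_endosI)
  fix c a assume "c \<in> K" "a \<in> carrier R"
  then show "r \<otimes> \<Phi> (c \<otimes> a) = c \<otimes> (r \<otimes> \<Phi> a)"
    using assms by (simp add: linear_endos_scale linear_endos_closed m_lcomm subset_eq)
qed (use assms in \<open>auto simp: linear_endos_add linear_endos_closed r_distr\<close>)

lemma diff_ops_linear: "\<Phi> \<in> diff_ops R K m \<Longrightarrow> \<Phi> \<in> linear_endos R K"
  by (cases m) auto

text \<open>Operators are functions on the whole type, while ring identities hold only on the
  carrier. This lemma lets a commutator be replaced by a formula that agrees with it there.\<close>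

lemma diff_ops_cong:
  assumes "\<Phi> \<in> diff_ops R K m" "\<And>a. a \<in> carrier R \<Longrightarrow> \<Psi> a = \<Phi> a" "K \<subseteq> carrier R"
  shows "\<Psi> \<in> diff_ops R K m"
  using assms(1,2)
proof (induction m arbitrary: \<Phi> \<Psi>)
  case 0
  have "\<Psi> \<in> linear_endos R K"
    using diff_ops_linear[OF 0(1)] 0(2) assms(3) by (rule linear_endos_cong)
  moreover have "\<Psi> (f \<otimes> g) = f \<otimes> \<Psi> g" if "f \<in> carrier R" "g \<in> carrier R" for f g
  proof -
    have "\<Phi> (f \<otimes> g) = f \<otimes> \<Phi> g" using 0(1) that by simp
    then show ?thesis using that 0(2) by (metis m_closed)
  qed
  ultimately show ?case by simp
next
  case (Suc m)
  have "\<Psi> \<in> linear_endos R K"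
    using diff_ops_linear[OF Suc.prems(1)] Suc.prems(2) assms(3) by (rule linear_endos_cong)
  moreover have "(\<lambda>g. \<Psi> (f \<otimes> g) \<ominus> f \<otimes> \<Psi> g) \<in> diff_ops R K m" if "f \<in> carrier R" for f
  proof (rule Suc.IH)
    show "(\<lambda>g. \<Phi> (f \<otimes> g) \<ominus> f \<otimes> \<Phi> g) \<in> diff_ops R K m" using Suc.prems(1) that by simp
  qed (use that Suc.prems(2) in simp)
  ultimately show ?case by simp
qed

lemma diff_ops_sum:
  assumes "\<Phi> \<in> diff_ops R K m" "\<Psi> \<in> diff_ops R K m" "K \<subseteq> carrier R"
  shows "(\<lambda>a. \<Phi> a \<oplus> \<Psi> a) \<in> diff_ops R K m"
  using assms(1,2)
proof (induction m arbitrary: \<Phi> \<Psi>)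
  case 0
  then have *: "\<Phi> \<in> linear_endos R K" "\<Psi> \<in> linear_endos R K" by auto
  then show ?case using 0 linear_endos_sum[OF * assms(3)]
    by (auto simp: linear_endos_closed r_distr)
next
  case (Suc m)
  then have *: "\<Phi> \<in> linear_endos R K" "\<Psi> \<in> linear_endos R K" by auto
  have "(\<lambda>g. (\<Phi> (f \<otimes> g) \<oplus> \<Psi> (f \<otimes> g)) \<ominus> f \<otimes> (\<Phi> g \<oplus> \<Psi> g)) \<in> diff_ops R K m"
    if f: "f \<in> carrier R" for f
  proof (rule diff_ops_cong[OF Suc.IH _ assms(3)])
    show "(\<lambda>g. \<Phi> (f \<otimes> g) \<ominus> f \<otimes> \<Phi> g) \<in> diff_ops R K m"
      and "(\<lambda>g. \<Psi> (f \<otimes> g) \<ominus> f \<otimes> \<Psi> g) \<in> diff_ops R K m"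
      using Suc.prems f by auto
    fix g assume g: "g \<in> carrier R"
    then show "(\<Phi> (f \<otimes> g) \<oplus> \<Psi> (f \<otimes> g)) \<ominus> f \<otimes> (\<Phi> g \<oplus> \<Psi> g)
        = (\<Phi> (f \<otimes> g) \<ominus> f \<otimes> \<Phi> g) \<oplus> (\<Psi> (f \<otimes> g) \<ominus> f \<otimes> \<Psi> g)"
      using f linear_endos_closed[OF *(1)] linear_endos_closed[OF *(2)]
      by (simp add: minus_eq r_distr minus_add a_ac)
  qed
  then show ?case using linear_endos_sum[OF * assms(3)] by simp
qed

lemma diff_ops_smult:
  assumes "\<Phi> \<in> diff_ops R K m" "r \<in> carrier R" "K \<subseteq> carrier R"
  shows "(\<lambda>a. r \<otimes> \<Phi> a) \<in> diff_ops R K m"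
  using assms(1)
proof (induction m arbitrary: \<Phi>)
  case 0
  then have *: "\<Phi> \<in> linear_endos R K" by auto
  then show ?case using 0 linear_endos_smult[OF * assms(2,3)] assms(2)
    by (auto simp: linear_endos_closed m_lcomm)
next
  case (Suc m)
  then have *: "\<Phi> \<in> linear_endos R K" by auto
  have "(\<lambda>g. r \<otimes> \<Phi> (f \<otimes> g) \<ominus> f \<otimes> (r \<otimes> \<Phi> g)) \<in> diff_ops R K m"
    if f: "f \<in> carrier R" for f
  proof (rule diff_ops_cong[OF Suc.IH _ assms(3)])
    show "(\<lambda>g. \<Phi> (f \<otimes> g) \<ominus> f \<otimes> \<Phi> g) \<in> diff_ops R K m"
      using Suc.prems f by auto
    fix g assume g: "g \<in> carrier R"
    then show "r \<otimes> \<Phi> (f \<otimes> g) \<ominus> f \<otimes> (r \<otimes> \<Phi> g) = r \<otimes> (\<Phi> (f \<otimes> g) \<ominus> f \<otimes> \<Phi> g)"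
      using f assms(2) linear_endos_closed[OF *(1)]
      by (simp add: minus_eq r_distr r_minus m_lcomm)
  qed
  then show ?case using linear_endos_smult[OF * assms(2,3)] by simp
qed

lemma vector_fieldsD:
  assumes "\<delta> \<in> vector_fields R K"
  shows "\<delta> \<in> linear_endos R K"
    and "a \<in> carrier R \<Longrightarrow> \<delta> a \<in> carrier R"
    and "a \<in> carrier R \<Longrightarrow> b \<in> carrier R \<Longrightarrow> \<delta> (a \<oplus> b) = \<delta> a \<oplus> \<delta> b"
    and "a \<in> carrier R \<Longrightarrow> b \<in> carrier R \<Longrightarrow> \<delta> (a \<otimes> b) = a \<otimes> \<delta> b \<oplus> b \<otimes> \<delta> a"
    and "\<delta> \<zero> = \<zero>"
    and "a \<in> carrier R \<Longrightarrow> \<delta> (\<ominus> a) = \<ominus> \<delta> a"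
  using assms linear_endos_closed linear_endos_add linear_endos_zero linear_endos_minus
  by (auto simp: vector_fields_def)

text \<open>The commutator of \<open>\<delta> \<circ> \<Phi>\<close> with \<open>f\<close> is
  \<open>\<delta>\<close> after the commutator of \<open>\<Phi>\<close> with \<open>f\<close>, plus
  \<open>\<delta> f\<close> times \<open>\<Phi>\<close>. The first summand is handled by induction,
  the second is a multiple of \<open>\<Phi>\<close>. For order zero only the second remains.\<close>

lemma vector_field_comp_diff_op:
  assumes "\<delta> \<in> vector_fields R K" "\<Phi> \<in> diff_ops R K m" "K \<subseteq> carrier R"
  shows "(\<lambda>a. \<delta> (\<Phi> a)) \<in> diff_ops R K (Suc m)"
  using assms(2)
proof (induction m arbitrary: \<Phi>)
  case 0
  then have *: "\<Phi> \<in> linear_endos R K" by auto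
  have "(\<lambda>g. \<delta> (\<Phi> (f \<otimes> g)) \<ominus> f \<otimes> \<delta> (\<Phi> g)) \<in> diff_ops R K 0" if f: "f \<in> carrier R" for f
  proof (rule diff_ops_cong[OF diff_ops_smult[OF 0 _ assms(3)] _ assms(3)])
    show "\<delta> f \<in> carrier R" using f vector_fieldsD[OF assms(1)] by simp
    fix g assume g: "g \<in> carrier R"
    have "\<Phi> (f \<otimes> g) = f \<otimes> \<Phi> g" using 0 f g by simp
    then show "\<delta> (\<Phi> (f \<otimes> g)) \<ominus> f \<otimes> \<delta> (\<Phi> g) = \<delta> f \<otimes> \<Phi> g"
      using f g vector_fieldsD[OF assms(1)] linear_endos_closed[OF *]
      by (simp add: add_minus_cancel m_comm)
  qed
  then show ?case using linear_endos_comp[OF vector_fieldsD(1)[OF assms(1)] *]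
    by (simp del: diff_ops.simps(1))
next
  case (Suc m)
  then have *: "\<Phi> \<in> linear_endos R K" by auto
  have "(\<lambda>g. \<delta> (\<Phi> (f \<otimes> g)) \<ominus> f \<otimes> \<delta> (\<Phi> g)) \<in> diff_ops R K (Suc m)" if f: "f \<in> carrier R" for f
  proof (rule diff_ops_cong[OF diff_ops_sum[OF Suc.IH diff_ops_smult[OF Suc.prems _ assms(3)] assms(3)] _ assms(3)])
    show "\<delta> f \<in> carrier R" using f vector_fieldsD[OF assms(1)] by simp
    show "(\<lambda>g. \<Phi> (f \<otimes> g) \<ominus> f \<otimes> \<Phi> g) \<in> diff_ops R K m" using Suc.prems f by simp
    fix g assume g: "g \<in> carrier R"
    have c: "\<Phi> (f \<otimes> g) \<in> carrier R" "\<Phi> g \<in> carrier R" using f g linear_endos_closed[OF *] by auto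
    have "\<delta> (\<Phi> (f \<otimes> g) \<ominus> f \<otimes> \<Phi> g) = \<delta> (\<Phi> (f \<otimes> g)) \<oplus> \<ominus> (f \<otimes> \<delta> (\<Phi> g) \<oplus> \<Phi> g \<otimes> \<delta> f)"
      using f c vector_fieldsD[OF assms(1)] by (simp add: minus_eq)
    then show "\<delta> (\<Phi> (f \<otimes> g)) \<ominus> f \<otimes> \<delta> (\<Phi> g)
        = \<delta> (\<Phi> (f \<otimes> g) \<ominus> f \<otimes> \<Phi> g) \<oplus> \<delta> f \<otimes> \<Phi> g"
      using f g c vector_fieldsD(2)[OF assms(1)]
      by (simp add: minus_eq minus_add m_comm[of "\<delta> f"] a_assoc l_neg)
  qed
  then show ?case using linear_endos_comp[OF vector_fieldsD(1)[OF assms(1)] *]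
    by (simp del: diff_ops.simps add: diff_ops.simps(2)[of R K "Suc m"])
qed

lemma id_diff_op: "K \<subseteq> carrier R \<Longrightarrow> id \<in> diff_ops R K 0"
  by (simp add: linear_endos_id)

lemma fold_vector_fields_diff_op:
  assumes "\<And>l. l \<in> set ls \<Longrightarrow> D l \<in> vector_fields R K" "K \<subseteq> carrier R"
  shows "fold D ls \<in> diff_ops R K (length ls)"
  using assms(1)
proof (induction ls rule: rev_induct)
  case Nil
  then show ?case using id_diff_op[OF assms(2)] by (simp only: fold.simps list.size)
next
  case (snoc l ls)
  have "fold D (ls @ [l]) = (\<lambda>a. D l (fold D ls a))" by auto
  then show ?case
    using vector_field_comp_diff_op[OF _ snoc.IH assms(2), of "D l"] snoc.prems
    by (simp del: diff_ops.simps)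
qed

text \<open>A commutator with a parameter lowers the order of an operator by one, while the parameter
  itself contributes at most \<open>W\<close> to the weight.\<close>

lemma diff_op_filtration:
  assumes zs: "set zs \<subseteq> carrier R" and W: "\<And>l. l < length zs \<Longrightarrow> w ! l \<le> W \<or> zs ! l = \<zero>"
    and "\<Phi> \<in> diff_ops R K m" "f \<in> monomial_filtration R zs w t"
  shows "\<Phi> f \<in> monomial_filtration R zs w (t - m * W)"
  using assms(3,4)
proof (induction m arbitrary: \<Phi> f t)
  case 0
  have f: "f \<in> carrier R" using filtration_closed[OF zs 0(2)] .
  \<comment> \<open>An operator of order zero is multiplication by its value at one.\<close>
  have "\<Phi> (f \<otimes> \<one>) = f \<otimes> \<Phi> \<one>" using 0(1) f by (simp del: r_one)
  moreover have "\<Phi> \<one> \<in> carrier R" using linear_endos_closed[OF diff_ops_linear[OF 0(1)]] by simp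
  ultimately show ?case using f ideal.I_r_closed[OF filtration_ideal[OF zs] 0(2)] by simp
next
  case (Suc m)
  let ?F = "monomial_filtration R zs w"
  have lin: "\<Phi> \<in> linear_endos R K" using Suc.prems(1) by simp
  note clo = linear_endos_closed[OF lin] and IH = Suc.IH
  have z: "zs ! l \<in> carrier R" if "l < length zs" for l using zs that by (auto dest: nth_mem)
  \<comment> \<open>Inner induction on the degree: with one parameter \<open>z\<close> split off,
    \<open>\<Phi> (z \<otimes> g)\<close> is the commutator at \<open>g\<close> plus
    \<open>z \<otimes> \<Phi> g\<close>. The commutator has smaller order, and in the second summand
    \<open>\<Phi>\<close> meets a monomial of smaller degree.\<close>
  have gen: "\<Phi> (r \<otimes> power_product R zs \<beta>) \<in> ?F (weight w (length zs) \<beta> - Suc m * W)"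
    if "r \<in> carrier R" for r \<beta>
  proof (induction "\<Sum>l<length zs. \<beta> l" arbitrary: \<beta>)
    case 0
    then have "weight w (length zs) \<beta> = 0" by (simp add: weight_def)
    then show ?case using that zs clo by (simp add: filtration_0)
  next
    case (Suc k)
    then obtain l where l: "l < length zs" "0 < \<beta> l"
      by (metis (no_types, lifting) lessThan_iff neq0_conv old.nat.distinct(2) sum.neutral)
    let ?\<beta>' = "\<beta>(l := \<beta> l - 1)"
    let ?g = "r \<otimes> power_product R zs ?\<beta>'"
    have g: "?g \<in> carrier R" using that zs by simp
    have wt: "weight w (length zs) \<beta> = w ! l + weight w (length zs) ?\<beta>'"
      using weight_step[of l "length zs" \<beta> w] l by simp
    have "(\<Sum>i<length zs. \<beta> i) = 1 + (\<Sum>i<length zs. ?\<beta>' i)"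
      using l by (simp add: sum.remove[of _ l])
    then have k: "k = (\<Sum>i<length zs. ?\<beta>' i)" using Suc(2) by simp
    have eq: "r \<otimes> power_product R zs \<beta> = zs ! l \<otimes> ?g"
      using power_product_step[of zs l \<beta>, OF zs l] that z[OF l(1)] zs by (simp add: m_lcomm)
    show ?case
    \<comment> \<open>For a parameter that is zero there is no bound on its weight, but then the
      monomial is zero.\<close>
    proof (cases "zs ! l = \<zero>")
      case True
      then show ?thesis using eq g linear_endos_zero[OF lin]
        by (simp add: additive_subgroup.zero_closed[OF ideal.axioms(1)[OF filtration_ideal[OF zs]]])
    next
      case False
      then have le: "w ! l \<le> W" using W l by blast
      have gF: "?g \<in> ?F (weight w (length zs) ?\<beta>')"
        using power_product_in_filtration[OF zs order_refl] that
        by (intro ideal.I_l_closed[OF filtration_ideal[OF zs]])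
      have "(\<lambda>g. \<Phi> (zs ! l \<otimes> g) \<ominus> zs ! l \<otimes> \<Phi> g) \<in> diff_ops R K m"
        using \<open>\<Phi> \<in> diff_ops R K (Suc m)\<close> z[OF l(1)] by simp
      then have "\<Phi> (zs ! l \<otimes> ?g) \<ominus> zs ! l \<otimes> \<Phi> ?g \<in> ?F (weight w (length zs) ?\<beta>' - m * W)"
        using gF by (rule IH)
      \<comment> \<open>Truncated subtraction is harmless throughout: weight 0 stands for the whole
        ring.\<close>
      then have 1: "\<Phi> (zs ! l \<otimes> ?g) \<ominus> zs ! l \<otimes> \<Phi> ?g \<in> ?F (weight w (length zs) \<beta> - Suc m * W)"
        by (rule subsetD[OF filtration_antimono[OF zs], rotated]) (use wt le in simp)
      have "zs ! l \<otimes> \<Phi> ?g \<in> ?F (w ! l + (weight w (length zs) ?\<beta>' - Suc m * W))"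
        by (rule filtration_mult[OF zs parameter_in_filtration[OF zs l(1)]]) (rule Suc(1)[OF k])
      then have 2: "zs ! l \<otimes> \<Phi> ?g \<in> ?F (weight w (length zs) \<beta> - Suc m * W)"
        by (rule subsetD[OF filtration_antimono[OF zs], rotated]) (use wt in simp)
      have "\<Phi> (zs ! l \<otimes> ?g) = (\<Phi> (zs ! l \<otimes> ?g) \<ominus> zs ! l \<otimes> \<Phi> ?g) \<oplus> zs ! l \<otimes> \<Phi> ?g"
        using z[OF l(1)] g clo by (simp add: minus_eq a_assoc l_neg)
      then show ?thesis
        using additive_subgroup.a_closed[OF ideal.axioms(1)[OF filtration_ideal[OF zs]] 1 2] eq by simp
    qed
  qed
  interpret F: ideal "?F (t - Suc m * W)" R using filtration_ideal[OF zs] .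
  show ?case using Suc.prems(2) zs
  proof (rule filtration_induct)
    show "\<Phi> \<zero> \<in> ?F (t - Suc m * W)"
      using linear_endos_zero[OF lin] F.zero_closed by (simp only:)
  next
    fix a b assume "a \<in> carrier R" "b \<in> carrier R" "\<Phi> a \<in> ?F (t - Suc m * W)" "\<Phi> b \<in> ?F (t - Suc m * W)"
    then show "\<Phi> (a \<oplus> b) \<in> ?F (t - Suc m * W)"
      using linear_endos_add[OF lin] F.a_closed by (simp only:)
  next
    fix r \<beta> assume "r \<in> carrier R" and \<beta>: "t \<le> weight w (length zs) \<beta>"
    from gen[OF this(1), of \<beta>] show "\<Phi> (r \<otimes> power_product R zs \<beta>) \<in> ?F (t - Suc m * W)"
      by (rule subsetD[OF filtration_antimono[OF zs], rotated]) (use \<beta> in simp)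
  qed
qed

section \<open>Vector fields as a module\<close>

lemma vector_field_cong:
  assumes "\<delta> \<in> vector_fields R K" "\<And>a. a \<in> carrier R \<Longrightarrow> \<epsilon> a = \<delta> a" "K \<subseteq> carrier R"
  shows "\<epsilon> \<in> vector_fields R K"
  using assms linear_endos_cong[OF _ assms(2,3)] by (auto simp: vector_fields_def)

lemma vector_field_zero: "K \<subseteq> carrier R \<Longrightarrow> (\<lambda>_. \<zero>) \<in> vector_fields R K"
  by (auto simp: vector_fields_def linear_endos_def subset_eq)

lemma vector_field_smult:
  assumes "\<delta> \<in> vector_fields R K" "r \<in> carrier R" "K \<subseteq> carrier R"
  shows "(\<lambda>a. r \<otimes> \<delta> a) \<in> vector_fields R K"
  using linear_endos_smult[OF vector_fieldsD(1)[OF assms(1)] assms(2,3)] vector_fieldsD[OF assms(1)]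
    assms(2)
  by (auto simp: vector_fields_def r_distr m_lcomm)

lemma vector_field_sum:
  assumes "\<delta> \<in> vector_fields R K" "\<epsilon> \<in> vector_fields R K" "K \<subseteq> carrier R"
  shows "(\<lambda>a. \<delta> a \<oplus> \<epsilon> a) \<in> vector_fields R K"
  using linear_endos_sum[OF vector_fieldsD(1)[OF assms(1)] vector_fieldsD(1)[OF assms(2)] assms(3)]
    vector_fieldsD(2,4)[OF assms(1)] vector_fieldsD(2,4)[OF assms(2)]
  by (auto simp: vector_fields_def r_distr a_ac)

lemma vector_field_finsum:
  assumes "finite A" "\<And>i. i \<in> A \<Longrightarrow> D i \<in> vector_fields R K" "K \<subseteq> carrier R"
  shows "(\<lambda>a. \<Oplus>i\<in>A. D i a) \<in> vector_fields R K"
  using assms(1,2)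
proof (induction A rule: finite_induct)
  case empty
  then show ?case using vector_field_zero[OF assms(3)] by simp
next
  case (insert i A)
  show ?case
  proof (rule vector_field_cong[OF vector_field_sum[OF _ insert.IH assms(3)] _ assms(3)])
    fix a assume "a \<in> carrier R"
    then have "D j a \<in> carrier R" if "j \<in> insert i A" for j
      using vector_fieldsD(2)[OF insert.prems[OF that]] by simp
    then show "(\<Oplus>j\<in>insert i A. D j a) = D i a \<oplus> (\<Oplus>j\<in>A. D j a)"
      using insert.hyps by (intro finsum_insert) auto
  qed (use insert.prems in auto)
qed

lemma vector_field_diff_smult:
  assumes "\<delta> \<in> vector_fields R K" "\<epsilon> \<in> vector_fields R K" "r \<in> carrier R" "K \<subseteq> carrier R"
  shows "(\<lambda>a. \<delta> a \<ominus> r \<otimes> \<epsilon> a) \<in> vector_fields R K"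
proof (rule vector_field_cong[OF vector_field_sum[OF assms(1) vector_field_smult[OF assms(2) _ assms(4)] assms(4)] _ assms(4)])
  show "\<ominus> r \<in> carrier R" using assms(3) by simp
  fix a assume "a \<in> carrier R"
  then show "\<delta> a \<ominus> r \<otimes> \<epsilon> a = \<delta> a \<oplus> \<ominus> r \<otimes> \<epsilon> a"
    using assms(3) vector_fieldsD(2)[OF assms(2)] by (simp add: minus_eq l_minus)
qed

end

section \<open>Operators on quotients and iterated derivatives\<close>

context cring
begin

lemma quotient_eq_iff:
  assumes "ideal B R" "x \<in> carrier R" "y \<in> carrier R"
  shows "B +> x = B +> y \<longleftrightarrow> x \<ominus> y \<in> B"
  using quotient_eq_iff_same_a_r_cos[OF assms] by simp

lemma carrier_quotient: "carrier (R Quot B) = (+>) B ` carrier R"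
  by (auto simp: FactRing_simps)

lemma quotient_vector_field:
  assumes B: "ideal B R" and \<delta>: "\<delta> \<in> vector_fields R K" and K: "K \<subseteq> carrier R"
    and pres: "\<And>b. b \<in> B \<Longrightarrow> \<delta> b \<in> B"
  obtains \<delta>' where "\<delta>' \<in> vector_fields (R Quot B) ((+>) B ` K)"
    and "\<And>x. x \<in> carrier R \<Longrightarrow> \<delta>' (B +> x) = B +> \<delta> x"
proof -
  interpret h: ring_hom_cring R "R Quot B" "(+>) B"
    using ideal.rcos_ring_hom_cring[OF B is_cring] .
  note vf = vector_fieldsD[OF \<delta>]
  \<comment> \<open>The value is read off an arbitrary representative; since \<open>\<delta>\<close>
    preserves \<open>B\<close>, the next fact shows that the choice is immaterial.\<close>
  define \<delta>' where "\<delta>' C = B +> \<delta> (SOME x. x \<in> carrier R \<and> B +> x = C)" for C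
  have *: "\<delta>' (B +> x) = B +> \<delta> x" if x: "x \<in> carrier R" for x
  proof -
    define y where "y = (SOME y. y \<in> carrier R \<and> B +> y = B +> x)"
    have y: "y \<in> carrier R \<and> B +> y = B +> x" unfolding y_def
      by (rule someI[of "\<lambda>y. y \<in> carrier R \<and> B +> y = B +> x" x]) (use x in simp)
    have "\<delta> (y \<ominus> x) = \<delta> y \<ominus> \<delta> x" using x y vf(2,3,6) by (simp add: minus_eq)
    moreover have "\<delta> (y \<ominus> x) \<in> B" by (rule pres) (use quotient_eq_iff[OF B, of y x] x y in simp)
    ultimately have "B +> \<delta> y = B +> \<delta> x" using quotient_eq_iff[OF B] x y vf(2) by simp
    then show ?thesis by (simp add: \<delta>'_def y_def)
  qed
  have "\<delta>' \<in> vector_fields (R Quot B) ((+>) B ` K)"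
    unfolding vector_fields_def
  proof (intro CollectI conjI ballI h.S.linear_endosI)
    fix a assume "a \<in> carrier (R Quot B)"
    then obtain x where x: "x \<in> carrier R" "a = B +> x" by (auto simp: carrier_quotient)
    then show "\<delta>' a \<in> carrier (R Quot B)" using vf(2) by (simp add: *)
    {
      fix b assume "b \<in> carrier (R Quot B)"
      then obtain y where y: "y \<in> carrier R" "b = B +> y" by (auto simp: carrier_quotient)
      have "\<delta>' (B +> (x \<oplus> y)) = (B +> \<delta> x) \<oplus>\<^bsub>R Quot B\<^esub> (B +> \<delta> y)"
        using x y vf(2,3) by (simp add: * del: h.hom_add) simp
      then show "\<delta>' (a \<oplus>\<^bsub>R Quot B\<^esub> b) = \<delta>' a \<oplus>\<^bsub>R Quot B\<^esub> \<delta>' b"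
        using x y by (simp add: *)
      have "\<delta>' (B +> (x \<otimes> y)) = (B +> x) \<otimes>\<^bsub>R Quot B\<^esub> (B +> \<delta> y) \<oplus>\<^bsub>R Quot B\<^esub> (B +> y) \<otimes>\<^bsub>R Quot B\<^esub> (B +> \<delta> x)"
        using x y vf(2,4) by (simp add: * del: h.hom_mult h.hom_add) simp
      then show "\<delta>' (a \<otimes>\<^bsub>R Quot B\<^esub> b) = a \<otimes>\<^bsub>R Quot B\<^esub> \<delta>' b \<oplus>\<^bsub>R Quot B\<^esub> b \<otimes>\<^bsub>R Quot B\<^esub> \<delta>' a"
        using x y by (simp add: *)
    }
    fix c assume "c \<in> (+>) B ` K"
    then obtain k where k: "k \<in> K" "k \<in> carrier R" "c = B +> k" using K by auto
    have "\<delta>' (B +> (k \<otimes> x)) = (B +> k) \<otimes>\<^bsub>R Quot B\<^esub> (B +> \<delta> x)"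
      using x k vf(2) linear_endos_scale[OF vf(1)] by (simp add: * del: h.hom_mult) simp
    then show "\<delta>' (c \<otimes>\<^bsub>R Quot B\<^esub> a) = c \<otimes>\<^bsub>R Quot B\<^esub> \<delta>' a"
      using x k by (simp add: *)
  qed
  then show thesis using that * by blast
qed

lemma fold_vector_fields_closed:
  assumes "\<And>l. l \<in> set ls \<Longrightarrow> D l \<in> vector_fields R K" "x \<in> carrier R"
  shows "fold D ls x \<in> carrier R"
  using assms
proof (induction ls arbitrary: x)
  case (Cons l ls)
  have "D l x \<in> carrier R" using vector_fieldsD(2) Cons.prems by (metis list.set_intros(1))
  then show ?case using Cons by simp
qed simp

text \<open>The word is carried to the quotient letter by letter rather than as one operator: it is
  then again a composite of vector fields, and its order there is at most its length.\<close>

lemma quotient_fold_vector_fields: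
  assumes B: "ideal B R" and K: "K \<subseteq> carrier R"
    and D: "\<And>l. l \<in> set ls \<Longrightarrow> D l \<in> vector_fields R K"
    and pres: "\<And>l b. l \<in> set ls \<Longrightarrow> b \<in> B \<Longrightarrow> D l b \<in> B"
  obtains \<Phi> where "\<Phi> \<in> diff_ops (R Quot B) ((+>) B ` K) (length ls)"
    and "\<And>x. x \<in> carrier R \<Longrightarrow> \<Phi> (B +> x) = B +> fold D ls x"
proof -
  interpret h: ring_hom_cring R "R Quot B" "(+>) B"
    using ideal.rcos_ring_hom_cring[OF B is_cring] .
  have "\<exists>\<delta>'. \<delta>' \<in> vector_fields (R Quot B) ((+>) B ` K) \<and>
      (\<forall>x\<in>carrier R. \<delta>' (B +> x) = B +> D l x)" if "l \<in> set ls" for l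
    using quotient_vector_field[OF B D[OF that] K pres[OF that]] by (metis (no_types, lifting))
  then obtain D' where D': "\<And>l. l \<in> set ls \<Longrightarrow> D' l \<in> vector_fields (R Quot B) ((+>) B ` K)"
      "\<And>l x. l \<in> set ls \<Longrightarrow> x \<in> carrier R \<Longrightarrow> D' l (B +> x) = B +> D l x"
    by metis
  have "fold D' ls (B +> x) = B +> fold D ls x" if "x \<in> carrier R" for x
    using D D'(2) that
  proof (induction ls arbitrary: x)
    case (Cons l ls)
    have "D l x \<in> carrier R" using vector_fieldsD(2) Cons.prems by (metis list.set_intros(1))
    then show ?case using Cons by simp
  qed simp
  moreover have "fold D' ls \<in> diff_ops (R Quot B) ((+>) B ` K) (length ls)"
    by (rule h.S.fold_vector_fields_diff_op) (use D'(1) K in auto)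
  ultimately show thesis using that by blast
qed

text \<open>In \<open>\<delta> (r \<otimes> s) = r \<otimes> \<delta> s \<oplus> s \<otimes>
  \<delta> r\<close> the second summand lies in \<open>J\<close> because \<open>s\<close> does. The
  target \<open>J\<close> is kept apart from \<open>Idl S\<close>, since it is \<open>Idl S\<close>
  when fields descend to a quotient and \<open>M\<close> when Jacobian entries are
  estimated.\<close>

lemma vector_field_ideal_into:
  assumes S: "S \<subseteq> carrier R" and \<delta>: "\<delta> \<in> vector_fields R K" and J: "ideal J R" "S \<subseteq> J"
    and "\<And>s. s \<in> S \<Longrightarrow> \<delta> s \<in> J" and b: "b \<in> Idl S"
  shows "\<delta> b \<in> J"
proof -
  interpret J: ideal J R by fact
  note vf = vector_fieldsD[OF \<delta>]
  show ?thesis using b S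
  proof (rule genideal_induct)
    show "\<delta> \<zero> \<in> J" using vf(5) by simp
    show "\<delta> (a \<oplus> b) \<in> J"
      if "a \<in> carrier R" "b \<in> carrier R" "\<delta> a \<in> J" "\<delta> b \<in> J" for a b
      using that vf(3) by simp
    fix r s assume r: "r \<in> carrier R" and s: "s \<in> S"
    have "r \<otimes> \<delta> s \<in> J" "s \<otimes> \<delta> r \<in> J"
      using r s assms(5) J(2) vf(2) by (auto intro: J.I_l_closed J.I_r_closed)
    then show "\<delta> (r \<otimes> s) \<in> J" using r s S vf(4) by (simp add: subset_eq)
  qed
qed

lemma diff_ideal_gens:
  assumes "A \<subseteq> carrier R"
  shows "{\<Phi> f |\<Phi> f. \<Phi> \<in> diff_ops R K m \<and> f \<in> A} \<subseteq> carrier R"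
  using assms linear_endos_closed[OF diff_ops_linear] by blast

lemma diff_ideal_ideal: "A \<subseteq> carrier R \<Longrightarrow> ideal (diff_ideal R K m A) R"
  unfolding diff_ideal_def by (rule genideal_ideal[OF diff_ideal_gens])

lemma diff_op_in_diff_ideal:
  "A \<subseteq> carrier R \<Longrightarrow> \<Phi> \<in> diff_ops R K m \<Longrightarrow> f \<in> A \<Longrightarrow> \<Phi> f \<in> diff_ideal R K m A"
  unfolding diff_ideal_def by (rule subsetD[OF genideal_self[OF diff_ideal_gens]]) auto

section \<open>Derivatives on the subvarieties cut out by the parameters\<close>

context
  fixes xs :: "'a list"
  assumes xs: "set xs \<subseteq> carrier R"
begin

lemma vanishing_ideal: "ideal (Idl (set (take l xs))) R"
  using xs set_take_subset[of l xs] by (intro genideal_ideal) blast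

lemma sub_hom: "ring_hom_cring R (sub_ring R xs l) (sub_class R xs l)"
  using ideal.rcos_ring_hom_cring[OF vanishing_ideal is_cring]
  by (simp add: sub_ring_def sub_class_def[abs_def])

lemma sub_ring_cring: "cring (sub_ring R xs l)"
  using ring_hom_cring.axioms(2)[OF sub_hom] .

lemma carrier_sub_ring: "carrier (sub_ring R xs l) = sub_class R xs l ` carrier R"
  by (simp add: sub_ring_def sub_class_def[abs_def] carrier_quotient)

lemma sub_class_eq_iff:
  "x \<in> carrier R \<Longrightarrow> y \<in> carrier R \<Longrightarrow>
    sub_class R xs l x = sub_class R xs l y \<longleftrightarrow> x \<ominus> y \<in> Idl (set (take l xs))"
  by (simp add: sub_class_def quotient_eq_iff[OF vanishing_ideal])

lemma sub_class_closed: "x \<in> carrier R \<Longrightarrow> sub_class R xs l x \<in> carrier (sub_ring R xs l)"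
  by (simp add: carrier_sub_ring)

lemma in_sub_class:
  assumes "x \<in> carrier R"
  shows "x \<in> sub_class R xs l x"
proof -
  interpret B: ideal "Idl (set (take l xs))" R by (rule vanishing_ideal)
  show ?thesis unfolding sub_class_def by (rule B.a_rcos_self[OF assms])
qed

lemma sub_ring_elem:
  assumes "C \<in> carrier (sub_ring R xs l)" "x \<in> C"
  shows "x \<in> carrier R" and "C = sub_class R xs l x"
proof -
  interpret B: ideal "Idl (set (take l xs))" R by (rule vanishing_ideal)
  obtain y where y: "y \<in> carrier R" "C = Idl (set (take l xs)) +> y"
    using assms(1) by (auto simp: carrier_sub_ring sub_class_def)
  then show "x \<in> carrier R" using assms(2) B.a_elemrcos_carrier by simp
  show "C = sub_class R xs l x"
    unfolding sub_class_def y(2) using B.a_repr_independence'[of x y] assms(2) y by simp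
qed

lemma sub_class_zero_iff:
  assumes "x \<in> carrier R"
  shows "sub_class R xs l x = \<zero>\<^bsub>sub_ring R xs l\<^esub> \<longleftrightarrow> x \<in> Idl (set (take l xs))"
proof -
  interpret h: ring_hom_cring R "sub_ring R xs l" "sub_class R xs l" by (rule sub_hom)
  have "sub_class R xs l \<zero> = \<zero>\<^bsub>sub_ring R xs l\<^esub>" by simp
  then show ?thesis using sub_class_eq_iff[of x \<zero> l] assms by (simp add: minus_eq)
qed

lemma iter_diff_ideal:
  assumes "I \<subseteq> carrier R" "K \<subseteq> carrier R"
  shows "ideal (iter_diff R K xs I \<beta> l) (sub_ring R xs l)"
proof (induction l)
  case 0
  show ?case unfolding iter_diff.simps
    by (rule cring.diff_ideal_ideal[OF sub_ring_cring]) (use assms sub_class_closed in auto)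
next
  case (Suc l)
  have "\<Union> (iter_diff R K xs I \<beta> l) \<subseteq> carrier R"
    using sub_ring_elem(1) ideal.Icarr[OF Suc] by blast
  then show ?case unfolding iter_diff.simps
    by (intro cring.diff_ideal_ideal[OF sub_ring_cring]) (use assms sub_class_closed in auto)
qed

text \<open>An element of the quotient ring is a coset, so the union over an ideal of cosets is the
  preimage of that ideal in \<open>R\<close>.\<close>

lemma Union_iter_diff:
  assumes "I \<subseteq> carrier R" "K \<subseteq> carrier R"
  shows "x \<in> \<Union> (iter_diff R K xs I \<beta> l) \<longleftrightarrow>
    x \<in> carrier R \<and> sub_class R xs l x \<in> iter_diff R K xs I \<beta> l"
proof
  assume "x \<in> \<Union> (iter_diff R K xs I \<beta> l)"
  then obtain C where C: "C \<in> iter_diff R K xs I \<beta> l" "x \<in> C" by blast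
  have "C \<in> carrier (sub_ring R xs l)" using ideal.Icarr[OF iter_diff_ideal[OF assms] C(1)] .
  from sub_ring_elem[OF this C(2)] C(1)
  show "x \<in> carrier R \<and> sub_class R xs l x \<in> iter_diff R K xs I \<beta> l" by simp
qed (use in_sub_class in blast)

text \<open>Fields that kill the first \<open>l\<close> parameters preserve their ideal. A word in
  such fields, evaluated in \<open>R\<close>, therefore represents the value of an operator on the
  subvariety.\<close>

lemma fold_in_diff_ideal:
  assumes K: "K \<subseteq> carrier R" and "A \<subseteq> carrier R" and l: "l \<le> length xs"
    and D: "\<And>i. i \<in> set ls \<Longrightarrow> D i \<in> vector_fields R K"
    and kill: "\<And>i m. i \<in> set ls \<Longrightarrow> m < l \<Longrightarrow> D i (xs ! m) = \<zero>" and "f \<in> A"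
  shows "sub_class R xs l (fold D ls f) \<in>
    diff_ideal (sub_ring R xs l) (sub_class R xs l ` K) (length ls) (sub_class R xs l ` A)"
proof -
  let ?B = "Idl (set (take l xs))"
  interpret B: ideal ?B R by (rule vanishing_ideal)
  have S: "set (take l xs) \<subseteq> carrier R" using xs set_take_subset[of l xs] by blast
  have pres: "D i b \<in> ?B" if i: "i \<in> set ls" and b: "b \<in> ?B" for i b
    using S D[OF i] B.ideal_axioms genideal_self[OF S] _ b
  proof (rule vector_field_ideal_into)
    fix s assume "s \<in> set (take l xs)"
    then obtain m where "m < l" "s = xs ! m" by (auto simp: in_set_conv_nth)
    then show "D i s \<in> ?B" using kill[OF i] B.zero_closed by simp
  qed
  obtain \<Phi> where \<Phi>: "\<Phi> \<in> diff_ops (R Quot ?B) ((+>) ?B ` K) (length ls)"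
      "\<And>x. x \<in> carrier R \<Longrightarrow> \<Phi> (?B +> x) = ?B +> fold D ls x"
    by (rule quotient_fold_vector_fields[OF vanishing_ideal[of l] K, of ls D])
      (rule D pres that; assumption)+
  have "\<Phi> (sub_class R xs l f) \<in>
      diff_ideal (sub_ring R xs l) (sub_class R xs l ` K) (length ls) (sub_class R xs l ` A)"
  proof (rule cring.diff_op_in_diff_ideal[OF sub_ring_cring, where \<Phi> = \<Phi>])
    show "\<Phi> \<in> diff_ops (sub_ring R xs l) (sub_class R xs l ` K) (length ls)"
      using \<Phi>(1) by (simp add: sub_ring_def sub_class_def[abs_def])
  qed (use assms sub_class_closed in auto)
  moreover have "\<Phi> (sub_class R xs l f) = sub_class R xs l (fold D ls f)"
    using \<Phi>(2)[of f] assms(2,6) by (auto simp: sub_class_def)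
  ultimately show ?thesis by simp
qed

text \<open>\<open>u l\<close> is the word of stage \<open>l\<close>, to be applied after
  restriction to \<open>V(x_1, ..., x_l)\<close>. Since its letters kill these parameters,
  differentiation can be done in \<open>R\<close> and all restrictions postponed: the derivative
  computed in \<open>R\<close> is among the representatives collected by the union in
  \<open>iter_diff\<close>.\<close>

lemma fold_in_iter_diff:
  assumes I: "I \<subseteq> carrier R" and K: "K \<subseteq> carrier R" and L: "L \<le> length xs"
    and D: "\<And>l i. l \<le> L \<Longrightarrow> i \<in> set (u l) \<Longrightarrow> D i \<in> vector_fields R K"
    and kill: "\<And>l i m. l \<le> L \<Longrightarrow> i \<in> set (u l) \<Longrightarrow> m < l \<Longrightarrow> D i (xs ! m) = \<zero>"
    and len: "\<And>l. l \<le> L \<Longrightarrow> length (u l) = \<beta> ! l" and f: "f \<in> I"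
  shows "sub_class R xs L (fold D (concat (map u [0..<Suc L])) f) \<in> iter_diff R K xs I \<beta> L"
  using L D kill len
proof (induction L)
  case 0
  show ?case
    using fold_in_diff_ideal[OF K I, of 0 "u 0" D f] 0 f by simp
next
  case (Suc L)
  let ?g = "fold D (concat (map u [0..<Suc L])) f"
  let ?A = "\<Union> (iter_diff R K xs I \<beta> L)"
  have IH: "sub_class R xs L ?g \<in> iter_diff R K xs I \<beta> L"
  proof (rule Suc.IH)
    fix l i assume "l \<le> L" "i \<in> set (u l)"
    then show "D i \<in> vector_fields R K" using Suc.prems(2)[of l i] by simp
    show "D i (xs ! m) = \<zero>" if "m < l" for m
      using Suc.prems(3)[of l i m] \<open>l \<le> L\<close> \<open>i \<in> set (u l)\<close> that by simp
  qed (use Suc.prems(1,4) in auto)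
  have g: "?g \<in> carrier R"
  proof (rule fold_vector_fields_closed[of _ D K])
    fix i assume "i \<in> set (concat (map u [0..<Suc L]))"
    then obtain l where "l < Suc L" "i \<in> set (u l)" by (auto simp del: upt_Suc)
    then show "D i \<in> vector_fields R K" using Suc.prems(2)[of l i] by simp
  qed (use I f in blast)
  have "sub_class R xs (Suc L) (fold D (u (Suc L)) ?g) \<in>
    diff_ideal (sub_ring R xs (Suc L)) (sub_class R xs (Suc L) ` K) (length (u (Suc L)))
      (sub_class R xs (Suc L) ` ?A)"
  proof (rule fold_in_diff_ideal[OF K])
    show "?A \<subseteq> carrier R" using Union_iter_diff[OF I K] by blast
    show "?g \<in> ?A" using Union_iter_diff[OF I K] g IH by blast
    show "Suc L \<le> length xs" by (rule Suc.prems(1))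
    fix i assume i: "i \<in> set (u (Suc L))"
    show "D i \<in> vector_fields R K" using Suc.prems(2)[OF order_refl i] .
    show "D i (xs ! m) = \<zero>" if "m < Suc L" for m using Suc.prems(3)[OF order_refl i that] .
  qed
  then show ?case using Suc.prems(4)[of "Suc L"] by (simp add: fold_append)
qed

text \<open>On \<open>V(x_1, ..., x_L)\<close> the first \<open>L\<close> members of
  \<open>zs\<close> vanish and, the weights being decreasing, every other weight is at most
  \<open>w ! L\<close>. So each unit of order costs at most \<open>w ! L\<close>; the alternative of
  a zero parameter in \<open>diff_op_filtration\<close> is made for this.\<close>

lemma diff_ideal_filtration:
  assumes zs: "set zs \<subseteq> carrier R" and w: "sorted_wrt (\<ge>) w" "length w = length zs"
    and L: "L < length zs" "take L zs = take L xs"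
    and A: "sub_class R xs L ` A \<subseteq> sub_class R xs L ` monomial_filtration R zs w t"
  shows "diff_ideal (sub_ring R xs L) K' m (sub_class R xs L ` A)
    \<subseteq> sub_class R xs L ` monomial_filtration R zs w (t - m * w ! L)"
proof -
  interpret h: ring_hom_cring R "sub_ring R xs L" "sub_class R xs L" by (rule sub_hom)
  have F: "monomial_filtration (sub_ring R xs L) (map (sub_class R xs L) zs) w i
      = sub_class R xs L ` monomial_filtration R zs w i" for i
    by (rule h.hom_filtration[OF zs carrier_sub_ring[symmetric]])
  have hzs: "set (map (sub_class R xs L) zs) \<subseteq> carrier (sub_ring R xs L)" using zs by auto
  have W: "w ! l \<le> w ! L \<or> map (sub_class R xs L) zs ! l = \<zero>\<^bsub>sub_ring R xs L\<^esub>"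
    if l: "l < length (map (sub_class R xs L) zs)" for l
  proof (cases "l < L")
    case True
    then have "zs ! l \<in> set (take L zs)" using L(1) by (auto simp: in_set_conv_nth)
    then have "zs ! l \<in> Idl (set (take L xs))"
      using genideal_self[of "set (take L xs)"] xs set_take_subset[of L xs] L(2) by auto
    then have "sub_class R xs L (zs ! l) = \<zero>\<^bsub>sub_ring R xs L\<^esub>"
      using sub_class_zero_iff[of "zs ! l" L] zs l by (simp add: subset_eq)
    then show ?thesis using l by simp
  next
    case False
    then show ?thesis using w l by (cases "l = L") (auto simp: sorted_wrt_iff_nth_less)
  qed
  show ?thesis
    unfolding diff_ideal_def F[symmetric]
  proof (rule h.S.genideal_minimal[OF h.S.filtration_ideal[OF hzs]], clarify)
    fix \<Phi> f assume \<Phi>: "\<Phi> \<in> diff_ops (sub_ring R xs L) K' m" and "f \<in> A"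
    then have f: "sub_class R xs L f \<in> monomial_filtration (sub_ring R xs L) (map (sub_class R xs L) zs) w t"
      unfolding F using A by blast
    show "\<Phi> (sub_class R xs L f) \<in>
        monomial_filtration (sub_ring R xs L) (map (sub_class R xs L) zs) w (t - m * w ! L)"
      using hzs W \<Phi> f by (rule h.S.diff_op_filtration)
  qed
qed

lemma iter_diff_filtration:
  assumes I: "I \<subseteq> carrier R" and K: "K \<subseteq> carrier R"
    and zs: "set zs \<subseteq> carrier R" and w: "sorted_wrt (\<ge>) w" "length w = length zs"
    and L: "L < length zs" "take L zs = take L xs" and IF: "I \<subseteq> monomial_filtration R zs w d"
  shows "iter_diff R K xs I \<beta> L \<subseteq>
    sub_class R xs L ` monomial_filtration R zs w (d - (\<Sum>i<Suc L. \<beta> ! i * w ! i))"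
  using L
proof (induction L)
  case 0
  then show ?case using diff_ideal_filtration[OF zs w 0, of I d] IF by (simp add: image_mono)
next
  case (Suc L)
  let ?t = "d - (\<Sum>i<Suc L. \<beta> ! i * w ! i)"
  let ?F = "monomial_filtration R zs w ?t"
  have tk: "take L zs = take L xs" using Suc.prems(2) by (metis min.absorb1 lessI less_imp_le take_take)
  \<comment> \<open>A representative need not lie in the filtration, but it differs from an element
    of it by an element of the ideal of the first \<open>L\<close> parameters, which also vanishes
    after the next restriction.\<close>
  have "sub_class R xs (Suc L) ` \<Union> (iter_diff R K xs I \<beta> L) \<subseteq> sub_class R xs (Suc L) ` ?F"
  proof (rule image_subsetI)
    fix x assume "x \<in> \<Union> (iter_diff R K xs I \<beta> L)"
    then have x: "x \<in> carrier R" "sub_class R xs L x \<in> iter_diff R K xs I \<beta> L"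
      using Union_iter_diff[OF I K] by auto
    then have "sub_class R xs L x \<in> sub_class R xs L ` ?F" using Suc.IH Suc.prems tk by auto
    then obtain y where y: "y \<in> ?F" "sub_class R xs L x = sub_class R xs L y" by blast
    have yc: "y \<in> carrier R" using filtration_closed[OF zs y(1)] .
    have "x \<ominus> y \<in> Idl (set (take L xs))" using sub_class_eq_iff x(1) yc y(2) by blast
    moreover have "Idl (set (take L xs)) \<subseteq> Idl (set (take (Suc L) xs))"
      using xs set_take_subset[of "Suc L" xs] set_take_subset_set_take[of L "Suc L" xs]
      by (intro subset_Idl_subset) auto
    ultimately have "sub_class R xs (Suc L) x = sub_class R xs (Suc L) y"
      using sub_class_eq_iff x(1) yc by blast
    then show "sub_class R xs (Suc L) x \<in> sub_class R xs (Suc L) ` ?F" using y(1) by simp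
  qed
  from diff_ideal_filtration[OF zs w Suc.prems this] show ?case by (simp add: add.assoc)
qed

end

end

section \<open>Parameters of the local ring\<close>

context cring
begin

lemma finsum_in_ideal:
  assumes "ideal J R" "\<And>i. i \<in> A \<Longrightarrow> f i \<in> J"
  shows "(\<Oplus>i\<in>A. f i) \<in> J"
proof -
  interpret J: ideal J R by fact
  show ?thesis using assms(2)
  proof (induction A rule: infinite_finite_induct)
    case (insert i A)
    have "f \<in> A \<rightarrow> carrier R" "f i \<in> carrier R" using insert.prems by auto
    then show ?case using insert by (simp add: finsum_insert)
  qed auto
qed

lemma finprod_in_ideal:
  assumes J: "ideal J R" and "finite A" "i \<in> A" "f i \<in> J" "\<And>k. k \<in> A \<Longrightarrow> f k \<in> carrier R"
  shows "(\<Otimes>k\<in>A. f k) \<in> J"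
proof -
  have "(\<Otimes>k\<in>insert i (A - {i}). f k) = f i \<otimes> (\<Otimes>k\<in>A - {i}. f k)"
    using assms by (intro finprod_insert) auto
  moreover have "(\<Otimes>k\<in>A - {i}. f k) \<in> carrier R" using assms(5) by (intro finprod_closed) auto
  ultimately show ?thesis using ideal.I_r_closed[OF J assms(4)] assms(3) by (simp add: insert_absorb)
qed

lemma in_genideal_insert:
  assumes "x \<in> Idl (insert g S)" "g \<in> carrier R" "S \<subseteq> carrier R"
  obtains y c where "y \<in> Idl S" "c \<in> carrier R" "x = y \<oplus> c \<otimes> g"
proof -
  interpret S: ideal "Idl S" R using assms(3) by (rule genideal_ideal)
  have "\<exists>y\<in>Idl S. \<exists>c\<in>carrier R. x = y \<oplus> c \<otimes> g"
    using assms(1)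
  proof (rule genideal_induct)
    show "\<exists>y\<in>Idl S. \<exists>c\<in>carrier R. \<zero> = y \<oplus> c \<otimes> g"
      using assms(2) by (intro bexI[of _ \<zero>]) auto
  next
    fix a b assume "\<exists>y\<in>Idl S. \<exists>c\<in>carrier R. a = y \<oplus> c \<otimes> g" "\<exists>y\<in>Idl S. \<exists>c\<in>carrier R. b = y \<oplus> c \<otimes> g"
    then obtain y c y' c' where *: "y \<in> Idl S" "c \<in> carrier R" "a = y \<oplus> c \<otimes> g"
      "y' \<in> Idl S" "c' \<in> carrier R" "b = y' \<oplus> c' \<otimes> g" by blast
    have "a \<oplus> b = (y \<oplus> y') \<oplus> (c \<oplus> c') \<otimes> g"
      using * assms(2) S.a_Hcarr by (simp add: l_distr a_ac)
    then show "\<exists>y\<in>Idl S. \<exists>c\<in>carrier R. a \<oplus> b = y \<oplus> c \<otimes> g" using * by blast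
  next
    fix r s assume r: "r \<in> carrier R" and "s \<in> insert g S"
    then consider "s = g" | "s \<in> S" by blast
    then show "\<exists>y\<in>Idl S. \<exists>c\<in>carrier R. r \<otimes> s = y \<oplus> c \<otimes> g"
    proof cases
      case 1
      then show ?thesis using r assms(2) by (intro bexI[of _ \<zero>] bexI[of _ r]) auto
    next
      case 2
      then have "r \<otimes> s \<in> Idl S" using genideal_self[OF assms(3)] r S.I_l_closed by blast
      then show ?thesis using S.a_Hcarr assms(2) by (intro bexI[of _ "r \<otimes> s"] bexI[of _ \<zero>]) auto
    qed
  qed (use assms in auto)
  then show thesis using that by blast
qed

text \<open>Subtracting \<open>E (xs ! l)\<close> times the dual field \<open>D l\<close> for all
  \<open>l \<in> A\<close> cancels the values of \<open>E\<close> on these parameters and, by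
  duality, leaves its values on the others unchanged.\<close>

lemma vector_field_project:
  assumes K: "K \<subseteq> carrier R" and xs: "set xs \<subseteq> carrier R" and E: "E \<in> vector_fields R K"
    and D: "\<And>i. i < length xs \<Longrightarrow> D i \<in> vector_fields R K"
    and dual: "\<And>i l. i < length xs \<Longrightarrow> l < length xs \<Longrightarrow> D i (xs ! l) = (if i = l then \<one> else \<zero>)"
    and A: "A \<subseteq> {..<length xs}"
  obtains F where "F \<in> vector_fields R K"
    and "\<And>a. a \<in> carrier R \<Longrightarrow> F a = E a \<ominus> (\<Oplus>l\<in>A. E (xs ! l) \<otimes> D l a)"
    and "\<And>l. l < length xs \<Longrightarrow> F (xs ! l) = (if l \<in> A then \<zero> else E (xs ! l))"
proof -
  let ?S = "\<lambda>a. \<Oplus>l\<in>A. E (xs ! l) \<otimes> D l a"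
  have fin: "finite A" using A finite_subset by blast
  have xc: "xs ! l \<in> carrier R" if "l < length xs" for l using xs that by (auto dest: nth_mem)
  have Ex: "E (xs ! l) \<in> carrier R" if "l < length xs" for l using vector_fieldsD(2)[OF E xc[OF that]] .
  have S: "?S \<in> vector_fields R K"
    by (rule vector_field_finsum[OF fin _ K], rule vector_field_smult[OF _ _ K]) (use A D Ex in auto)
  have "?S (xs ! l) = (if l \<in> A then E (xs ! l) else \<zero>)" if l: "l < length xs" for l
  proof -
    have "?S (xs ! l) = (\<Oplus>i\<in>A. if l = i then E (xs ! i) else \<zero>)"
      by (rule finsum_cong') (use A Ex dual l in auto)
    also have "\<dots> = (if l \<in> A then E (xs ! l) else \<zero>)"
    proof (cases "l \<in> A")
      case True
      then show ?thesis using finsum_singleton[OF True fin, of "\<lambda>i. E (xs ! i)"] Ex A by auto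
    next
      case False
      then have "(\<Oplus>i\<in>A. if l = i then E (xs ! i) else \<zero>) = (\<Oplus>i\<in>A. \<zero>)"
        by (intro finsum_cong') auto
      then show ?thesis using False by simp
    qed
    finally show ?thesis .
  qed
  then have val: "E (xs ! l) \<ominus> \<one> \<otimes> ?S (xs ! l) = (if l \<in> A then \<zero> else E (xs ! l))"
    if "l < length xs" for l
    using Ex that by (simp add: minus_eq r_neg)
  show thesis
  proof (rule that[OF vector_field_diff_smult[OF E S one_closed K]])
    fix a assume "a \<in> carrier R"
    then show "E a \<ominus> \<one> \<otimes> ?S a = E a \<ominus> ?S a" using vector_fieldsD(2)[OF S] by simp
  qed (rule val)
qed

text \<open>Composing the permutations with the transposition of the two equal entries only changes
  signs, so the determinant equals its negative. In a general commutative ring this gives no more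
  than that its double is zero; the factor 2 is cancelled later in characteristic zero.\<close>

lemma wedge_repeat:
  assumes ys: "set ys \<subseteq> carrier R" and ds: "length ds = length ys" "set ds \<subseteq> vector_fields R K"
    and rl: "r < length ys" "l < length ys" "r \<noteq> l" "ys ! r = ys ! l"
  shows "[(2::nat)] \<cdot> wedge_d R ys ds = \<zero>"
proof -
  let ?P = "{\<sigma>. \<sigma> permutes {..<length ys}}"
  let ?\<tau> = "Transposition.transpose r l"
  define T where "T \<sigma> = (if evenperm \<sigma> then \<one> else \<ominus> \<one>) \<otimes> (\<Otimes>i\<in>{..<length ys}. (ds ! i) (ys ! \<sigma> i))" for \<sigma>
  have c: "(ds ! i) (ys ! k) \<in> carrier R" if "i < length ys" "k < length ys" for i k
  proof -
    have "ds ! i \<in> vector_fields R K" using ds that by (auto dest: nth_mem)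
    moreover have "ys ! k \<in> carrier R" using ys that by (auto dest: nth_mem)
    ultimately show ?thesis by (rule vector_fieldsD(2))
  qed
  have \<sigma>k: "\<sigma> i < length ys" if "\<sigma> \<in> ?P" "i < length ys" for \<sigma> i
    using permutes_in_image[of \<sigma> "{..<length ys}" i] that by simp
  have prc: "(\<Otimes>i\<in>{..<length ys}. (ds ! i) (ys ! \<sigma> i)) \<in> carrier R" if "\<sigma> \<in> ?P" for \<sigma>
    by (rule finprod_closed) (use c \<sigma>k[OF that] in auto)
  have Tc: "T \<in> ?P \<rightarrow> carrier R" using prc by (auto simp: T_def)
  have \<tau>: "?\<tau> permutes {..<length ys}" using rl by (intro permutes_swap_id) auto
  have T\<tau>: "T (?\<tau> \<circ> \<sigma>) = \<ominus> \<one> \<otimes> T \<sigma>" if \<sigma>: "\<sigma> \<in> ?P" for \<sigma>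
  proof -
    have "ys ! ?\<tau> (\<sigma> i) = ys ! \<sigma> i" for i using rl(4) by (cases "\<sigma> i = r \<or> \<sigma> i = l") auto
    then have "(\<Otimes>i\<in>{..<length ys}. (ds ! i) (ys ! (?\<tau> \<circ> \<sigma>) i)) = (\<Otimes>i\<in>{..<length ys}. (ds ! i) (ys ! \<sigma> i))"
      by simp
    moreover have "evenperm (?\<tau> \<circ> \<sigma>) \<longleftrightarrow> \<not> evenperm \<sigma>"
      using rl(3) \<sigma> \<tau> by (subst evenperm_comp) (auto simp: evenperm_swap permutation_permutes)
    ultimately show ?thesis using prc[OF \<sigma>] by (simp add: T_def l_minus)
  qed
  have inj: "inj_on ((\<circ>) ?\<tau>) ?P"
  proof (rule inj_onI)
    fix \<sigma> \<rho> assume "?\<tau> \<circ> \<sigma> = ?\<tau> \<circ> \<rho>"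
    then have "?\<tau> (\<sigma> i) = ?\<tau> (\<rho> i)" for i by (metis comp_apply)
    then show "\<sigma> = \<rho>" using injD[OF permutes_inj[OF \<tau>]] by blast
  qed
  have img: "(\<circ>) ?\<tau> ` ?P = ?P" using image_compose_permutations_left[OF \<tau>] by auto
  have w: "wedge_d R ys ds = finsum R T ?P" by (simp add: wedge_d_def T_def[abs_def])
  have wc: "wedge_d R ys ds \<in> carrier R" unfolding w using Tc by (rule finsum_closed)
  have "finsum R T ((\<circ>) ?\<tau> ` ?P) = (\<Oplus>\<sigma>\<in>?P. T (?\<tau> \<circ> \<sigma>))"
    by (rule finsum_reindex) (use Tc img inj in auto)
  then have "wedge_d R ys ds = (\<Oplus>\<sigma>\<in>?P. T (?\<tau> \<circ> \<sigma>))" unfolding w img .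
  also have "\<dots> = (\<Oplus>\<sigma>\<in>?P. \<ominus> \<one> \<otimes> T \<sigma>)"
    by (rule finsum_cong') (use T\<tau> Tc in auto)
  also have "\<dots> = \<ominus> \<one> \<otimes> finsum R T ?P"
    by (rule finsum_rdistr[symmetric]) (use Tc finite_permutations in auto)
  finally have "wedge_d R ys ds = \<ominus> wedge_d R ys ds" using wc by (simp add: w l_minus)
  then have "wedge_d R ys ds \<oplus> wedge_d R ys ds = \<zero>" using wc by (metis r_neg)
  then show ?thesis using wc by (simp add: numeral_2_eq_2)
qed

text \<open>Each term of the determinant contains the entry \<open>r\<close> in exactly one factor,
  so the determinant is a linear combination of the vector fields in \<open>ds\<close> applied to
  \<open>f\<close>.\<close>

lemma wedge_vector_field:
  assumes K: "K \<subseteq> carrier R" and xs: "set xs \<subseteq> carrier R"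
    and ds: "length ds = length xs" "set ds \<subseteq> vector_fields R K" and r: "r < length xs"
  shows "(\<lambda>f. wedge_d R (xs[r := f]) ds) \<in> vector_fields R K"
proof -
  let ?P = "{\<sigma>. \<sigma> permutes {..<length xs}}"
  \<comment> \<open>The sign and the product of the other factors; entry \<open>r\<close> occurs at
    the position that \<open>\<sigma>\<close> sends to \<open>r\<close>.\<close>
  define C where "C \<sigma> = (if evenperm \<sigma> then \<one> else \<ominus> \<one>) \<otimes>
    (\<Otimes>i\<in>{..<length xs} - {inv_into UNIV \<sigma> r}. (ds ! i) (xs ! \<sigma> i))" for \<sigma>
  have dsv: "ds ! i \<in> vector_fields R K" if "i < length xs" for i using ds that by (auto dest: nth_mem)
  have c: "(ds ! i) (xs ! k) \<in> carrier R" if "i < length xs" "k < length xs" for i k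
    using vector_fieldsD(2)[OF dsv[OF that(1)]] xs that by (auto dest: nth_mem)
  have \<sigma>k: "\<sigma> i < length xs" if "\<sigma> \<in> ?P" "i < length xs" for \<sigma> i
    using permutes_in_image[of \<sigma> "{..<length xs}" i] that by simp
  have inv: "inv_into UNIV \<sigma> r < length xs" "\<sigma> i = r \<longleftrightarrow> i = inv_into UNIV \<sigma> r" if "\<sigma> \<in> ?P" for \<sigma> i
  proof -
    from that have p: "\<sigma> permutes {..<length xs}" by simp
    show "inv_into UNIV \<sigma> r < length xs" using permutes_in_image[OF permutes_inv[OF p], of r] r by simp
    show "\<sigma> i = r \<longleftrightarrow> i = inv_into UNIV \<sigma> r" using permutes_inverses[OF p] by metis
  qed
  have prc: "(\<Otimes>i\<in>{..<length xs} - {inv_into UNIV \<sigma> r}. (ds ! i) (xs ! \<sigma> i)) \<in> carrier R" if "\<sigma> \<in> ?P" for \<sigma>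
    by (rule finprod_closed) (use c \<sigma>k[OF that] in auto)
  have Cc: "C \<sigma> \<in> carrier R" if "\<sigma> \<in> ?P" for \<sigma> using prc[OF that] by (simp add: C_def)
  have "(\<lambda>f. \<Oplus>\<sigma>\<in>?P. C \<sigma> \<otimes> (ds ! inv_into UNIV \<sigma> r) f) \<in> vector_fields R K"
    by (rule vector_field_finsum[OF _ _ K], simp add: finite_permutations, rule vector_field_smult[OF _ _ K])
      (use inv dsv Cc in auto)
  moreover have "wedge_d R (xs[r := f]) ds = (\<Oplus>\<sigma>\<in>?P. C \<sigma> \<otimes> (ds ! inv_into UNIV \<sigma> r) f)"
    if f: "f \<in> carrier R" for f
    unfolding wedge_d_def length_list_update
  proof (rule finsum_cong')
    fix \<sigma> assume \<sigma>: "\<sigma> \<in> ?P"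
    let ?t = "\<lambda>i. (ds ! i) (xs[r := f] ! \<sigma> i)"
    have df: "(ds ! inv_into UNIV \<sigma> r) f \<in> carrier R" using vector_fieldsD(2)[OF dsv[OF inv(1)[OF \<sigma>]] f] .
    have t: "?t i = (if i = inv_into UNIV \<sigma> r then (ds ! i) f else (ds ! i) (xs ! \<sigma> i))" for i
      using inv(2)[OF \<sigma>, of i] r by (auto simp: nth_list_update)
    have "(\<Otimes>i\<in>insert (inv_into UNIV \<sigma> r) ({..<length xs} - {inv_into UNIV \<sigma> r}). ?t i)
        = ?t (inv_into UNIV \<sigma> r) \<otimes> (\<Otimes>i\<in>{..<length xs} - {inv_into UNIV \<sigma> r}. ?t i)"
      by (rule finprod_insert) (use c df \<sigma>k[OF \<sigma>] in \<open>auto simp: t\<close>)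
    moreover have "(\<Otimes>i\<in>{..<length xs} - {inv_into UNIV \<sigma> r}. ?t i)
        = (\<Otimes>i\<in>{..<length xs} - {inv_into UNIV \<sigma> r}. (ds ! i) (xs ! \<sigma> i))"
      by (rule finprod_cong') (use c \<sigma>k[OF \<sigma>] in \<open>auto simp: t\<close>)
    moreover have "insert (inv_into UNIV \<sigma> r) ({..<length xs} - {inv_into UNIV \<sigma> r}) = {..<length xs}"
      using inv(1)[OF \<sigma>] by auto
    ultimately have "(\<Otimes>i\<in>{..<length xs}. ?t i)
        = (ds ! inv_into UNIV \<sigma> r) f \<otimes> (\<Otimes>i\<in>{..<length xs} - {inv_into UNIV \<sigma> r}. (ds ! i) (xs ! \<sigma> i))"
      by (simp add: t)
    then show "(if evenperm \<sigma> then \<one> else \<ominus> \<one>) \<otimes> (\<Otimes>i\<in>{..<length xs}. ?t i)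
        = C \<sigma> \<otimes> (ds ! inv_into UNIV \<sigma> r) f"
      using prc[OF \<sigma>] df by (simp add: C_def m_assoc m_comm l_minus r_minus)
  qed (use Cc vector_fieldsD(2)[OF dsv[OF inv(1)] f] in auto)
  ultimately show ?thesis by (rule vector_field_cong[OF _ _ K])
qed

end

context smooth_local_ring
begin

section \<open>Units and the maximal ideal\<close>

lemma M_ideal: "ideal M R"
  using maximalideal.axioms(1)[OF maximal] .

lemma M_carrier: "M \<subseteq> carrier R"
  using ideal.Icarr[OF M_ideal] by blast

lemma M_add: "a \<in> M \<Longrightarrow> b \<in> M \<Longrightarrow> a \<oplus> b \<in> M"
  using additive_subgroup.a_closed[OF ideal.axioms(1)[OF M_ideal]] .

lemma M_lmult: "a \<in> M \<Longrightarrow> r \<in> carrier R \<Longrightarrow> r \<otimes> a \<in> M"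
  using ideal.I_l_closed[OF M_ideal] .

lemma M_zero: "\<zero> \<in> M"
  using additive_subgroup.zero_closed[OF ideal.axioms(1)[OF M_ideal]] .

lemma one_notin_M: "\<one> \<notin> M"
  using ideal.one_imp_carrier[OF M_ideal] maximalideal.I_notcarr[OF maximal] by blast

lemma unit_notin_M:
  assumes "x \<in> Units R"
  shows "x \<notin> M"
proof
  assume "x \<in> M"
  then have "inv x \<otimes> x \<in> M" by (rule M_lmult) (use assms in simp)
  then show False using assms one_notin_M by simp
qed

lemma notin_M_unit:
  assumes x: "x \<in> carrier R" "x \<notin> M"
  shows "x \<in> Units R"
proof (rule ccontr)
  assume nu: "x \<notin> Units R"
  define A where "A = {N. ideal N R \<and> PIdl x \<subseteq> N \<and> \<one> \<notin> N}"
  have "\<one> \<notin> PIdl x"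
  proof
    assume "\<one> \<in> PIdl x"
    then obtain y where "y \<in> carrier R" "\<one> = y \<otimes> x" by (auto simp: cgenideal_def)
    then show False using nu x m_comm by (auto simp: Units_def)
  qed
  then have "A \<noteq> {}" using cgenideal_ideal[OF x(1)] unfolding A_def by blast
  \<comment> \<open>As \<open>R\<close> is noetherian, the union of a nonempty chain of ideals is a
    member of the chain.\<close>
  moreover have "\<Union> C \<in> A" if "C \<noteq> {}" "subset.chain A C" for C
  proof -
    have "subset.chain {N. ideal N R} C" using that(2) by (auto simp: pred_on.chain_def A_def)
    then have "\<Union> C \<in> C" using ideal_chain_is_trivial that(1) by blast
    then show ?thesis using that(2) unfolding pred_on.chain_def by blast
  qed
  ultimately have "\<exists>N\<in>A. \<forall>N'\<in>A. N \<subseteq> N' \<longrightarrow> N' = N"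
    by (rule subset_Zorn_nonempty)
  then obtain N where N: "N \<in> A" "\<And>N'. N' \<in> A \<Longrightarrow> N \<subseteq> N' \<Longrightarrow> N' = N"
    by blast
  have "maximalideal N R"
  proof (rule maximalidealI)
    show "ideal N R" using N(1) by (simp add: A_def)
    show "carrier R \<noteq> N" using N(1) by (auto simp: A_def)
    fix N' assume N': "ideal N' R" "N \<subseteq> N'" "N' \<subseteq> carrier R"
    show "N' = N \<or> N' = carrier R"
    proof (cases "\<one> \<in> N'")
      case True
      then show ?thesis using ideal.one_imp_carrier[OF N'(1)] by blast
    next
      case False
      then have "N' \<in> A" using N(1) N'(1,2) by (auto simp: A_def)
      then have "N' = N" using N(2) N'(2) by blast
      then show ?thesis ..
    qed
  qed
  then have "N = M" by (rule maximal_unique)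
  then show False using N(1) x(2) cgenideal_self[OF x(1)] by (auto simp: A_def)
qed

lemma notin_M_mult:
  assumes "x \<in> carrier R" "x \<notin> M" "y \<in> carrier R" "y \<notin> M"
  shows "x \<otimes> y \<notin> M"
  using notin_M_unit unit_notin_M Units_m_closed assms by blast

lemma notin_M_add:
  assumes "x \<in> carrier R" "x \<notin> M" "y \<in> M"
  shows "x \<oplus> y \<notin> M"
proof
  assume "x \<oplus> y \<in> M"
  then have "x \<oplus> y \<oplus> \<ominus> y \<in> M"
    by (rule M_add) (use assms(3) additive_subgroup.a_inv_closed[OF ideal.axioms(1)[OF M_ideal]] in blast)
  then show False using assms M_carrier by (auto simp: a_assoc r_neg subset_eq)
qed

lemma finprod_notin_M:
  assumes "finite A" "\<And>i. i \<in> A \<Longrightarrow> f i \<in> carrier R" "\<And>i. i \<in> A \<Longrightarrow> f i \<notin> M"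
  shows "(\<Otimes>i\<in>A. f i) \<notin> M"
  using assms
proof (induction A rule: finite_induct)
  case empty
  then show ?case using one_notin_M by simp
next
  case (insert i A)
  have c: "(\<Otimes>i\<in>A. f i) \<in> carrier R" by (rule finprod_closed) (use insert in auto)
  have "(\<Otimes>k\<in>insert i A. f k) = f i \<otimes> (\<Otimes>k\<in>A. f k)"
    by (rule finprod_insert) (use insert in auto)
  then show ?case using notin_M_mult[OF _ _ c] insert by simp
qed

lemma K_carrier: "K \<subseteq> carrier R"
  using subfieldE(3)[OF base_field] .

text \<open>A positive integer lies in the field \<open>K\<close> and is nonzero there, so its
  inverse in \<open>K\<close> makes it a unit of \<open>R\<close>.\<close>

lemma nat_notin_M:
  assumes "0 < (m::nat)"
  shows "[m] \<cdot> \<one> \<notin> M"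
proof -
  have sub: "subring K R" using subfieldE(1)[OF base_field] .
  have "[k] \<cdot> \<one> \<in> K" for k :: nat
    by (induction k) (use subringE(2,3,7)[OF sub] in auto)
  then have k: "[m] \<cdot> \<one> \<in> K - {\<zero>}" using char_zero[OF assms] by blast
  have c: "[m] \<cdot> \<one> \<in> carrier R" "inv ([m] \<cdot> \<one>) \<in> carrier R"
    using subfield_m_inv(1)[OF base_field k] k K_carrier by auto
  then have "[m] \<cdot> \<one> \<in> Units R"
    using subfield_m_inv(2,3)[OF base_field k] unfolding Units_def by blast
  then show ?thesis by (rule unit_notin_M)
qed

lemma nat_mult_zero:
  assumes "0 < (m::nat)" "x \<in> carrier R" "[m] \<cdot> x = \<zero>"
  shows "x = \<zero>"
proof -
  have "([m] \<cdot> \<one>) \<otimes> x = \<zero>" using assms by (simp add: add_pow_ldistr)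
  moreover have "[m] \<cdot> \<one> \<in> Units R" using notin_M_unit nat_notin_M[OF assms(1)] by simp
  ultimately show ?thesis
    using assms(2) by (metis Units_closed Units_l_cancel r_null zero_closed)
qed

text \<open>A Jacobian matrix that is upper triangular modulo \<open>M\<close> suffices: every permutation other than
  the identity meets an entry below the diagonal.\<close>

lemma parametersI:
  assumes xs: "set xs \<subseteq> M"
    and D: "\<And>i. i < length xs \<Longrightarrow> D i \<in> vector_fields R K"
    and lower: "\<And>i l. i < length xs \<Longrightarrow> l < i \<Longrightarrow> D i (xs ! l) \<in> M"
    and diag: "\<And>i. i < length xs \<Longrightarrow> D i (xs ! i) \<notin> M"
  shows "parameters R K M xs"
proof -
  let ?ds = "map D [0..<length xs]" and ?P = "{\<sigma>. \<sigma> permutes {..<length xs}}"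
  define T where "T \<sigma> = (if evenperm \<sigma> then \<one> else \<ominus> \<one>) \<otimes> (\<Otimes>i\<in>{..<length xs}. (?ds ! i) (xs ! \<sigma> i))" for \<sigma>
  have xc: "xs ! l \<in> carrier R" if "l < length xs" for l
    using xs M_carrier that by (auto dest: nth_mem)
  have c: "(?ds ! i) (xs ! k) \<in> carrier R" if "i < length xs" "k < length xs" for i k
    using vector_fieldsD(2)[OF D[OF that(1)] xc[OF that(2)]] that by simp
  have \<sigma>k: "\<sigma> i < length xs" if "\<sigma> \<in> ?P" "i < length xs" for \<sigma> i
    using permutes_in_image[of \<sigma> "{..<length xs}" i] that by simp
  have prc: "(\<Otimes>i\<in>{..<length xs}. (?ds ! i) (xs ! \<sigma> i)) \<in> carrier R" if "\<sigma> \<in> ?P" for \<sigma>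
    by (rule finprod_closed) (use c \<sigma>k[OF that] in auto)
  have Tc: "T \<sigma> \<in> carrier R" if "\<sigma> \<in> ?P" for \<sigma> using prc[OF that] by (simp add: T_def)
  have TM: "T \<sigma> \<in> M" if \<sigma>: "\<sigma> \<in> ?P - {id}" for \<sigma>
  proof -
    have "\<exists>i\<in>{..<length xs}. \<sigma> i < i"
    proof (rule ccontr)
      assume "\<not> (\<exists>i\<in>{..<length xs}. \<sigma> i < i)"
      then have "\<sigma> = id" using \<sigma> permutes_natset_ge[of \<sigma> "{..<length xs}"] by (auto simp: not_less)
      then show False using \<sigma> by blast
    qed
    then obtain i where i: "i < length xs" "\<sigma> i < i" by blast
    have "(\<Otimes>i\<in>{..<length xs}. (?ds ! i) (xs ! \<sigma> i)) \<in> M"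
      by (rule finprod_in_ideal[OF M_ideal, of _ i]) (use i lower c \<sigma>k \<sigma> in auto)
    then show ?thesis unfolding T_def by (rule M_lmult) auto
  qed
  have "(\<Otimes>i\<in>{..<length xs}. (?ds ! i) (xs ! id i)) \<notin> M"
    by (rule finprod_notin_M) (use c diag in auto)
  then have id: "T id \<notin> M" using prc[of id] by (simp add: T_def permutes_id)
  have "wedge_d R xs ?ds = finsum R T (insert id (?P - {id}))"
    by (simp add: wedge_d_def T_def[abs_def] insert_absorb permutes_id)
  also have "\<dots> = T id \<oplus> finsum R T (?P - {id})"
    by (rule finsum_insert) (use Tc in \<open>auto simp: finite_permutations permutes_id\<close>)
  finally have w: "wedge_d R xs ?ds = T id \<oplus> finsum R T (?P - {id})" .
  have "finsum R T (?P - {id}) \<in> M" by (rule finsum_in_ideal[OF M_ideal TM])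
  then have "wedge_d R xs ?ds \<notin> M"
    unfolding w using Tc[of id] id by (intro notin_M_add) (auto simp: permutes_id)
  then show ?thesis unfolding parameters_def using xs D
    by (intro conjI exI[of _ ?ds]) auto
qed

text \<open>Cramer's rule: replacing \<open>x\<^sub>r\<close> by \<open>f\<close> in the Jacobian determinant is a derivation in \<open>f\<close>.\<close>

lemma parameters_dual:
  assumes "parameters R K M xs"
  obtains D where "\<And>i. i < length xs \<Longrightarrow> D i \<in> vector_fields R K"
    and "\<And>i l. i < length xs \<Longrightarrow> l < length xs \<Longrightarrow> D i (xs ! l) = (if i = l then \<one> else \<zero>)"
proof -
  obtain ds where ds: "length ds = length xs" "set ds \<subseteq> vector_fields R K" "wedge_d R xs ds \<notin> M"
    and "set xs \<subseteq> M" using assms by (auto simp: parameters_def)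
  then have xs: "set xs \<subseteq> carrier R" using M_carrier by blast
  let ?u = "wedge_d R xs ds"
  let ?E = "\<lambda>r f. wedge_d R (xs[r := f]) ds"
  have xc: "xs ! l \<in> carrier R" if "l < length xs" for l
    using xs that by (auto dest: nth_mem)
  have vf: "?E r \<in> vector_fields R K" if "r < length xs" for r
    using wedge_vector_field[OF K_carrier xs ds(1,2) that] .
  \<comment> \<open>Replacing \<open>x_r\<close> by itself returns the Jacobian, which is thus a
    value of the derivation \<open>?E r\<close>.\<close>
  have uc: "?u \<in> carrier R" if "r < length xs" for r
    using vector_fieldsD(2)[OF vf[OF that] xc[OF that]] by simp
  define D where "D r = (\<lambda>f. inv ?u \<otimes> ?E r f)" for r
  show thesis
  proof (rule that)
    fix r assume r: "r < length xs"
    have u: "?u \<in> Units R" using notin_M_unit[OF uc[OF r] ds(3)] .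
    show "D r \<in> vector_fields R K"
      unfolding D_def by (rule vector_field_smult[OF vf[OF r] _ K_carrier]) (use u in simp)
    fix l assume l: "l < length xs"
    show "D r (xs ! l) = (if r = l then \<one> else \<zero>)"
    proof (cases "r = l")
      case True
      then show ?thesis using u by (simp add: D_def)
    next
      case False
      let ?ys = "xs[r := xs ! l]"
      have "[(2::nat)] \<cdot> wedge_d R ?ys ds = \<zero>"
      proof (rule wedge_repeat[where r = r and l = l])
        show "set ?ys \<subseteq> carrier R" using set_update_subset_insert[of xs r "xs ! l"] xs xc[OF l] by blast
      qed (use ds r l False in auto)
      then have "?E r (xs ! l) = \<zero>"
        using nat_mult_zero[of 2] vector_fieldsD(2)[OF vf[OF r] xc[OF l]] by simp
      then show ?thesis using False u by (simp add: D_def)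
    qed
  qed
qed

text \<open>Steinitz exchange, with a derivation as witness. If in an expression of \<open>x\<close>
  by \<open>S\<close> and \<open>G\<close> all coefficients of members of \<open>G\<close> were in
  \<open>M\<close>, then \<open>D x\<close> would be in \<open>M\<close>. So one of them is a unit,
  and the equation can be solved for its generator. The induction peels off one \<open>g\<close>: if
  its coefficient is in \<open>M\<close>, the remainder \<open>y\<close> still has
  \<open>D y \<notin> M\<close>, and \<open>y\<close> is \<open>x\<close> minus a multiple of
  \<open>g\<close>.\<close>

lemma exchange:
  assumes "finite G" and S: "S \<subseteq> M" and "G \<subseteq> M" and D: "D \<in> vector_fields R K"
    and DS: "\<And>s. s \<in> S \<Longrightarrow> D s \<in> M" and "x \<in> Idl (S \<union> G)" "D x \<notin> M"
  shows "\<exists>g\<in>G. g \<in> Idl (insert x S \<union> (G - {g}))"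
  using assms(1,3,6,7)
proof (induction G arbitrary: x rule: finite_induct)
  case empty
  have "D x \<in> M"
    using vector_field_ideal_into[OF _ D M_ideal S DS, of x] S M_carrier empty by auto
  then show ?case using empty by blast
next
  case (insert g G)
  have SG: "S \<union> G \<subseteq> carrier R" "g \<in> carrier R" using S insert.prems(1) M_carrier by auto
  obtain y c where yc: "y \<in> Idl (S \<union> G)" "c \<in> carrier R" "x = y \<oplus> c \<otimes> g"
    using in_genideal_insert[of x g "S \<union> G"] insert.prems(2) SG by auto
  have y: "y \<in> carrier R" using yc(1) ideal.Icarr[OF genideal_ideal[OF SG(1)]] by blast
  have x: "x \<in> carrier R" using yc y SG by simp
  have yx: "y = x \<oplus> \<ominus> c \<otimes> g"
    using y yc(2) SG(2) unfolding yc(3) by (simp add: a_assoc l_minus r_neg)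
  show ?case
  proof (cases "c \<in> M")
    case False
    then have u: "c \<in> Units R" using notin_M_unit yc(2) by blast
    let ?J = "Idl (insert x S \<union> G)"
    have Jc: "insert x S \<union> G \<subseteq> carrier R" using SG x by auto
    interpret J: ideal ?J R using Jc by (rule genideal_ideal)
    have "x \<in> ?J" using genideal_self[OF Jc] by blast
    moreover have "y \<in> ?J" using yc(1) subset_Idl_subset[OF Jc, of "S \<union> G"] by blast
    ultimately have "x \<oplus> \<ominus> y \<in> ?J" by (intro J.a_closed J.a_inv_closed)
    moreover have "x \<oplus> \<ominus> y = c \<otimes> g"
      using y yc(2) SG(2) unfolding yc(3) by (simp add: a_comm[of y] a_assoc r_neg)
    ultimately have "c \<otimes> g \<in> ?J" by (simp only:)
    then have "inv c \<otimes> (c \<otimes> g) \<in> ?J" by (rule J.I_l_closed[OF _ Units_inv_closed[OF u]])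
    then have "g \<in> ?J" using u yc(2) SG(2) by (simp add: m_assoc[symmetric])
    moreover have "insert g G - {g} = G" using insert.hyps by blast
    ultimately show ?thesis by auto
  next
    case True
    note vf = vector_fieldsD[OF D]
    have "D (c \<otimes> g) = c \<otimes> D g \<oplus> g \<otimes> D c" using vf(4) yc(2) SG(2) by simp
    also have "\<dots> \<in> M"
      using True insert.prems(1) yc(2) SG(2) vf(2) by (simp add: M_add M_lmult m_comm[of c] m_comm[of g])
    finally have cg: "D (c \<otimes> g) \<in> M" .
    have "D y \<notin> M"
    proof
      assume "D y \<in> M"
      then have "D x \<in> M" using cg vf(3)[of y "c \<otimes> g"] y yc SG(2) M_add by simp
      then show False using insert.prems by blast
    qed
    then obtain h where h: "h \<in> G" "h \<in> Idl (insert y S \<union> (G - {h}))"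
      using insert.IH[OF _ yc(1)] insert.prems(1) by blast
    let ?T = "insert x S \<union> (insert g G - {h})"
    have Tc: "?T \<subseteq> carrier R" using SG x by auto
    interpret T: ideal "Idl ?T" R using Tc by (rule genideal_ideal)
    have gx: "g \<in> Idl ?T" "x \<in> Idl ?T" using genideal_self[OF Tc] h(1) insert.hyps by auto
    have "y \<in> Idl ?T" unfolding yx by (intro T.a_closed T.I_l_closed gx a_inv_closed yc(2))
    then have "Idl (insert y S \<union> (G - {h})) \<subseteq> Idl ?T"
      using genideal_self[OF Tc] by (intro genideal_minimal T.ideal_axioms) auto
    then show ?thesis using h by blast
  qed
qed

lemma parameters_carrier: "parameters R K M xs \<Longrightarrow> set xs \<subseteq> carrier R"
  using M_carrier by (auto simp: parameters_def)

lemma system_generates: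
  assumes ys: "parameters R K M ys" and n: "length ys = n"
  shows "Idl (set ys) = M"
proof -
  obtain D where D: "\<And>i. i < n \<Longrightarrow> D i \<in> vector_fields R K"
      "\<And>i l. i < n \<Longrightarrow> l < n \<Longrightarrow> D i (ys ! l) = (if i = l then \<one> else \<zero>)"
    using parameters_dual[OF ys] n by metis
  have ysM: "set ys \<subseteq> M" using ys by (simp add: parameters_def)
  have "\<exists>G. finite G \<and> G \<subseteq> M \<and> card G \<le> n - t \<and> Idl (set (take t ys) \<union> G) = M" if "t \<le> n" for t
    using that
  proof (induction t)
    case 0
    obtain gs where gs: "length gs = n" "set gs \<subseteq> carrier R" "M = Idl (set gs)" using regular by blast
    then have "set gs \<subseteq> M" using genideal_self by blast
    moreover have "card (set gs) \<le> n" using gs(1) card_length by blast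
    ultimately show ?case using gs(3) by (intro exI[of _ "set gs"]) simp
  next
    case (Suc t)
    then obtain G where G: "finite G" "G \<subseteq> M" "card G \<le> n - t" "Idl (set (take t ys) \<union> G) = M" by auto
    let ?x = "ys ! t" and ?S = "set (take t ys)"
    have t: "t < n" using Suc.prems by simp
    have S: "?S \<subseteq> M" using ysM set_take_subset[of t ys] by blast
    have xM: "?x \<in> M" using ysM t n by (auto dest: nth_mem)
    have "\<exists>g\<in>G. g \<in> Idl (insert ?x ?S \<union> (G - {g}))"
    proof (rule exchange[OF G(1) S G(2) D(1)[OF t]])
      fix s assume "s \<in> ?S"
      then obtain i where "i < t" "s = ys ! i" using n t by (auto simp: in_set_conv_nth)
      then show "D t s \<in> M" using D(2)[OF t, of i] t M_zero by simp
    next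
      show "?x \<in> Idl (?S \<union> G)" using G(4) xM by simp
      show "D t ?x \<notin> M" using D(2)[OF t t] one_notin_M by simp
    qed
    then obtain g where g: "g \<in> G" "g \<in> Idl (insert ?x ?S \<union> (G - {g}))" by blast
    let ?T = "insert ?x ?S \<union> (G - {g})"
    have TM: "?T \<subseteq> M" using S xM G(2) by blast
    then have Tc: "?T \<subseteq> carrier R" using M_carrier by blast
    have "Idl ?T = M"
    proof
      show "Idl ?T \<subseteq> M" using TM by (rule genideal_minimal[OF M_ideal])
      have "?S \<union> G \<subseteq> Idl ?T" using genideal_self[OF Tc] g(2) by auto
      then show "M \<subseteq> Idl ?T" using genideal_minimal[OF genideal_ideal[OF Tc]] G(4) by blast
    qed
    moreover have "set (take (Suc t) ys) = insert ?x ?S" using t n by (simp add: take_Suc_conv_app_nth)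
    moreover have "card (G - {g}) \<le> n - Suc t" using G(1,3) g(1) by simp
    ultimately show ?case using G by (intro exI[of _ "G - {g}"]) auto
  qed
  from this[of n] show ?thesis using n by auto
qed

text \<open>A full system is turned, place by place, into one that starts with \<open>xs\<close>.
  Vector fields dual to the current system are updated along with it, and they certify that the new
  list consists of parameters.\<close>

lemma extend_parameters:
  assumes ys: "parameters R K M ys" "length ys = n" and xs: "parameters R K M xs" "length xs \<le> n"
  obtains zs where "parameters R K M zs" "length zs = n" "take (length xs) zs = xs"
proof -
  have "\<exists>zs. parameters R K M zs \<and> length zs = n \<and> take t zs = take t xs" if "t \<le> length xs" for t
    using that
  proof (induction t)
    case 0
    then show ?case using ys by auto
  next
    case (Suc t)
    then obtain zs where zs: "parameters R K M zs" "length zs = n" "take t zs = take t xs" by auto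
    have t: "t < length xs" "t < n" using Suc.prems xs(2) by auto
    obtain D where D: "\<And>i. i < length xs \<Longrightarrow> D i \<in> vector_fields R K"
      "\<And>i l. i < length xs \<Longrightarrow> l < length xs \<Longrightarrow> D i (xs ! l) = (if i = l then \<one> else \<zero>)"
      using parameters_dual[OF xs(1)] by metis
    obtain E where E: "\<And>i. i < n \<Longrightarrow> E i \<in> vector_fields R K"
      "\<And>i l. i < n \<Longrightarrow> l < n \<Longrightarrow> E i (zs ! l) = (if i = l then \<one> else \<zero>)"
      using parameters_dual[OF zs(1)] zs(2) by metis
    let ?x = "xs ! t"
    have xM: "?x \<in> M" using xs(1) t by (auto simp: parameters_def dest: nth_mem)
    have x: "?x \<in> carrier R" using xM M_carrier by blast
    have zsM: "set zs \<subseteq> M" using zs(1) by (simp add: parameters_def)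
    have zc: "zs ! l \<in> carrier R" if "l < n" for l using zsM M_carrier zs(2) that by (auto dest: nth_mem)
    have Ex: "E l ?x \<in> carrier R" if "l < n" for l using vector_fieldsD(2)[OF E(1)[OF that] x] .
    have pre: "zs ! l = xs ! l" if "l < t" for l using zs(3) that by (metis nth_take)
    \<comment> \<open>Otherwise correct \<open>D t\<close> by the \<open>E l\<close> with
      \<open>t \<le> l\<close> so that it kills these \<open>zs ! l\<close>; it kills the earlier
      ones already, as they belong to \<open>xs\<close>. The corrected field maps \<open>M\<close>,
      the ideal of \<open>zs\<close>, into \<open>M\<close>. The correction at \<open>?x\<close> is
      in \<open>M\<close> as well, so \<open>D t ?x\<close>, which is 1, would lie in
      \<open>M\<close>.\<close>
    have "\<exists>l. t \<le> l \<and> l < n \<and> E l ?x \<notin> M"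
    proof (rule ccontr)
      assume "\<not> (\<exists>l. t \<le> l \<and> l < n \<and> E l ?x \<notin> M)"
      then have EM: "E l ?x \<in> M" if "l \<in> {t..<n}" for l using that by auto
      obtain F where F: "F \<in> vector_fields R K"
        "\<And>a. a \<in> carrier R \<Longrightarrow> F a = D t a \<ominus> (\<Oplus>l\<in>{t..<n}. D t (zs ! l) \<otimes> E l a)"
        "\<And>l. l < n \<Longrightarrow> F (zs ! l) = (if l \<in> {t..<n} then \<zero> else D t (zs ! l))"
      proof (rule vector_field_project[OF K_carrier parameters_carrier[OF zs(1)] D(1)[OF t(1)], of E "{t..<n}"])
        show "E i \<in> vector_fields R K" if "i < length zs" for i using E(1) zs(2) that by simp
        show "E i (zs ! l) = (if i = l then \<one> else \<zero>)" if "i < length zs" "l < length zs" for i l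
          using E(2) zs(2) that by simp
        show "{t..<n} \<subseteq> {..<length zs}" using zs(2) by auto
      qed (use zs(2) in blast)
      have "F (zs ! l) = \<zero>" if "l < n" for l
        using F(3)[OF that] pre[of l] D(2)[OF t(1), of l] t that by auto
      then have "F s \<in> M" if "s \<in> set zs" for s
        using that zs(2) M_zero by (auto simp: in_set_conv_nth)
      moreover have "?x \<in> Idl (set zs)" using system_generates[OF zs(1,2)] xM by simp
      ultimately have FM: "F ?x \<in> M"
        using vector_field_ideal_into[OF parameters_carrier[OF zs(1)] F(1) M_ideal zsM] by blast
      let ?S = "\<Oplus>l\<in>{t..<n}. D t (zs ! l) \<otimes> E l ?x"
      have SM: "?S \<in> M"
        by (rule finsum_in_ideal[OF M_ideal]) (use EM zc vector_fieldsD(2)[OF D(1)[OF t(1)]] in \<open>auto intro: M_lmult\<close>)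
      have Dx: "D t ?x \<in> carrier R" using vector_fieldsD(2)[OF D(1)[OF t(1)] x] .
      have "F ?x \<oplus> ?S = D t ?x"
        using F(2)[OF x] Dx SM M_carrier by (auto simp: minus_eq a_assoc l_neg)
      then show False using M_add[OF FM SM] D(2)[OF t(1) t(1)] one_notin_M by simp
    qed
    then obtain l where l: "t \<le> l" "l < n" "E l ?x \<notin> M" by blast
    have u: "E l ?x \<in> Units R" using notin_M_unit[OF Ex[OF l(2)] l(3)] .
    let ?\<sigma> = "Transposition.transpose t l"
    \<comment> \<open>The old member at place \<open>t\<close> moves to place \<open>l\<close>,
      whose own member is dropped. The update at \<open>t\<close> comes second, so
      \<open>l = t\<close> is covered too.\<close>
    let ?zs = "zs[l := zs ! t, t := ?x]"
    \<comment> \<open>After the swap \<open>E l\<close> belongs to \<open>?x\<close>; from each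
      other field the multiple of \<open>E l\<close> is subtracted that makes it vanish at
      \<open>?x\<close>.\<close>
    define E' where "E' p = (if p = t then E l
      else (\<lambda>a. E (?\<sigma> p) a \<ominus> (E (?\<sigma> p) ?x \<otimes> inv (E l ?x)) \<otimes> E l a))" for p
    have \<sigma>n: "?\<sigma> p < n" if "p < n" for p using that l t by (auto simp: transpose_def)
    have zs': "?zs ! q = (if q = t then ?x else zs ! ?\<sigma> q)" if "q < n" for q
      using that l t zs(2) by (auto simp: nth_list_update transpose_def)
    have vf: "E' p \<in> vector_fields R K" if "p < n" for p
      unfolding E'_def using that \<sigma>n[OF that] E(1) Ex l(2) u
      by (auto intro!: vector_field_diff_smult[OF _ _ _ K_carrier])
    have dual: "E' p (?zs ! q) = (if p = q then if p = t then E l ?x else \<one> else \<zero>)"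
      if "p < n" "q < n" for p q
    proof (cases "p = t")
      case True
      then show ?thesis using that E(2)[OF l(2) \<sigma>n[OF that(2)]] zs'[OF that(2)]
        by (auto simp: E'_def transpose_def split: if_splits)
    next
      case False
      show ?thesis
      proof (cases "q = t")
        case True
        have "(E (?\<sigma> p) ?x \<otimes> inv (E l ?x)) \<otimes> E l ?x = E (?\<sigma> p) ?x"
          using Ex[OF \<sigma>n[OF that(1)]] Ex[OF l(2)] u by (simp add: m_assoc)
        then show ?thesis using False True that zs'[OF that(2)] Ex[OF \<sigma>n[OF that(1)]]
          by (simp add: E'_def minus_eq r_neg)
      next
        case q: False
        have "E l (zs ! ?\<sigma> q) = \<zero>" using E(2)[OF l(2) \<sigma>n[OF that(2)]] q
          by (auto simp: transpose_def split: if_splits)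
        moreover have "E (?\<sigma> p) (zs ! ?\<sigma> q) = (if p = q then \<one> else \<zero>)"
          using E(2)[OF \<sigma>n[OF that(1)] \<sigma>n[OF that(2)]] by (simp add: inj_eq)
        ultimately show ?thesis using False q zs'[OF that(2)] Ex[OF \<sigma>n[OF that(1)]] u
          by (auto simp: E'_def minus_eq)
      qed
    qed
    have "set ?zs \<subseteq> M"
    proof
      fix z assume "z \<in> set ?zs"
      then obtain q where q: "q < n" "z = ?zs ! q" using zs(2) by (auto simp: in_set_conv_nth)
      then show "z \<in> M" using zs'[OF q(1)] xM zsM zs(2) \<sigma>n[OF q(1)] by (auto dest: nth_mem)
    qed
    then have "parameters R K M ?zs"
    proof (rule parametersI)
      fix i assume i: "i < length ?zs"
      show "E' i \<in> vector_fields R K" using vf i zs(2) by simp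
      show "E' i (?zs ! i) \<notin> M" using dual[of i i] i zs(2) l(3) one_notin_M by auto
      show "E' i (?zs ! q) \<in> M" if "q < i" for q using dual[of i q] i zs(2) that M_zero by simp
    qed
    moreover have "take (Suc t) ?zs = take (Suc t) xs"
    proof (rule nth_equalityI)
      show "length (take (Suc t) ?zs) = length (take (Suc t) xs)" using t zs(2) by simp
      fix i assume "i < length (take (Suc t) ?zs)"
      then have i: "i \<le> t" "i < n" using zs(2) by auto
      then show "take (Suc t) ?zs ! i = take (Suc t) xs ! i"
        using zs'[OF i(2)] pre[of i] l(1) by (cases "i = t") (auto simp: transpose_def)
    qed
    ultimately show ?case using zs(2) by auto
  qed
  from this[OF order_refl] show thesis using that by auto
qed

text \<open>The fields along the later members of \<open>ys\<close> kill the earlier ones, hence map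
  \<open>xs\<close> into \<open>M\<close>. Together with the fields dual to \<open>xs\<close> they
  give a Jacobian that is triangular modulo \<open>M\<close>.\<close>

lemma replace_initial_parameters:
  assumes ys: "parameters R K M ys" and xs: "parameters R K M xs" and len: "length xs \<le> length ys"
    and sub: "set xs \<subseteq> Idl (set (take (length xs) ys))"
  shows "parameters R K M (xs @ drop (length xs) ys)"
proof -
  let ?j = "length xs" and ?n = "length ys"
  obtain D where D: "\<And>i. i < ?j \<Longrightarrow> D i \<in> vector_fields R K"
    "\<And>i l. i < ?j \<Longrightarrow> l < ?j \<Longrightarrow> D i (xs ! l) = (if i = l then \<one> else \<zero>)"
    using parameters_dual[OF xs] by metis
  obtain E where E: "\<And>i. i < ?n \<Longrightarrow> E i \<in> vector_fields R K"
    "\<And>i l. i < ?n \<Longrightarrow> l < ?n \<Longrightarrow> E i (ys ! l) = (if i = l then \<one> else \<zero>)"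
    using parameters_dual[OF ys] by metis
  have xsM: "set xs \<subseteq> M" and ysM: "set ys \<subseteq> M" using xs ys by (auto simp: parameters_def)
  have tk: "set (take ?j ys) \<subseteq> M" using ysM set_take_subset[of ?j ys] by blast
  have yc: "ys ! l \<in> carrier R" if "l < ?n" for l
    using ysM M_carrier that by (auto dest: nth_mem)
  have EM: "E m (xs ! l) \<in> M" if "?j \<le> m" "m < ?n" "l < ?j" for m l
  proof (rule vector_field_ideal_into[OF _ E(1)[OF that(2)] M_ideal tk])
    show "set (take ?j ys) \<subseteq> carrier R" using tk M_carrier by blast
    show "xs ! l \<in> Idl (set (take ?j ys))" using sub that(3) by (auto dest: nth_mem)
    fix s assume "s \<in> set (take ?j ys)"
    then obtain i where "i < ?j" "s = ys ! i" using len by (auto simp: in_set_conv_nth)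
    then show "E m s \<in> M" using E(2)[OF that(2), of i] that M_zero by simp
  qed
  \<comment> \<open>Subtracting the \<open>D l\<close> with coefficients \<open>E m (xs ! l)\<close>
    gives exact vanishing on \<open>xs\<close>; since these coefficients are in \<open>M\<close>,
    values on the later \<open>ys\<close> change only modulo \<open>M\<close>.\<close>
  have "\<exists>F. F \<in> vector_fields R K \<and> (\<forall>l<?j. F (xs ! l) = \<zero>) \<and>
      (\<forall>q. ?j \<le> q \<longrightarrow> q < ?n \<longrightarrow> (if q = m then F (ys ! q) \<notin> M else F (ys ! q) \<in> M))"
    if m: "?j \<le> m" "m < ?n" for m
  proof -
    obtain F where F: "F \<in> vector_fields R K"
      "\<And>a. a \<in> carrier R \<Longrightarrow> F a = E m a \<ominus> (\<Oplus>l\<in>{..<?j}. E m (xs ! l) \<otimes> D l a)"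
      "\<And>l. l < ?j \<Longrightarrow> F (xs ! l) = (if l \<in> {..<?j} then \<zero> else E m (xs ! l))"
      by (rule vector_field_project[OF K_carrier parameters_carrier[OF xs] E(1)[OF m(2)] D order_refl])
        (assumption | rule that)+
    have "if q = m then F (ys ! q) \<notin> M else F (ys ! q) \<in> M" if q: "?j \<le> q" "q < ?n" for q
    proof -
      let ?S = "\<Oplus>l\<in>{..<?j}. E m (xs ! l) \<otimes> D l (ys ! q)"
      have Dc: "D l (ys ! q) \<in> carrier R" if "l < ?j" for l
        using vector_fieldsD(2)[OF D(1)[OF that] yc[OF q(2)]] .
      have "E m (xs ! l) \<otimes> D l (ys ! q) \<in> M" if "l < ?j" for l
        using M_lmult[OF EM[OF m that] Dc[OF that]] EM[OF m that] Dc[OF that] M_carrier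
        by (simp add: m_comm subset_eq)
      then have "?S \<in> M" by (intro finsum_in_ideal[OF M_ideal]) auto
      then have S: "\<ominus> ?S \<in> M" using additive_subgroup.a_inv_closed[OF ideal.axioms(1)[OF M_ideal]] by blast
      have "F (ys ! q) = (if m = q then \<one> else \<zero>) \<oplus> \<ominus> ?S"
        using F(2)[OF yc[OF q(2)]] E(2)[OF m(2) q(2)] by (simp add: minus_eq)
      then show ?thesis using notin_M_add[OF one_closed one_notin_M S] M_add[OF M_zero S] by auto
    qed
    then show ?thesis using F by auto
  qed
  then have "\<exists>F. \<forall>m\<in>{?j..<?n}. F m \<in> vector_fields R K \<and> (\<forall>l<?j. F m (xs ! l) = \<zero>) \<and>
      (\<forall>q. ?j \<le> q \<longrightarrow> q < ?n \<longrightarrow> (if q = m then F m (ys ! q) \<notin> M else F m (ys ! q) \<in> M))"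
    by (intro bchoice ballI) simp
  then obtain F where F: "\<And>m. ?j \<le> m \<Longrightarrow> m < ?n \<Longrightarrow> F m \<in> vector_fields R K"
    "\<And>m l. ?j \<le> m \<Longrightarrow> m < ?n \<Longrightarrow> l < ?j \<Longrightarrow> F m (xs ! l) = \<zero>"
    "\<And>m q. ?j \<le> m \<Longrightarrow> m < ?n \<Longrightarrow> ?j \<le> q \<Longrightarrow> q < ?n \<Longrightarrow>
      (if q = m then F m (ys ! q) \<notin> M else F m (ys ! q) \<in> M)"
    unfolding Ball_def atLeastLessThan_iff by blast
  \<comment> \<open>The values of \<open>D i\<close> on the later \<open>ys\<close> are
    uncontrolled, but they stand above the diagonal.\<close>
  define G where "G m = (if m < ?j then D m else F m)" for m
  let ?zs = "xs @ drop ?j ys"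
  have nth: "?zs ! i = (if i < ?j then xs ! i else ys ! i)" if "i < ?n" for i
    using that len by (auto simp: nth_append)
  show ?thesis
  proof (rule parametersI)
    show "set ?zs \<subseteq> M" using xsM ysM set_drop_subset[of ?j ys] by auto
    fix i assume "i < length ?zs"
    then have i: "i < ?n" using len by simp
    show "G i \<in> vector_fields R K" using D(1) F(1) i by (simp add: G_def)
    show "G i (?zs ! i) \<notin> M"
      using D(2)[of i i] F(3)[of i i] i one_notin_M by (auto simp: G_def nth)
    fix l assume l: "l < i"
    then have ln: "l < ?n" using i by simp
    show "G i (?zs ! l) \<in> M"
      using D(2)[of i l] F(2)[of i l] F(3)[of i l] i l M_zero by (auto simp: G_def nth[OF ln])
  qed
qed

end

section \<open>Taylor expansion\<close>

context cring
begin

text \<open>For a single derivation only the values on the parameters count. A partial derivative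
  thus costs the weight of its own parameter, whereas \<open>diff_op_filtration\<close> charges the
  largest weight.\<close>

lemma vector_field_filtration:
  assumes zs: "set zs \<subseteq> carrier R" and \<delta>: "\<delta> \<in> vector_fields R K"
    and par: "\<And>l. l < length zs \<Longrightarrow> \<delta> (zs ! l) \<in> monomial_filtration R zs w (w ! l - c)"
    and f: "f \<in> monomial_filtration R zs w t"
  shows "\<delta> f \<in> monomial_filtration R zs w (t - c)"
proof -
  let ?F = "monomial_filtration R zs w"
  note vf = vector_fieldsD[OF \<delta>]
  have z: "zs ! l \<in> carrier R" if "l < length zs" for l using zs that by (auto dest: nth_mem)
  note Fa = additive_subgroup.a_closed[OF ideal.axioms(1)[OF filtration_ideal[OF zs]]]
  have mon: "\<delta> (power_product R zs \<beta>) \<in> ?F (weight w (length zs) \<beta> - c)" for \<beta>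
  proof (induction "\<Sum>l<length zs. \<beta> l" arbitrary: \<beta>)
    case 0
    then have "weight w (length zs) \<beta> = 0" by (simp add: weight_def)
    then show ?case using zs vf(2) by (simp add: filtration_0)
  next
    case (Suc k)
    then obtain l where l: "l < length zs" "0 < \<beta> l"
      by (metis (no_types, lifting) lessThan_iff neq0_conv old.nat.distinct(2) sum.neutral)
    let ?\<beta>' = "\<beta>(l := \<beta> l - 1)"
    let ?g = "power_product R zs ?\<beta>'"
    have wt: "weight w (length zs) \<beta> = w ! l + weight w (length zs) ?\<beta>'"
      using weight_step[of l "length zs" \<beta> w] l by simp
    have "(\<Sum>i<length zs. \<beta> i) = 1 + (\<Sum>i<length zs. ?\<beta>' i)"
      using l by (simp add: sum.remove[of _ l])
    then have k: "k = (\<Sum>i<length zs. ?\<beta>' i)" using Suc(2) by simp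
    have "zs ! l \<otimes> \<delta> ?g \<in> ?F (w ! l + (weight w (length zs) ?\<beta>' - c))"
      by (rule filtration_mult[OF zs parameter_in_filtration[OF zs l(1)]]) (rule Suc(1)[OF k])
    then have 1: "zs ! l \<otimes> \<delta> ?g \<in> ?F (weight w (length zs) \<beta> - c)"
      by (rule subsetD[OF filtration_antimono[OF zs], rotated]) (use wt in simp)
    have "?g \<otimes> \<delta> (zs ! l) \<in> ?F (weight w (length zs) ?\<beta>' + (w ! l - c))"
      by (rule filtration_mult[OF zs power_product_in_filtration[OF zs order_refl] par[OF l(1)]])
    then have 2: "?g \<otimes> \<delta> (zs ! l) \<in> ?F (weight w (length zs) \<beta> - c)"
      by (rule subsetD[OF filtration_antimono[OF zs], rotated]) (use wt in simp)
    have "\<delta> (power_product R zs \<beta>) = zs ! l \<otimes> \<delta> ?g \<oplus> ?g \<otimes> \<delta> (zs ! l)"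
      using power_product_step[of zs l \<beta>, OF zs l] vf(4)[OF z[OF l(1)] power_product_closed[OF zs]] by simp
    then show ?case using Fa[OF 1 2] by simp
  qed
  show ?thesis using f zs
  proof (rule filtration_induct)
    show "\<delta> \<zero> \<in> ?F (t - c)"
      using vf(5) additive_subgroup.zero_closed[OF ideal.axioms(1)[OF filtration_ideal[OF zs]]]
      by (simp only:)
  next
    fix a b assume "a \<in> carrier R" "b \<in> carrier R" "\<delta> a \<in> ?F (t - c)" "\<delta> b \<in> ?F (t - c)"
    then show "\<delta> (a \<oplus> b) \<in> ?F (t - c)" using vf(3) Fa by (simp only:)
  next
    fix r \<beta> assume r: "r \<in> carrier R" and \<beta>: "t \<le> weight w (length zs) \<beta>"
    let ?p = "power_product R zs \<beta>"
    have p: "?p \<in> carrier R" using zs by simp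
    have "\<delta> ?p \<in> ?F (t - c)"
      by (rule subsetD[OF filtration_antimono[OF zs] mon]) (use \<beta> in simp)
    then have 1: "r \<otimes> \<delta> ?p \<in> ?F (t - c)" using r by (rule ideal.I_l_closed[OF filtration_ideal[OF zs]])
    have "?p \<in> ?F (t - c)" by (rule power_product_in_filtration[OF zs]) (use \<beta> in simp)
    then have 2: "?p \<otimes> \<delta> r \<in> ?F (t - c)"
      using vf(2)[OF r] by (rule ideal.I_r_closed[OF filtration_ideal[OF zs]])
    show "\<delta> (r \<otimes> ?p) \<in> ?F (t - c)" using vf(4)[OF r p] Fa[OF 1 2] by simp
  qed
qed

text \<open>Exponents are functions on all natural numbers. Making them zero beyond the parameters
  turns the exponents of a given weight into a finite set.\<close>

lemma power_product_restrict:
  assumes "set zs \<subseteq> carrier R"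
  shows "power_product R zs (\<lambda>l. if l < length zs then \<beta> l else 0) = power_product R zs \<beta>"
proof -
  have "zs ! l \<in> carrier R" if "l < length zs" for l using assms that by (auto dest: nth_mem)
  then show ?thesis unfolding power_product_def by (intro finprod_cong') auto
qed

text \<open>If \<open>\<beta> l = 0\<close>, the truncated exponent on the right does not matter,
  because its factor is zero.\<close>

lemma partial_power_product:
  assumes zs: "set zs \<subseteq> carrier R" and \<delta>: "\<delta> \<in> vector_fields R K" and l: "l < length zs"
    and dual: "\<And>i. i < length zs \<Longrightarrow> \<delta> (zs ! i) = (if l = i then \<one> else \<zero>)"
  shows "\<delta> (power_product R zs \<beta>) = [\<beta> l] \<cdot> power_product R zs (\<beta>(l := \<beta> l - 1))"
proof (induction "\<Sum>i<length zs. \<beta> i" arbitrary: \<beta>)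
  case 0
  note vf = vector_fieldsD[OF \<delta>]
  have "power_product R zs \<beta> = power_product R zs (\<lambda>i. if i < length zs then \<beta> i else 0)"
    using power_product_restrict[OF zs] by simp
  also have "(\<lambda>i. if i < length zs then \<beta> i else 0) = (\<lambda>_. 0)" using 0 by auto
  finally have 1: "power_product R zs \<beta> = \<one>" by (simp only: power_product_0)
  have "\<delta> (\<one> \<otimes> \<one>) = \<one> \<otimes> \<delta> \<one> \<oplus> \<one> \<otimes> \<delta> \<one>" by (rule vf(4)) auto
  then have "\<delta> \<one> \<oplus> \<zero> = \<delta> \<one> \<oplus> \<delta> \<one>" using vf(2) by simp
  then have "\<delta> \<one> = \<zero>" using vf(2) by (metis add.l_cancel one_closed zero_closed)
  moreover have "\<beta> l = 0" using 0 l by auto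
  ultimately show ?case using 1 by simp
next
  case (Suc k)
  note vf = vector_fieldsD[OF \<delta>]
  have z: "zs ! i \<in> carrier R" if "i < length zs" for i using zs that by (auto dest: nth_mem)
  obtain i where i: "i < length zs" "0 < \<beta> i"
    using Suc(2) by (metis (no_types, lifting) lessThan_iff neq0_conv old.nat.distinct(2) sum.neutral)
  let ?\<beta>' = "\<beta>(i := \<beta> i - 1)"
  let ?g = "power_product R zs ?\<beta>'"
  have "(\<Sum>m<length zs. \<beta> m) = 1 + (\<Sum>m<length zs. ?\<beta>' m)"
    using i by (simp add: sum.remove[of _ i])
  then have k: "k = (\<Sum>m<length zs. ?\<beta>' m)" using Suc(2) by simp
  have g: "?g \<in> carrier R" using zs by simp
  have "\<delta> (power_product R zs \<beta>) = zs ! i \<otimes> \<delta> ?g \<oplus> ?g \<otimes> \<delta> (zs ! i)"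
    using power_product_step[of zs i \<beta>, OF zs i] vf(4)[OF z[OF i(1)] g] by simp
  also have "\<delta> ?g = [?\<beta>' l] \<cdot> power_product R zs (?\<beta>'(l := ?\<beta>' l - 1))"
    by (rule Suc(1)[OF k])
  finally have eq: "\<delta> (power_product R zs \<beta>) =
      [?\<beta>' l] \<cdot> (zs ! i \<otimes> power_product R zs (?\<beta>'(l := ?\<beta>' l - 1))) \<oplus> ?g \<otimes> \<delta> (zs ! i)"
    by (simp only: add_pow_rdistr[OF z[OF i(1)] power_product_closed[OF zs]])
  show ?case
  proof (cases "i = l")
    case True
    show ?thesis
    proof (cases "\<beta> l = 1")
      case one: True
      then show ?thesis using eq True dual[OF l] g zs z[OF l] by simp
    next
      case False
      then have pos: "0 < ?\<beta>' l" using i True by simp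
      have "zs ! l \<otimes> power_product R zs (?\<beta>'(l := ?\<beta>' l - 1)) = ?g"
        using power_product_step[of zs l ?\<beta>', OF zs l pos] by simp
      then have "\<delta> (power_product R zs \<beta>) = [?\<beta>' l] \<cdot> ?g \<oplus> ?g"
        using eq True dual[OF l] g by simp
      also have "\<dots> = [Suc (?\<beta>' l)] \<cdot> ?g" by simp
      also have "Suc (?\<beta>' l) = \<beta> l" using True i by simp
      finally show ?thesis unfolding True .
    qed
  next
    case False
    have "?\<beta>'(l := ?\<beta>' l - 1) = (\<beta>(l := \<beta> l - 1))(i := (\<beta>(l := \<beta> l - 1)) i - 1)"
      using False by (auto simp: fun_eq_iff)
    then have "zs ! i \<otimes> power_product R zs (?\<beta>'(l := ?\<beta>' l - 1)) = power_product R zs (\<beta>(l := \<beta> l - 1))"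
      using power_product_step[of zs i "\<beta>(l := \<beta> l - 1)", OF zs i(1)] i(2) False by simp
    then show ?thesis using eq False dual[OF i(1)] g zs by simp
  qed
qed

lemma finite_exponents:
  assumes "\<And>l. l < k \<Longrightarrow> 0 < w ! l"
  shows "finite {\<gamma>. (\<forall>l. k \<le> l \<longrightarrow> \<gamma> l = 0) \<and> weight w k \<gamma> = s}"
proof (rule finite_subset)
  show "{\<gamma>. (\<forall>l. k \<le> l \<longrightarrow> \<gamma> l = 0) \<and> weight w k \<gamma> = s} \<subseteq>
      {\<gamma>. \<forall>l. (l \<in> {..<k} \<longrightarrow> \<gamma> l \<in> {..s}) \<and> (l \<notin> {..<k} \<longrightarrow> \<gamma> l = 0)}"
  proof (intro subsetI CollectI allI conjI impI)
    fix \<gamma> l assume \<gamma>: "\<gamma> \<in> {\<gamma>. (\<forall>l. k \<le> l \<longrightarrow> \<gamma> l = 0) \<and> weight w k \<gamma> = s}" and l: "l \<in> {..<k}"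
    have "\<gamma> l \<le> \<gamma> l * w ! l" using assms[of l] l by simp
    also have "\<dots> \<le> weight w k \<gamma>" unfolding weight_def by (rule member_le_sum) (use l in auto)
    finally show "\<gamma> l \<in> {..s}" using \<gamma> by simp
  qed auto
  show "finite {\<gamma>. \<forall>l. (l \<in> {..<k} \<longrightarrow> \<gamma> l \<in> {..s}) \<and> (l \<notin> {..<k} \<longrightarrow> \<gamma> l = (0::nat))}"
    by (rule finite_set_of_finite_funs) auto
qed

text \<open>The coefficients are arbitrary elements of the ring and are not unique;
  \<open>taylor_step\<close> asks only whether they lie in \<open>M\<close>.\<close>

lemma leading_form:
  assumes zs: "set zs \<subseteq> carrier R" and w: "\<And>l. l < length zs \<Longrightarrow> 0 < w ! l"
    and f: "f \<in> monomial_filtration R zs w s"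
  defines "\<Gamma> \<equiv> {\<gamma>. (\<forall>l. length zs \<le> l \<longrightarrow> \<gamma> l = 0) \<and> weight w (length zs) \<gamma> = s}"
  obtains c g where "c \<in> \<Gamma> \<rightarrow> carrier R" "g \<in> monomial_filtration R zs w (Suc s)"
    "f = (\<Oplus>\<gamma>\<in>\<Gamma>. c \<gamma> \<otimes> power_product R zs \<gamma>) \<oplus> g"
proof -
  let ?G = "monomial_filtration R zs w (Suc s)"
  let ?p = "power_product R zs"
  interpret G: ideal ?G R by (rule filtration_ideal[OF zs])
  have fin: "finite \<Gamma>" unfolding \<Gamma>_def by (rule finite_exponents[OF w])
  have "\<exists>c\<in>\<Gamma> \<rightarrow> carrier R. \<exists>g\<in>?G. f = (\<Oplus>\<gamma>\<in>\<Gamma>. c \<gamma> \<otimes> ?p \<gamma>) \<oplus> g"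
    using f zs
  proof (rule filtration_induct)
    have "(\<Oplus>\<gamma>\<in>\<Gamma>. \<zero> \<otimes> ?p \<gamma>) = (\<Oplus>\<gamma>\<in>\<Gamma>. \<zero>)" using zs by (intro finsum_cong') auto
    then show "\<exists>c\<in>\<Gamma> \<rightarrow> carrier R. \<exists>g\<in>?G. \<zero> = (\<Oplus>\<gamma>\<in>\<Gamma>. c \<gamma> \<otimes> ?p \<gamma>) \<oplus> g"
      by (intro bexI[of _ "\<lambda>_. \<zero>"] bexI[of _ \<zero>]) auto
  next
    fix a b assume "\<exists>c\<in>\<Gamma> \<rightarrow> carrier R. \<exists>g\<in>?G. a = (\<Oplus>\<gamma>\<in>\<Gamma>. c \<gamma> \<otimes> ?p \<gamma>) \<oplus> g"
      "\<exists>c\<in>\<Gamma> \<rightarrow> carrier R. \<exists>g\<in>?G. b = (\<Oplus>\<gamma>\<in>\<Gamma>. c \<gamma> \<otimes> ?p \<gamma>) \<oplus> g"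
    then obtain c g c' g' where *: "c \<in> \<Gamma> \<rightarrow> carrier R" "g \<in> ?G" "a = (\<Oplus>\<gamma>\<in>\<Gamma>. c \<gamma> \<otimes> ?p \<gamma>) \<oplus> g"
      "c' \<in> \<Gamma> \<rightarrow> carrier R" "g' \<in> ?G" "b = (\<Oplus>\<gamma>\<in>\<Gamma>. c' \<gamma> \<otimes> ?p \<gamma>) \<oplus> g'" by blast
    let ?S = "\<Oplus>\<gamma>\<in>\<Gamma>. c \<gamma> \<otimes> ?p \<gamma>" and ?S' = "\<Oplus>\<gamma>\<in>\<Gamma>. c' \<gamma> \<otimes> ?p \<gamma>"
    have cc: "?S \<in> carrier R" "?S' \<in> carrier R" using * zs by (auto intro!: finsum_closed)
    have "(\<Oplus>\<gamma>\<in>\<Gamma>. (c \<gamma> \<oplus> c' \<gamma>) \<otimes> ?p \<gamma>) = (\<Oplus>\<gamma>\<in>\<Gamma>. c \<gamma> \<otimes> ?p \<gamma> \<oplus> c' \<gamma> \<otimes> ?p \<gamma>)"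
      using * zs by (intro finsum_cong') (auto simp: l_distr Pi_iff)
    also have "\<dots> = ?S \<oplus> ?S'" using * zs by (intro finsum_addf) (auto simp: Pi_iff)
    finally have "a \<oplus> b = (\<Oplus>\<gamma>\<in>\<Gamma>. (c \<gamma> \<oplus> c' \<gamma>) \<otimes> ?p \<gamma>) \<oplus> (g \<oplus> g')"
      using * cc G.a_Hcarr by (simp add: a_ac)
    moreover have "(\<lambda>\<gamma>. c \<gamma> \<oplus> c' \<gamma>) \<in> \<Gamma> \<rightarrow> carrier R" using * by (auto simp: Pi_iff)
    moreover have "g \<oplus> g' \<in> ?G" using * by (intro G.a_closed)
    ultimately show "\<exists>c\<in>\<Gamma> \<rightarrow> carrier R. \<exists>g\<in>?G. a \<oplus> b = (\<Oplus>\<gamma>\<in>\<Gamma>. c \<gamma> \<otimes> ?p \<gamma>) \<oplus> g"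
      by (intro bexI[of _ "\<lambda>\<gamma>. c \<gamma> \<oplus> c' \<gamma>"] bexI[of _ "g \<oplus> g'"])
  next
    fix r \<beta> assume r: "r \<in> carrier R" and \<beta>: "s \<le> weight w (length zs) \<beta>"
    define \<beta>' where "\<beta>' = (\<lambda>l. if l < length zs then \<beta> l else 0)"
    have p: "?p \<beta> = ?p \<beta>'" unfolding \<beta>'_def using power_product_restrict[OF zs] by simp
    have wt: "weight w (length zs) \<beta>' = weight w (length zs) \<beta>"
      unfolding weight_def \<beta>'_def by (rule sum.cong) auto
    show "\<exists>c\<in>\<Gamma> \<rightarrow> carrier R. \<exists>g\<in>?G. r \<otimes> ?p \<beta> = (\<Oplus>\<gamma>\<in>\<Gamma>. c \<gamma> \<otimes> ?p \<gamma>) \<oplus> g"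
    proof (cases "weight w (length zs) \<beta> = s")
      case True
      then have \<beta>\<Gamma>: "\<beta>' \<in> \<Gamma>" using wt by (simp add: \<Gamma>_def \<beta>'_def)
      let ?c = "\<lambda>\<gamma>. if \<beta>' = \<gamma> then r else \<zero>"
      have "(\<Oplus>\<gamma>\<in>\<Gamma>. ?c \<gamma> \<otimes> ?p \<gamma>) = (\<Oplus>\<gamma>\<in>\<Gamma>. if \<beta>' = \<gamma> then r \<otimes> ?p \<gamma> else \<zero>)"
        using r zs by (intro finsum_cong') auto
      also have "\<dots> = r \<otimes> ?p \<beta>'" using r zs by (intro finsum_singleton[OF \<beta>\<Gamma> fin]) auto
      finally have "r \<otimes> ?p \<beta> = (\<Oplus>\<gamma>\<in>\<Gamma>. ?c \<gamma> \<otimes> ?p \<gamma>) \<oplus> \<zero>" using p r zs by simp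
      moreover have "?c \<in> \<Gamma> \<rightarrow> carrier R" using r by auto
      ultimately show ?thesis using G.zero_closed by (intro bexI[of _ ?c] bexI[of _ \<zero>])
    next
      case False
      then have "?p \<beta> \<in> ?G" using \<beta> by (intro power_product_in_filtration[OF zs]) simp
      then have g: "r \<otimes> ?p \<beta> \<in> ?G" using r by (rule G.I_l_closed)
      have "(\<Oplus>\<gamma>\<in>\<Gamma>. \<zero> \<otimes> ?p \<gamma>) = (\<Oplus>\<gamma>\<in>\<Gamma>. \<zero>)" using zs by (intro finsum_cong') auto
      then have "r \<otimes> ?p \<beta> = (\<Oplus>\<gamma>\<in>\<Gamma>. \<zero> \<otimes> ?p \<gamma>) \<oplus> r \<otimes> ?p \<beta>" using r zs by simp
      then show ?thesis using g by (intro bexI[of _ "\<lambda>_. \<zero>"] bexI[of _ "r \<otimes> ?p \<beta>"]) auto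
    qed
  qed
  then show thesis using that by blast
qed

end

text \<open>\<open>fold\<close> applies the head of a word first. For increasing \<open>ls\<close>
  the derivatives in earlier parameters therefore precede those in later ones, as in the alternation
  of derivatives and restrictions in \<open>\<D>[\<beta>]\<close>.\<close>

definition sorted_word :: "(nat \<Rightarrow> nat) \<Rightarrow> nat list \<Rightarrow> nat list" where
  "sorted_word \<gamma> ls = concat (map (\<lambda>i. replicate (\<gamma> i) i) ls)"

lemma set_sorted_word: "set (sorted_word \<gamma> ls) \<subseteq> set ls"
  by (auto simp: sorted_word_def)

lemma count_list_replicate: "count_list (replicate m x) y = (if x = y then m else 0)"
  by (induction m) auto

lemma count_list_sorted_word:
  "distinct ls \<Longrightarrow> count_list (sorted_word \<gamma> ls) l = (if l \<in> set ls then \<gamma> l else 0)"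
  by (induction ls) (auto simp: sorted_word_def count_list_append count_list_replicate)

lemma weight_sorted_word:
  "(\<Sum>l\<leftarrow>sorted_word \<gamma> [0..<k]. w ! l) = weight w k \<gamma>"
  by (induction k) (auto simp: sorted_word_def weight_def sum_list_replicate)

lemma length_sorted_word:
  "length (sorted_word \<gamma> ls) = (\<Sum>l\<leftarrow>ls. \<gamma> l)"
  by (induction ls) (auto simp: sorted_word_def)

section \<open>Expansion in a system with dual vector fields\<close>

context smooth_local_ring
begin

context
  fixes zs :: "'a list" and w :: "nat list" and D :: "nat \<Rightarrow> 'a \<Rightarrow> 'a"
  assumes zs: "set zs \<subseteq> carrier R" and gen: "Idl (set zs) = M"
    and w: "\<And>l. l < length zs \<Longrightarrow> 0 < w ! l"
    and D: "\<And>i. i < length zs \<Longrightarrow> D i \<in> vector_fields R K"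
    and dual: "\<And>i l. i < length zs \<Longrightarrow> l < length zs \<Longrightarrow> D i (zs ! l) = (if i = l then \<one> else \<zero>)"
begin

lemma filtration_1: "monomial_filtration R zs w 1 = M"
proof
  show "monomial_filtration R zs w 1 \<subseteq> M"
    unfolding monomial_filtration_alt
  proof (rule genideal_minimal[OF M_ideal], clarify)
    fix \<beta> assume "1 \<le> weight w (length zs) \<beta>"
    then obtain l where l: "l < length zs" "0 < \<beta> l"
      unfolding weight_def
      by (metis (no_types, lifting) lessThan_iff mult_0 neq0_conv not_one_le_zero sum.neutral)
    have "zs ! l \<in> M" using gen genideal_self[OF zs] l(1) by (auto dest: nth_mem)
    then show "power_product R zs \<beta> \<in> M"
      using power_product_step[of zs l \<beta>, OF zs l] zs by (simp add: ideal.I_r_closed[OF M_ideal])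
  qed
  show "M \<subseteq> monomial_filtration R zs w 1"
    unfolding gen[symmetric]
  proof (rule genideal_minimal[OF filtration_ideal[OF zs]], rule subsetI)
    fix z assume "z \<in> set zs"
    then obtain l where l: "l < length zs" "z = zs ! l" by (auto simp: in_set_conv_nth)
    have "z \<in> monomial_filtration R zs w (w ! l)" unfolding l(2) by (rule parameter_in_filtration[OF zs l(1)])
    then show "z \<in> monomial_filtration R zs w 1"
      by (rule subsetD[OF filtration_antimono[OF zs], rotated]) (use w[OF l(1)] in simp)
  qed
qed

lemma partial_filtration:
  assumes "i < length zs" "f \<in> monomial_filtration R zs w t"
  shows "D i f \<in> monomial_filtration R zs w (t - w ! i)"
proof (rule vector_field_filtration[OF zs D[OF assms(1)] _ assms(2)])
  fix l assume l: "l < length zs"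
  show "D i (zs ! l) \<in> monomial_filtration R zs w (w ! l - w ! i)"
  proof (cases "i = l")
    case True
    then show ?thesis using dual l zs by (simp add: filtration_0)
  next
    case False
    then have "D i (zs ! l) = \<zero>" using dual assms(1) l by simp
    then show ?thesis
      by (simp add: additive_subgroup.zero_closed[OF ideal.axioms(1)[OF filtration_ideal[OF zs]]])
  qed
qed

lemma fold_partial_filtration:
  assumes "set ls \<subseteq> {..<length zs}" "f \<in> monomial_filtration R zs w t"
  shows "fold D ls f \<in> monomial_filtration R zs w (t - (\<Sum>l\<leftarrow>ls. w ! l))"
  using assms
proof (induction ls arbitrary: f t)
  case (Cons l ls)
  then have "D l f \<in> monomial_filtration R zs w (t - w ! l)" using partial_filtration by simp
  then show ?case using Cons.IH[of "D l f" "t - w ! l"] Cons.prems(1) by (simp add: diff_diff_eq)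
qed simp

lemma fold_partial_linear:
  assumes "set ls \<subseteq> {..<length zs}"
  shows "fold D ls \<in> linear_endos R K"
  by (rule diff_ops_linear[OF fold_vector_fields_diff_op]) (use assms D K_carrier in auto)

text \<open>Modulo \<open>M\<close>, derivatives of the coefficient do not matter, since they come with monomials of
  too large a weight.\<close>

lemma fold_partial_power_product:
  assumes "set ls \<subseteq> {..<length zs}" "c \<in> carrier R" "weight w (length zs) \<gamma> = (\<Sum>l\<leftarrow>ls. w ! l)"
  shows "if \<forall>l<length zs. count_list ls l = \<gamma> l
    then c \<notin> M \<longrightarrow> fold D ls (c \<otimes> power_product R zs \<gamma>) \<notin> M
    else fold D ls (c \<otimes> power_product R zs \<gamma>) \<in> M"
  using assms
proof (induction ls arbitrary: c \<gamma>)
  case Nil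
  then have "\<gamma> l * w ! l = 0" if "l < length zs" for l using that by (simp add: weight_def)
  then have 0: "\<gamma> l = 0" if "l < length zs" for l using w that by force
  then have "(\<lambda>l. if l < length zs then \<gamma> l else 0) = (\<lambda>_. 0)" by auto
  then have "power_product R zs \<gamma> = \<one>"
    using power_product_restrict[OF zs, of \<gamma>] by (simp only: power_product_0)
  then show ?case using 0 Nil.prems(2) by simp
next
  case (Cons l ls)
  let ?p = "power_product R zs"
  have l: "l < length zs" and ls: "set ls \<subseteq> {..<length zs}" using Cons.prems(1) by auto
  note vf = vector_fieldsD[OF D[OF l]] and lin = fold_partial_linear[OF ls]
  have c: "c \<in> carrier R" "D l c \<in> carrier R" using Cons.prems(2) vf(2) by auto
  have wt: "weight w (length zs) \<gamma> = w ! l + (\<Sum>l\<leftarrow>ls. w ! l)" using Cons.prems(3) by simp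
  have p: "?p \<gamma> \<in> carrier R" using zs by simp
  let ?A = "c \<otimes> D l (?p \<gamma>)" and ?B = "?p \<gamma> \<otimes> D l c"
  \<comment> \<open>Here the derivative hits the coefficient and the monomial keeps its weight; the
    remaining letters use up all of it except \<open>w ! l\<close>, which is positive.\<close>
  have "?B \<in> monomial_filtration R zs w (w ! l + (\<Sum>l\<leftarrow>ls. w ! l))"
    by (rule ideal.I_r_closed[OF filtration_ideal[OF zs] power_product_in_filtration[OF zs] c(2)]) (simp add: wt)
  from fold_partial_filtration[OF ls this]
  have "fold D ls ?B \<in> monomial_filtration R zs w (w ! l)" by simp
  then have "fold D ls ?B \<in> monomial_filtration R zs w 1"
    by (rule subsetD[OF filtration_antimono[OF zs], rotated]) (use w[OF l] in simp)
  then have B: "fold D ls ?B \<in> M" unfolding filtration_1 .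
  have AB: "?A \<in> carrier R" "?B \<in> carrier R" using c p vf(2) by auto
  have eq: "fold D (l # ls) (c \<otimes> ?p \<gamma>) = fold D ls ?A \<oplus> fold D ls ?B"
    using vf(4)[OF c(1) p] linear_endos_add[OF lin AB] by simp
  have Ac: "fold D ls ?A \<in> carrier R" using linear_endos_closed[OF lin AB(1)] .
  have reduce: "fold D (l # ls) (c \<otimes> ?p \<gamma>) \<in> M \<longleftrightarrow> fold D ls ?A \<in> M"
    unfolding eq using M_add[OF _ B] notin_M_add[OF Ac _ B] by blast
  have Dp: "D l (?p \<gamma>) = [\<gamma> l] \<cdot> ?p (\<gamma>(l := \<gamma> l - 1))"
    using partial_power_product[OF zs D[OF l] l dual[OF l]] by simp
  show ?case
  proof (cases "\<gamma> l = 0")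
    case True
    then have "?A = \<zero>" using Dp c by simp
    then have "fold D ls ?A \<in> M" using linear_endos_zero[OF lin] M_zero by simp
    moreover have nc: "\<not> (\<forall>i<length zs. count_list (l # ls) i = \<gamma> i)" using True l by auto
    ultimately show ?thesis unfolding if_not_P[OF nc] reduce by blast
  next
    case False
    let ?\<gamma> = "\<gamma>(l := \<gamma> l - 1)" and ?c = "c \<otimes> [\<gamma> l] \<cdot> \<one>"
    have A: "?A = ?c \<otimes> ?p ?\<gamma>"
      unfolding Dp using c zs by (simp add: m_assoc add_pow_ldistr)
    have w\<gamma>: "weight w (length zs) ?\<gamma> = (\<Sum>l\<leftarrow>ls. w ! l)"
      using weight_step[of l "length zs" \<gamma> w] l False wt by simp
    have cc: "?c \<in> carrier R" using c by simp
    have IH: "if \<forall>i<length zs. count_list ls i = ?\<gamma> i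
      then ?c \<notin> M \<longrightarrow> fold D ls ?A \<notin> M else fold D ls ?A \<in> M"
      unfolding A by (rule Cons.IH[OF ls cc w\<gamma>])
    have cnt: "(\<forall>i<length zs. count_list (l # ls) i = \<gamma> i) \<longleftrightarrow> (\<forall>i<length zs. count_list ls i = ?\<gamma> i)"
      using False l by (auto split: if_splits)
    \<comment> \<open>The exponent is nonzero in this case, hence a unit by characteristic
      zero.\<close>
    have "c \<notin> M \<Longrightarrow> ?c \<notin> M" using notin_M_mult[OF c(1)] nat_notin_M[of "\<gamma> l"] False by simp
    show ?thesis
    proof (cases "\<forall>i<length zs. count_list (l # ls) i = \<gamma> i")
      case True
      have "?c \<notin> M \<longrightarrow> fold D ls ?A \<notin> M"
        using IH unfolding if_P[OF iffD1[OF cnt True]] .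
      then show ?thesis unfolding if_P[OF True] reduce using \<open>c \<notin> M \<Longrightarrow> ?c \<notin> M\<close> by blast
    next
      case False
      have "fold D ls ?A \<in> M" using IH unfolding if_not_P[OF False[unfolded cnt]] .
      then show ?thesis unfolding if_not_P[OF False] reduce .
    qed
  qed
qed

text \<open>Modulo \<open>M\<close>, the derivative belonging to \<open>\<gamma>\<close> detects
  exactly the coefficient \<open>c \<gamma>\<close> of the leading form, up to a unit. If it lies in
  \<open>M\<close>, so does \<open>c \<gamma>\<close>; as \<open>M\<close> is the filtration at
  weight 1, the term gains one unit of weight.\<close>

lemma taylor_step:
  assumes f: "f \<in> monomial_filtration R zs w s"
    and van: "\<And>\<gamma>. weight w (length zs) \<gamma> = s \<Longrightarrow> fold D (sorted_word \<gamma> [0..<length zs]) f \<in> M"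
  shows "f \<in> monomial_filtration R zs w (Suc s)"
proof -
  let ?p = "power_product R zs" and ?G = "monomial_filtration R zs w (Suc s)"
  interpret G: ideal ?G R by (rule filtration_ideal[OF zs])
  define \<Gamma> where "\<Gamma> = {\<gamma>. (\<forall>l. length zs \<le> l \<longrightarrow> \<gamma> l = 0) \<and> weight w (length zs) \<gamma> = s}"
  have fin: "finite \<Gamma>" unfolding \<Gamma>_def by (rule finite_exponents[OF w])
  obtain c g where c: "c \<in> \<Gamma> \<rightarrow> carrier R" and g: "g \<in> ?G"
    and eq: "f = (\<Oplus>\<gamma>\<in>\<Gamma>. c \<gamma> \<otimes> ?p \<gamma>) \<oplus> g"
    using leading_form[OF zs w f] unfolding \<Gamma>_def by blast
  have tc: "c \<gamma> \<otimes> ?p \<gamma> \<in> carrier R" if "\<gamma> \<in> \<Gamma>" for \<gamma> using c zs that by auto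
  have cM: "c \<gamma> \<in> M" if \<gamma>: "\<gamma> \<in> \<Gamma>" for \<gamma>
  proof (rule ccontr)
    assume cn: "c \<gamma> \<notin> M"
    let ?ls = "sorted_word \<gamma> [0..<length zs]"
    have ls: "set ?ls \<subseteq> {..<length zs}" using set_sorted_word[of \<gamma> "[0..<length zs]"] by (auto simp: subset_eq)
    note lin = fold_partial_linear[OF ls]
    have wt: "(\<Sum>l\<leftarrow>?ls. w ! l) = s" using \<gamma> by (simp add: weight_sorted_word \<Gamma>_def)
    have cnt: "count_list ?ls l = \<gamma> l" if "l < length zs" for l
      using that by (simp add: count_list_sorted_word)
    let ?T = "\<lambda>\<delta>. c \<delta> \<otimes> ?p \<delta>"
    have sum: "(\<Oplus>\<delta>\<in>\<Gamma>. ?T \<delta>) = ?T \<gamma> \<oplus> (\<Oplus>\<delta>\<in>\<Gamma> - {\<gamma>}. ?T \<delta>)"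
    proof -
      have "(\<Oplus>\<delta>\<in>insert \<gamma> (\<Gamma> - {\<gamma>}). ?T \<delta>) = ?T \<gamma> \<oplus> (\<Oplus>\<delta>\<in>\<Gamma> - {\<gamma>}. ?T \<delta>)"
        by (rule finsum_insert) (use fin tc \<gamma> in auto)
      then show ?thesis using \<gamma> by (simp add: insert_absorb)
    qed
    have rest: "fold D ?ls (\<Oplus>\<delta>\<in>A. ?T \<delta>) \<in> M" if "finite A" "A \<subseteq> \<Gamma> - {\<gamma>}" for A
      using that
    proof (induction A rule: finite_induct)
      case empty
      then show ?case using linear_endos_zero[OF lin] M_zero by simp
    next
      case (insert \<delta> A)
      have \<delta>: "\<delta> \<in> \<Gamma>" "\<delta> \<noteq> \<gamma>" using insert.prems by auto
      have "(\<Oplus>\<epsilon>\<in>insert \<delta> A. ?T \<epsilon>) = ?T \<delta> \<oplus> (\<Oplus>\<epsilon>\<in>A. ?T \<epsilon>)"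
        by (rule finsum_insert) (use insert tc in auto)
      moreover have "(\<Oplus>\<epsilon>\<in>A. ?T \<epsilon>) \<in> carrier R" by (rule finsum_closed) (use insert.prems tc in auto)
      ultimately have "fold D ?ls (\<Oplus>\<epsilon>\<in>insert \<delta> A. ?T \<epsilon>) = fold D ?ls (?T \<delta>) \<oplus> fold D ?ls (\<Oplus>\<epsilon>\<in>A. ?T \<epsilon>)"
        using linear_endos_add[OF lin tc[OF \<delta>(1)]] by simp
      moreover have "\<exists>l<length zs. \<gamma> l \<noteq> \<delta> l"
      proof (rule ccontr)
        assume "\<not> (\<exists>l<length zs. \<gamma> l \<noteq> \<delta> l)"
        then have "\<gamma> l = \<delta> l" for l using \<gamma> \<delta>(1) by (cases "l < length zs") (auto simp: \<Gamma>_def)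
        then show False using \<delta>(2) by auto
      qed
      then have ne: "\<not> (\<forall>l<length zs. count_list ?ls l = \<delta> l)" using cnt by auto
      have w\<delta>: "weight w (length zs) \<delta> = (\<Sum>l\<leftarrow>?ls. w ! l)" using \<delta>(1) wt by (simp add: \<Gamma>_def)
      have "fold D ?ls (?T \<delta>) \<in> M"
        using fold_partial_power_product[OF ls funcset_mem[OF c \<delta>(1)] w\<delta>] unfolding if_not_P[OF ne] .
      ultimately show ?case using insert M_add by auto
    qed
    \<comment> \<open>The word costs weight \<open>s\<close>, so the remainder keeps at least weight
      1.\<close>
    have "fold D ?ls g \<in> monomial_filtration R zs w (Suc s - s)"
      using fold_partial_filtration[OF ls g] wt by simp
    then have gM: "fold D ?ls g \<in> M" using filtration_1 by simp
    have cnt': "\<forall>l<length zs. count_list ?ls l = \<gamma> l" using cnt by blast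
    have w\<gamma>: "weight w (length zs) \<gamma> = (\<Sum>l\<leftarrow>?ls. w ! l)" using \<gamma> wt by (simp add: \<Gamma>_def)
    have Tn: "fold D ?ls (?T \<gamma>) \<notin> M"
      using fold_partial_power_product[OF ls funcset_mem[OF c \<gamma>] w\<gamma>] cn unfolding if_P[OF cnt'] by blast
    let ?S = "\<Oplus>\<delta>\<in>\<Gamma> - {\<gamma>}. ?T \<delta>"
    have Sc: "?S \<in> carrier R" by (rule finsum_closed) (use tc in auto)
    have SM: "fold D ?ls ?S \<in> M" by (rule rest) (use fin in auto)
    have gc: "g \<in> carrier R" using g by (rule G.a_Hcarr)
    have "fold D ?ls f = fold D ?ls (?T \<gamma>) \<oplus> fold D ?ls ?S \<oplus> fold D ?ls g"
      unfolding eq sum using linear_endos_add[OF lin] tc[OF \<gamma>] Sc gc by simp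
    moreover have "fold D ?ls (?T \<gamma>) \<in> carrier R" using linear_endos_closed[OF lin tc[OF \<gamma>]] .
    ultimately have "fold D ?ls f \<notin> M"
      using notin_M_add[OF _ notin_M_add[OF _ Tn SM] gM] SM M_carrier by auto
    then show False using van[of \<gamma>] \<gamma> by (simp add: \<Gamma>_def)
  qed
  have "c \<gamma> \<otimes> ?p \<gamma> \<in> ?G" if \<gamma>: "\<gamma> \<in> \<Gamma>" for \<gamma>
  proof -
    have "c \<gamma> \<in> monomial_filtration R zs w 1" using cM[OF \<gamma>] filtration_1 by simp
    moreover have "?p \<gamma> \<in> monomial_filtration R zs w s"
      by (rule power_product_in_filtration[OF zs]) (use \<gamma> in \<open>simp add: \<Gamma>_def\<close>)
    ultimately show ?thesis using filtration_mult[OF zs, of "c \<gamma>" w 1 "?p \<gamma>" s] by simp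
  qed
  then have "(\<Oplus>\<gamma>\<in>\<Gamma>. c \<gamma> \<otimes> ?p \<gamma>) \<in> ?G" by (rule finsum_in_ideal[OF G.ideal_axioms])
  then show ?thesis unfolding eq using g by (rule G.a_closed)
qed

lemma taylor_criterion:
  assumes f: "f \<in> carrier R"
    and van: "\<And>\<gamma>. weight w (length zs) \<gamma> < d \<Longrightarrow> fold D (sorted_word \<gamma> [0..<length zs]) f \<in> M"
  shows "f \<in> monomial_filtration R zs w d"
proof -
  have "f \<in> monomial_filtration R zs w s" if "s \<le> d" for s
    using that
  proof (induction s)
    case 0
    then show ?case using f zs by (simp add: filtration_0)
  next
    case (Suc s)
    then show ?case using van by (intro taylor_step) auto
  qed
  then show ?thesis by blast
qed

end

end

section \<open>Marked centres and next entries\<close>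

context cring
begin

lemma filtration_subset_genideal:
  assumes zs: "set zs \<subseteq> carrier R" and "0 < s"
  shows "monomial_filtration R zs w s \<subseteq> Idl (set zs)"
  unfolding monomial_filtration_alt
proof (rule genideal_minimal[OF genideal_ideal[OF zs]], clarify)
  fix \<beta> assume "s \<le> weight w (length zs) \<beta>"
  then obtain l where l: "l < length zs" "0 < \<beta> l"
    using assms(2) unfolding weight_def
    by (metis (no_types, lifting) lessThan_iff mult_0 neq0_conv not_le sum.neutral)
  have "zs ! l \<in> Idl (set zs)" using genideal_self[OF zs] l(1) by (auto dest: nth_mem)
  then show "power_product R zs \<beta> \<in> Idl (set zs)"
    using power_product_step[of zs l \<beta>, OF zs l] zs
    by (simp add: ideal.I_r_closed[OF genideal_ideal[OF zs]])
qed

text \<open>The weights of \<open>us\<close> and the corresponding weights of \<open>zs\<close> are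
  proportional with ratio \<open>d' / d\<close>; cross-multiplication keeps everything in the
  naturals. Further members of \<open>zs\<close> only enlarge the target.\<close>

lemma filtration_scale:
  assumes zs: "set zs \<subseteq> carrier R" and us: "length us \<le> length zs" "take (length us) zs = us"
    and w: "\<And>i. i < length us \<Longrightarrow> d * w' ! i = d' * w ! i" and d: "0 < d" "d * s' \<le> d' * s"
  shows "monomial_filtration R us w s \<subseteq> monomial_filtration R zs w' s'"
proof (rule filtration_subset[where q = "\<lambda>l. w' ! l"])
  show "set us \<subseteq> carrier R" using zs us(2) set_take_subset[of "length us" zs] by auto
  show "us ! l \<in> monomial_filtration R zs w' (w' ! l)" if "l < length us" for l
    using parameter_in_filtration[OF zs, of l w'] us that by (metis less_le_trans nth_take)
  fix \<beta> assume \<beta>: "s \<le> weight w (length us) \<beta>"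
  have "d * s' \<le> d' * weight w (length us) \<beta>" using d(2) \<beta> by (meson le_trans mult_le_mono2)
  also have "\<dots> = (\<Sum>l<length us. \<beta> l * (d' * w ! l))"
    by (simp add: weight_def sum_distrib_left mult.left_commute)
  also have "\<dots> = (\<Sum>l<length us. \<beta> l * (d * w' ! l))" by (rule sum.cong) (use w in auto)
  also have "\<dots> = d * (\<Sum>l<length us. \<beta> l * w' ! l)"
    by (simp add: sum_distrib_left mult.left_commute)
  finally show "s' \<le> (\<Sum>l<length us. \<beta> l * w' ! l)" using d(1) by simp
qed (rule zs)

end

section \<open>Lexicographic comparison of padded sequences\<close>

lemma lexordp_eq_take:
  fixes xs ys :: "'c::linorder list"
  assumes "lexordp_eq xs ys" "length xs = length ys"
  shows "lexordp_eq (take k xs) (take k ys)"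
  using assms
proof (induction xs arbitrary: ys k)
  case (Cons x xs)
  then show ?case by (cases ys; cases k) auto
qed simp

lemma lexordp_eq_nth:
  fixes xs ys :: "'c::linorder list"
  assumes "lexordp_eq xs ys" "take k xs = take k ys" "k < length xs" "k < length ys"
  shows "xs ! k \<le> ys ! k"
  using assms
proof (induction k arbitrary: xs ys)
  case 0
  then show ?case by (cases xs; cases ys) auto
next
  case (Suc k)
  then show ?case by (cases xs; cases ys) auto
qed

lemma length_pad [simp]: "length a \<le> n \<Longrightarrow> length (pad n a) = n"
  by (simp add: pad_def)

lemma take_pad: "k \<le> length a \<Longrightarrow> take k (pad n a) = map Fin (take k a)"
  by (simp add: pad_def take_map)

lemma pad_nth: "i < length a \<Longrightarrow> pad n a ! i = Fin (a ! i)"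
  by (simp add: pad_def nth_append)

lemma preinv_le_take:
  assumes "preinv_le n a b" "length a \<le> n" "length b \<le> n" "k \<le> length a" "k \<le> length b"
  shows "lexordp_eq (map Fin (take k a)) (map Fin (take k b))"
  using lexordp_eq_take[of "pad n a" "pad n b" k] assms by (simp add: preinv_le_def take_pad)

lemma preinv_le_nth:
  assumes "preinv_le n a b" "length a \<le> n" "length b \<le> n" "k < length a" "k < length b"
    and "take k a = take k b"
  shows "a ! k \<le> b ! k"
  using lexordp_eq_nth[of "pad n a" "pad n b" k] assms by (simp add: preinv_le_def take_pad pad_nth)

lemma length_centre_inv [simp]: "length (centre_inv J) = length (wts J)"
  by (simp add: centre_inv_def)

lemma nth_centre_inv: "i < length (wts J) \<Longrightarrow> centre_inv J ! i = of_nat (mark J) / of_nat (wts J ! i)"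
  by (simp add: centre_inv_def)

lemma pre_invariant_take: "pre_invariant n a \<Longrightarrow> pre_invariant n (take k a)"
  using set_take_subset[of k a] by (auto simp: pre_invariant_def sorted_wrt_take)

lemma marked_centre_pre_invariant:
  assumes "is_marked_centre R K M n J"
  shows "pre_invariant n (centre_inv J)"
proof -
  have w: "length (wts J) \<le> n" "sorted_wrt (\<ge>) (wts J)" "\<forall>v\<in>set (wts J). 0 < v" and m: "0 < mark J"
    using assms by (auto simp: is_marked_centre_def weighting_def)
  have "sorted (centre_inv J)"
    unfolding sorted_iff_nth_mono_less
  proof (intro allI impI)
    fix i k assume ik: "i < k" "k < length (centre_inv J)"
    then have "wts J ! k \<le> wts J ! i" "0 < wts J ! k" using w(2,3) by (auto simp: sorted_wrt_iff_nth_less)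
    then show "centre_inv J ! i \<le> centre_inv J ! k"
      using ik m by (simp add: nth_centre_inv divide_left_mono)
  qed
  then show ?thesis using w m by (auto simp: pre_invariant_def centre_inv_def)
qed

lemma marked_centre_weights_proportional:
  assumes "is_marked_centre R K M n J" "is_marked_centre R K M n J'"
    and "preinv_dominates (centre_inv J') (centre_inv J)" "i < length (wts J)"
  shows "mark J * wts J' ! i = mark J' * wts J ! i"
proof -
  have i: "i < length (wts J')" using assms(3,4) by (simp add: preinv_dominates_def)
  have "centre_inv J' ! i = take (length (centre_inv J)) (centre_inv J') ! i" using assms(4) by simp
  also have "\<dots> = centre_inv J ! i" using assms(3) by (simp add: preinv_dominates_def)
  finally have "centre_inv J' ! i = centre_inv J ! i" .
  moreover have "0 < wts J ! i" "0 < wts J' ! i"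
    using assms(1,2,4) i by (auto simp: is_marked_centre_def weighting_def)
  ultimately have "of_nat (mark J' * wts J ! i) = (of_nat (mark J * wts J' ! i) :: rat)"
    using i assms(4) by (simp add: nth_centre_inv frac_eq_eq)
  then show ?thesis by (simp only: of_nat_eq_iff)
qed

text \<open>The values are rationals, so a minimum needs an argument: those not above a given
  \<open>s0\<close> come from finitely many \<open>\<beta>\<close>. Each of the first entries is at
  most \<open>a ! i\<close>, as its quotient by \<open>a ! i\<close> is below 1, and the last entry
  is at most \<open>s0\<close>.\<close>

lemma next_entries_has_min:
  assumes ne: "s0 \<in> next_entries R K xs a I" and pos: "\<forall>r\<in>set a. 0 < r"
  obtains m where "m \<in> next_entries R K xs a I" "\<And>s. s \<in> next_entries R K xs a I \<Longrightarrow> m \<le> s"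
proof -
  let ?N = "next_entries R K xs a I" and ?j = "length a"
  let ?f = "\<lambda>\<beta>. of_nat (\<beta> ! ?j) / (1 - (\<Sum>i<?j. of_nat (\<beta> ! i) / a ! i))"
  obtain B :: nat where B: "Max (insert s0 (set a)) \<le> of_nat B" using real_arch_simple by blast
  have Ba: "r \<le> of_nat B" if "r \<in> set a" for r using B that by simp
  have Bs: "s0 \<le> of_nat B" using B by simp
  let ?T = "{s \<in> ?N. s \<le> s0}"
  have "?T \<subseteq> ?f ` {\<beta>. set \<beta> \<subseteq> {..B} \<and> length \<beta> = Suc ?j}"
  proof
    fix s assume "s \<in> ?T"
    then obtain \<beta> where \<beta>: "length \<beta> = Suc ?j" "(\<Sum>i<?j. of_nat (\<beta> ! i) / a ! i) < 1" "s = ?f \<beta>" "s \<le> s0"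
      by (auto simp: next_entries_def)
    let ?S = "\<Sum>i<?j. of_nat (\<beta> ! i) / a ! i"
    have nn: "0 \<le> of_nat (\<beta> ! i) / a ! i" if "i < ?j" for i
      using pos nth_mem[OF that] by (simp add: less_imp_le)
    then have S0: "0 \<le> ?S" by (intro sum_nonneg) auto
    have "\<beta> ! i \<le> B" if i: "i < Suc ?j" for i
    proof (cases "i = ?j")
      case True
      \<comment> \<open>The denominator is at most 1, so the numerator does not exceed the
        value.\<close>
      have "of_nat (\<beta> ! ?j) = s * (1 - ?S)" using \<beta> by simp
      also have "\<dots> \<le> s"
      proof (rule mult_left_le)
        show "1 - ?S \<le> 1" using S0 by simp
        show "0 \<le> s" unfolding \<beta>(3) using \<beta>(2) by (intro divide_nonneg_nonneg) auto
      qed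
      also have "\<dots> \<le> of_nat B" using \<beta>(4) Bs by simp
      finally show ?thesis using True by simp
    next
      case False
      then have i: "i < ?j" using i by simp
      have "of_nat (\<beta> ! i) / a ! i \<le> ?S" by (rule member_le_sum) (use i nn in auto)
      then have "of_nat (\<beta> ! i) / a ! i \<le> 1" using \<beta>(2) by simp
      then have "of_nat (\<beta> ! i) \<le> a ! i" using pos nth_mem[OF i] by (simp add: divide_le_eq)
      also have "\<dots> \<le> of_nat B" using Ba[OF nth_mem[OF i]] .
      finally show ?thesis by simp
    qed
    then have "set \<beta> \<subseteq> {..B}" using \<beta>(1) by (auto simp: in_set_conv_nth)
    then show "s \<in> ?f ` {\<beta>. set \<beta> \<subseteq> {..B} \<and> length \<beta> = Suc ?j}" using \<beta> by blast
  qed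
  then have fin: "finite ?T" by (rule finite_subset) (intro finite_imageI finite_lists_length_eq; simp)
  have s0T: "s0 \<in> ?T" using ne by simp
  show thesis
  proof (rule that[of "Min ?T"])
    show "Min ?T \<in> ?N" using Min_in[OF fin] s0T by blast
    fix s assume s: "s \<in> ?N"
    show "Min ?T \<le> s"
    proof (cases "s \<le> s0")
      case True
      then show ?thesis using s fin by (intro Min_le) auto
    next
      case False
      then show ?thesis using Min_le[OF fin s0T] by simp
    qed
  qed
qed

section \<open>Comparison centres and the two bounds\<close>

context smooth_local_ring
begin

lemma parameters_take:
  assumes "parameters R K M zs"
  shows "parameters R K M (take m zs)"
proof -
  obtain D where D: "\<And>i. i < length zs \<Longrightarrow> D i \<in> vector_fields R K"
    "\<And>i l. i < length zs \<Longrightarrow> l < length zs \<Longrightarrow> D i (zs ! l) = (if i = l then \<one> else \<zero>)"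
    using parameters_dual[OF assms] by metis
  show ?thesis
  proof (rule parametersI[of _ D])
    show "set (take m zs) \<subseteq> M" using assms set_take_subset[of m zs] by (auto simp: parameters_def)
  qed (use D one_notin_M M_zero in auto)
qed

text \<open>Scaling weights and mark by \<open>u\<close> preserves the old exponents. A common
  divisor of the new weights divides \<open>v\<close> and, the old weights being coprime, also
  \<open>u\<close>. Without old weights their gcd is \<open>v\<close> itself, whence
  \<open>v = 1\<close>. The bound \<open>v \<le> u * x\<close> keeps the weights decreasing.\<close>

lemma refined_centre:
  assumes J: "is_marked_centre R K M n J" and zs: "parameters R K M zs" "length zs = n"
    and m: "length (wts J) < m" "m \<le> n" and uv: "coprime u v" "0 < u" "0 < v"
    and v1: "wts J = [] \<Longrightarrow> v = 1" and le: "\<And>x. x \<in> set (wts J) \<Longrightarrow> v \<le> u * x"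
  defines "W \<equiv> map ((*) u) (wts J) @ replicate (m - length (wts J)) v"
  defines "J' \<equiv> \<lparr>filt = monomial_filtration R (take m zs) W, wts = W, mark = u * mark J\<rparr>"
  shows "is_marked_centre R K M n J'"
    and "centre_inv J' = centre_inv J @ replicate (m - length (wts J)) (of_nat (u * mark J) / of_nat v)"
proof -
  have w: "sorted_wrt (\<ge>) (wts J)" "\<forall>v\<in>set (wts J). 0 < v" "0 < mark J"
    using J by (auto simp: is_marked_centre_def weighting_def)
  have len: "length W = m" using m by (simp add: W_def)
  have "Gcd (set W) = 1"
  proof (cases "wts J = []")
    case True
    then have "set W = {1}" using m v1 by (auto simp: W_def)
    then show ?thesis by simp
  next
    case False
    let ?g = "Gcd (set W)"
    have "v \<in> set W" using m by (simp add: W_def)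
    then have gv: "?g dvd v" by (rule Gcd_dvd)
    have "?g dvd u * x" if "x \<in> set (wts J)" for x using that by (intro Gcd_dvd) (auto simp: W_def)
    then have "?g dvd Gcd ((*) u ` set (wts J))" by (intro Gcd_greatest) auto
    also have "\<dots> = u * Gcd (set (wts J))" by (simp add: Gcd_mult)
    also have "\<dots> = u" using J False by (simp add: is_marked_centre_def)
    finally show ?thesis using gv uv(1) by (metis coprime_common_divisor_nat)
  qed
  moreover have "sorted_wrt (\<ge>) W"
    unfolding W_def sorted_wrt_append sorted_wrt_map
  proof (intro conjI)
    show "sorted_wrt (\<lambda>x y. u * y \<le> u * x) (wts J)" using w(1) by (rule sorted_wrt_mono_rel[rotated]) simp
    show "sorted_wrt (\<ge>) (replicate (m - length (wts J)) v)" by (simp add: sorted_wrt_iff_nth_less)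
  qed (use le in auto)
  moreover have "\<forall>x\<in>set W. 0 < x" using w uv by (auto simp: W_def)
  moreover have "W \<noteq> []" using len m by auto
  moreover have "parameters R K M (take m zs)" "length (take m zs) = length W"
    using parameters_take[OF zs(1)] zs(2) m len by auto
  ultimately show "is_marked_centre R K M n J'"
    using w(3) uv(2) m(2) len
    by (auto simp: is_marked_centre_def weighting_def J'_def)
  show "centre_inv J' = centre_inv J @ replicate (m - length (wts J)) (of_nat (u * mark J) / of_nat v)"
    using uv(2) by (simp add: centre_inv_def J'_def W_def map_replicate_const o_def)
qed

text \<open>Truncating the invariant of the associated centre to fewer than \<open>j\<close> entries is impossible, as
  the missing entries could be filled with arbitrarily large numbers.\<close>

lemma associated_centre_dominates:
  assumes semi: "semi_associated R K M n I j J" and assoc: "associated_centre R K M n I Jp"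
    and ys: "parameters R K M ys" "length ys = n"
  shows "preinv_dominates (centre_inv Jp) (centre_inv J)"
proof -
  let ?a = "centre_inv J" and ?c = "centre_inv Jp"
  have J: "is_marked_centre R K M n J" and Jsemi: "semi_admissible R K M n I j ?a"
    and Jmax: "\<And>b. semi_admissible R K M n I j b \<Longrightarrow> preinv_le n b ?a"
    using semi by (auto simp: semi_associated_def)
  have Jp: "is_marked_centre R K M n Jp" "admissible I Jp"
    and Jpmax: "\<And>J'. is_marked_centre R K M n J' \<Longrightarrow> admissible I J' \<Longrightarrow> preinv_le n (centre_inv J') ?c"
    using assoc by (auto simp: associated_centre_def)
  have j: "length ?a = j" "j \<le> n" using Jsemi by (auto simp: semi_admissible_def pre_invariant_def)
  have pc: "pre_invariant n ?c" using marked_centre_pre_invariant[OF Jp(1)] .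
  obtain b where b: "preinv_le n b ?c" "length b \<le> n" "j \<le> length b" "take j b = ?a"
    using Jsemi Jpmax j
    by (auto simp: semi_admissible_def admissible_preinv_def preinv_dominates_def pre_invariant_def)
  have cn: "length ?c \<le> n" using pc by (simp add: pre_invariant_def)
  show ?thesis
  proof (cases "j \<le> length ?c")
    case True
    \<comment> \<open>The truncation of \<open>?c\<close> is semi-admissible, hence at most
      \<open>?a\<close>. Conversely \<open>b\<close> extends \<open>?a\<close>, is admissible and so
      at most \<open>?c\<close>; truncation gives the other inequality.\<close>
    have "semi_admissible R K M n I j (take j ?c)"
      using pre_invariant_take[OF pc] pc Jp True
      by (auto simp: semi_admissible_def admissible_preinv_def preinv_dominates_def intro!: exI[of _ ?c])
    then have "preinv_le n (take j ?c) ?a" by (rule Jmax)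
    from preinv_le_take[OF this, of j] have "lexordp_eq (map Fin (take j ?c)) (map Fin ?a)"
      using cn j True by simp
    moreover have "lexordp_eq (map Fin ?a) (map Fin (take j ?c))"
      using preinv_le_take[OF b(1), of j] b cn True by simp
    ultimately have "map Fin (take j ?c) = map Fin ?a" by (rule lexordp_eq_antisym)
    then have "take j ?c = ?a" by (simp add: inj_map_eq_map inj_def)
    then show ?thesis using True j by (simp add: preinv_dominates_def)
  next
    case False
    let ?k = "length (wts Jp)"
    have k: "?k < j" using False by simp
    obtain us where us: "parameters R K M us" "length us = ?k" "filt Jp = monomial_filtration R us (wts Jp)"
      using Jp(1) by (auto simp: is_marked_centre_def weighting_def)
    obtain zs where zs: "parameters R K M zs" "length zs = n" "take ?k zs = us"
      using extend_parameters[OF ys us(1)] us(2) k j by auto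
    have mk: "0 < mark Jp" and wp: "\<forall>x\<in>set (wts Jp). 0 < x"
      using Jp(1) by (auto simp: is_marked_centre_def weighting_def)
    \<comment> \<open>The old parameters alone already generate enough: after scaling by
      \<open>N\<close>, the extended filtration contains the filtration of \<open>Jp\<close>
      whatever exponents are appended.\<close>
    have large: "preinv_le n (?c @ replicate (j - ?k) (of_nat (N * mark Jp))) ?a" if N: "0 < N" for N
    proof -
      let ?W = "map ((*) N) (wts Jp) @ replicate (j - ?k) 1"
      let ?J = "\<lparr>filt = monomial_filtration R (take j zs) ?W, wts = ?W, mark = N * mark Jp\<rparr>"
      have "is_marked_centre R K M n ?J"
        and inv: "centre_inv ?J = ?c @ replicate (j - ?k) (of_nat (N * mark Jp) / of_nat 1)"
        using refined_centre[OF Jp(1) zs(1,2) k j(2), of N 1] N wp by (auto simp: Suc_le_eq)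
      moreover have "admissible I ?J"
      proof -
        have "monomial_filtration R us (wts Jp) (mark Jp)
            \<subseteq> monomial_filtration R (take j zs) ?W (N * mark Jp)"
        proof (rule filtration_scale[where d = 1 and d' = N])
          show "set (take j zs) \<subseteq> carrier R" by (rule parameters_carrier[OF parameters_take[OF zs(1)]])
          show "take (length us) (take j zs) = us" using zs(3) us(2) k by (simp add: min_def)
        qed (use us(2) zs(2) k j in \<open>auto simp: nth_append\<close>)
        then show ?thesis using Jp(2) us(3) by (auto simp: admissible_def)
      qed
      moreover have "length (centre_inv ?J) = j" using k by simp
      ultimately have "semi_admissible R K M n I j (centre_inv ?J)"
        using marked_centre_pre_invariant[of R K M n ?J]
        by (auto simp: semi_admissible_def admissible_preinv_def preinv_dominates_def intro!: exI[of _ "centre_inv ?J"])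
      from Jmax[OF this] inv show ?thesis by simp
    qed
    have la: "?k < length ?a" using k j by simp
    \<comment> \<open>\<open>large\<close> bounds \<open>?c\<close> by the beginning of
      \<open>?a\<close>, and \<open>b\<close>, which extends \<open>?a\<close>, gives the reverse
      inequality.\<close>
    have ca: "take ?k ?a = ?c"
    proof -
      have "lexordp_eq (map Fin ?c) (map Fin (take ?k ?a))"
        using preinv_le_take[OF large[of 1], of ?k] cn j k by simp
      moreover have "lexordp_eq (map Fin (take ?k ?a)) (map Fin ?c)"
        using preinv_le_take[OF b(1), of ?k] b cn k by (auto simp: min_def simp flip: b(4))
      ultimately have "map Fin ?c = map Fin (take ?k ?a)" by (rule lexordp_eq_antisym)
      then show ?thesis by (simp add: inj_map_eq_map inj_def)
    qed
    \<comment> \<open>An appended entry above \<open>?a ! ?k\<close> contradicts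
      \<open>large\<close>, as the preceding entries agree.\<close>
    obtain N :: nat where N: "?a ! ?k < of_nat N" using reals_Archimedean2 by blast
    have "0 \<le> ?a ! ?k" using la by (simp add: nth_centre_inv)
    then have N0: "0 < N" using N by (cases N) auto
    have "(?c @ replicate (j - ?k) (of_nat (N * mark Jp))) ! ?k \<le> ?a ! ?k"
      by (rule preinv_le_nth[OF large[OF N0]]) (use cn j k ca la in auto)
    then have "of_nat (N * mark Jp) \<le> ?a ! ?k" using k by (simp add: nth_append)
    moreover have "(of_nat N :: rat) \<le> of_nat (N * mark Jp)" unfolding of_nat_le_iff using mk by simp
    ultimately show ?thesis using N by linarith
  qed
qed

lemma next_entry_lower_bound:
  assumes I: "I \<subseteq> carrier R" and zs: "parameters R K M zs" and w: "sorted_wrt (\<ge>) w" "length w = length zs"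
    and pos: "\<forall>x\<in>set w. 0 < x" and d: "0 < d" and IF: "I \<subseteq> monomial_filtration R zs w d"
    and xs: "take (length a) zs = xs" "length a < length zs" "length xs = length a"
    and a: "\<And>i. i < length a \<Longrightarrow> a ! i = of_nat d / of_nat (w ! i)"
    and s: "s \<in> next_entries R K xs a I"
  shows "of_nat d / of_nat (w ! length a) \<le> s"
proof -
  let ?j = "length a"
  obtain \<beta> where \<beta>: "length \<beta> = Suc ?j" "(\<Sum>i<?j. of_nat (\<beta> ! i) / a ! i) < 1"
      "iter_diff R K xs I \<beta> ?j = carrier (sub_ring R xs ?j)"
      "s = of_nat (\<beta> ! ?j) / (1 - (\<Sum>i<?j. of_nat (\<beta> ! i) / a ! i))"
    using s by (auto simp: next_entries_def)
  have zc: "set zs \<subseteq> carrier R" using parameters_carrier[OF zs] .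
  have zM: "set zs \<subseteq> M" using zs by (simp add: parameters_def)
  have xM: "set (take ?j xs) \<subseteq> M" using xs(1) zM set_take_subset[of ?j zs] set_take_subset[of ?j xs] by blast
  have xc: "set xs \<subseteq> carrier R" using xs(1) zc set_take_subset[of ?j zs] by blast
  have "d \<le> (\<Sum>i<Suc ?j. \<beta> ! i * w ! i)"
  proof (rule ccontr)
    let ?e = "d - (\<Sum>i<Suc ?j. \<beta> ! i * w ! i)"
    assume "\<not> d \<le> (\<Sum>i<Suc ?j. \<beta> ! i * w ! i)"
    then have e: "0 < ?e" by simp
    have tk: "take ?j zs = take ?j xs" using xs(1,3) by simp
    have "carrier (sub_ring R xs ?j) \<subseteq> sub_class R xs ?j ` monomial_filtration R zs w ?e"
      using iter_diff_filtration[OF xc I K_carrier zc w xs(2) tk IF, of \<beta>] \<beta>(3) by simp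
    then have "sub_class R xs ?j \<one> \<in> sub_class R xs ?j ` monomial_filtration R zs w ?e"
      using sub_class_closed[OF xc one_closed] by blast
    then obtain y where y: "y \<in> monomial_filtration R zs w ?e" "sub_class R xs ?j \<one> = sub_class R xs ?j y"
      by blast
    have "y \<in> Idl (set zs)" using y(1) filtration_subset_genideal[OF zc e] by blast
    then have yM: "y \<in> M" using genideal_minimal[OF M_ideal zM] by blast
    have yc: "y \<in> carrier R" using yM M_carrier by blast
    \<comment> \<open>Equality on the subvariety is equality modulo \<open>x_1, ..., x_j\<close>,
      which lie in \<open>M\<close>; so 1 would lie in \<open>M\<close> along with
      \<open>y\<close>.\<close>
    have "\<one> \<ominus> y \<in> Idl (set (take ?j xs))" using sub_class_eq_iff[OF xc one_closed yc] y(2) by simp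
    then have "\<one> \<ominus> y \<in> M" using genideal_minimal[OF M_ideal xM] by blast
    from M_add[OF this yM] have "\<one> \<in> M" using yc by (simp add: minus_eq a_assoc l_neg)
    then show False using one_notin_M by simp
  qed
  then have "(of_nat d :: rat) \<le> of_nat (\<Sum>i<Suc ?j. \<beta> ! i * w ! i)" by (simp only: of_nat_le_iff)
  also have "\<dots> = (\<Sum>i<?j. of_nat (\<beta> ! i) * of_nat (w ! i)) + of_nat (\<beta> ! ?j) * of_nat (w ! ?j)" by simp
  also have "(\<Sum>i<?j. of_nat (\<beta> ! i) * of_nat (w ! i)) = of_nat d * (\<Sum>i<?j. of_nat (\<beta> ! i) / a ! i)"
    unfolding sum_distrib_left by (rule sum.cong) (use a d in auto)
  finally have "of_nat d * (1 - (\<Sum>i<?j. of_nat (\<beta> ! i) / a ! i)) \<le> of_nat (\<beta> ! ?j) * of_nat (w ! ?j)"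
    by (simp add: algebra_simps)
  moreover have "0 < w ! ?j" using pos w(2) xs(2) by auto
  ultimately show ?thesis using \<beta>(2) by (simp add: \<beta>(4) frac_le_eq divide_le_eq pos_le_divide_eq mult.commute)
qed

text \<open>The derivatives in each of the first \<open>j\<close> parameters form a stage of their
  own, and all the others together form the stage \<open>j\<close>. The last entry of
  \<open>\<beta>\<close> is therefore their total number.\<close>

lemma sorted_word_splits:
  assumes "j \<le> m"
  shows "concat (map (\<lambda>l. if l < j then replicate (\<gamma> l) l else sorted_word \<gamma> [j..<m]) [0..<Suc j])
    = sorted_word \<gamma> [0..<m]"
proof -
  let ?f = "\<lambda>l. if l < j then replicate (\<gamma> l) l else sorted_word \<gamma> [j..<m]"
  have f: "map ?f [0..<j] = map (\<lambda>l. replicate (\<gamma> l) l) [0..<j]" by (rule map_cong) auto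
  have "concat (map ?f [0..<Suc j]) = concat (map ?f [0..<j]) @ sorted_word \<gamma> [j..<m]" by simp
  also have "\<dots> = sorted_word \<gamma> ([0..<j] @ [j..<m])" unfolding f by (simp add: sorted_word_def)
  also have "[0..<j] @ [j..<m] = [0..<m]" using assms by (metis le_add_diff_inverse upt_add_eq_append zero_le)
  finally show ?thesis .
qed

text \<open>With the common weight \<open>v\<close> on all remaining parameters, the weight of
  \<open>\<gamma>\<close> depends only on its first \<open>j\<close> entries and the sum of the
  others, that is, on \<open>\<beta>\<close>. Assumption \<open>s\<close> holds vacuously when there
  are no next entries, and the lemma is also applied in that case.\<close>

lemma admissible_for_next_entry:
  assumes I: "I \<subseteq> carrier R" and zs: "parameters R K M zs" "length zs = n"
    and w: "length w = j" "\<forall>x\<in>set w. 0 < x" and d: "0 < d" and uv: "0 < u" "0 < v"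
    and xs: "take j zs = xs" "j < n"
    and a: "a = map (\<lambda>x. of_nat d / of_nat x) w"
    and s: "\<And>s. s \<in> next_entries R K xs a I \<Longrightarrow> of_nat (u * d) / of_nat v \<le> s"
  shows "I \<subseteq> monomial_filtration R zs (map ((*) u) w @ replicate (n - j) v) (u * d)"
proof
  fix f assume f: "f \<in> I"
  let ?W = "map ((*) u) w @ replicate (n - j) v"
  have xc: "set xs \<subseteq> carrier R" using parameters_carrier[OF parameters_take[OF zs(1)]] xs(1) by blast
  have xl: "length xs = j" using xs zs(2) by auto
  have al: "length a = j" using a w by simp
  obtain D where D: "\<And>i. i < n \<Longrightarrow> D i \<in> vector_fields R K"
    "\<And>i l. i < n \<Longrightarrow> l < n \<Longrightarrow> D i (zs ! l) = (if i = l then \<one> else \<zero>)"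
    using parameters_dual[OF zs(1)] zs(2) by metis
  show "f \<in> monomial_filtration R zs ?W (u * d)"
  proof (rule taylor_criterion[OF parameters_carrier[OF zs(1)] system_generates[OF zs]])
    show "0 < ?W ! l" if "l < length zs" for l using that w uv zs(2) xs(2) by (auto simp: nth_append)
    show "D i \<in> vector_fields R K" if "i < length zs" for i using D that zs(2) by simp
    show "D i (zs ! l) = (if i = l then \<one> else \<zero>)" if "i < length zs" "l < length zs" for i l
      using D that zs(2) by simp
    show "f \<in> carrier R" using f I by blast
    fix \<gamma> assume "weight ?W (length zs) \<gamma> < u * d"
    then have wt: "weight ?W n \<gamma> < u * d" using zs(2) by simp
    show "fold D (sorted_word \<gamma> [0..<length zs]) f \<in> M"
    proof (rule ccontr)
      assume notM: "fold D (sorted_word \<gamma> [0..<length zs]) f \<notin> M"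
      let ?g = "fold D (sorted_word \<gamma> [0..<n]) f"
      define U where "U l = (if l < j then replicate (\<gamma> l) l else sorted_word \<gamma> [j..<n])" for l
      let ?b = "\<Sum>l\<leftarrow>[j..<n]. \<gamma> l"
      define \<beta> where "\<beta> = map \<gamma> [0..<j] @ [?b]"
      have \<beta>: "length \<beta> = Suc j" "\<And>l. l < j \<Longrightarrow> \<beta> ! l = \<gamma> l" "\<beta> ! j = ?b"
        by (auto simp: \<beta>_def nth_append)
      have U: "l \<le> i \<and> i < n" if "l \<le> j" "i \<in> set (U l)" for l i
        using that set_sorted_word[of \<gamma> "[j..<n]"] xs(2) by (auto simp: U_def split: if_splits)
      have gc: "?g \<in> carrier R"
        by (rule fold_vector_fields_closed[of _ D K])
          (use set_sorted_word[of \<gamma> "[0..<n]"] D(1) f I in \<open>auto simp: subset_eq\<close>)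
      have "sub_class R xs j (fold D (concat (map U [0..<Suc j])) f) \<in> iter_diff R K xs I \<beta> j"
      proof (rule fold_in_iter_diff[OF xc I K_carrier])
        show "j \<le> length xs" using xl by simp
        show "D i \<in> vector_fields R K" if "l \<le> j" "i \<in> set (U l)" for l i using U[OF that] D(1) by blast
        show "D i (xs ! m) = \<zero>" if "l \<le> j" "i \<in> set (U l)" "m < l" for l i m
        proof -
          have "xs ! m = zs ! m" using xs(1) that(1,3) by (metis less_le_trans nth_take)
          then show ?thesis using U[OF that(1,2)] D(2)[of i m] that(3) by simp
        qed
        show "length (U l) = \<beta> ! l" if "l \<le> j" for l
          using \<beta>(2)[of l] \<beta>(3) that by (cases "l = j") (auto simp: U_def length_sorted_word)
      qed (rule f)
      moreover have "concat (map U [0..<Suc j]) = sorted_word \<gamma> [0..<n]"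
        unfolding U_def using xs(2) by (intro sorted_word_splits) simp
      ultimately have gI: "sub_class R xs j ?g \<in> iter_diff R K xs I \<beta> j" by (simp only:)
      interpret h: ring_hom_cring R "sub_ring R xs j" "sub_class R xs j" using sub_hom[OF xc] .
      interpret Q: ideal "iter_diff R K xs I \<beta> j" "sub_ring R xs j" using iter_diff_ideal[OF xc I K_carrier] .
      \<comment> \<open>A derivative outside \<open>M\<close> is a unit of \<open>R\<close>, so an
        ideal that contains its class is the whole ring.\<close>
      have gu: "?g \<in> Units R" using notin_M_unit[OF gc] notM zs(2) by simp
      have "sub_class R xs j (inv ?g) \<otimes>\<^bsub>sub_ring R xs j\<^esub> sub_class R xs j ?g \<in> iter_diff R K xs I \<beta> j"
        by (rule Q.I_l_closed[OF gI]) (use gu in simp)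
      also have "sub_class R xs j (inv ?g) \<otimes>\<^bsub>sub_ring R xs j\<^esub> sub_class R xs j ?g = \<one>\<^bsub>sub_ring R xs j\<^esub>"
        using gu gc h.hom_mult[of "inv ?g" ?g] by simp
      finally have full: "iter_diff R K xs I \<beta> j = carrier (sub_ring R xs j)" by (rule Q.one_imp_carrier)
      let ?S = "\<Sum>i<length a. of_nat (\<beta> ! i) / a ! i" and ?m = "of_nat (u * d) / of_nat v :: rat"
      have "weight ?W n \<gamma> = (\<Sum>l<j. \<gamma> l * ?W ! l) + (\<Sum>l=j..<n. \<gamma> l * ?W ! l)"
        unfolding weight_def lessThan_atLeast0
        by (rule sum.atLeastLessThan_concat[symmetric]) (use xs(2) in auto)
      also have "(\<Sum>l<j. \<gamma> l * ?W ! l) = (\<Sum>l<j. \<beta> ! l * (u * w ! l))"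
        by (rule sum.cong) (use w(1) \<beta>(2) in \<open>auto simp: nth_append\<close>)
      also have "(\<Sum>l=j..<n. \<gamma> l * ?W ! l) = (\<Sum>l=j..<n. \<gamma> l * v)"
        by (rule sum.cong) (use w(1) in \<open>auto simp: nth_append\<close>)
      also have "\<dots> = ?b * v"
        unfolding sum_distrib_right[symmetric] by (simp add: sum_list_distinct_conv_sum_set)
      finally have "(\<Sum>l<j. \<beta> ! l * (u * w ! l)) + \<beta> ! j * v < u * d" using wt \<beta>(3) by simp
      then have "of_nat ((\<Sum>l<j. \<beta> ! l * (u * w ! l)) + \<beta> ! j * v) < (of_nat (u * d) :: rat)"
        by (simp only: of_nat_less_iff)
      then have "(\<Sum>l<j. of_nat (\<beta> ! l) * (of_nat u * of_nat (w ! l))) + of_nat (\<beta> ! j) * of_nat v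
          < (of_nat (u * d) :: rat)" by simp
      moreover have "(\<Sum>l<j. of_nat (\<beta> ! l) * (of_nat u * of_nat (w ! l))) = of_nat (u * d) * ?S"
        unfolding sum_distrib_left by (rule sum.cong) (use a w d in auto)
      ultimately have lt: "of_nat (\<beta> ! j) * of_nat v < of_nat (u * d) * (1 - ?S)"
        by (simp add: algebra_simps)
      have ud: "(0::rat) < of_nat (u * d)" using uv d by simp
      \<comment> \<open>As the smaller side of \<open>lt\<close> is nonnegative,
        \<open>1 - ?S\<close> is positive; so \<open>\<beta>\<close> satisfies the side condition of
        \<open>next_entries\<close>.\<close>
      have "(0::rat) \<le> of_nat (\<beta> ! j) * of_nat v" by simp
      then have "0 < of_nat (u * d) * (1 - ?S)" using lt by linarith
      from zero_less_mult_pos[OF this ud] have S1: "?S < 1" by linarith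
      have "of_nat (\<beta> ! j) / (1 - ?S) \<in> next_entries R K xs a I"
        unfolding next_entries_def using \<beta>(1) S1 full al by auto
      then have "?m \<le> of_nat (\<beta> ! j) / (1 - ?S)" by (rule s)
      then have "of_nat (u * d) * (1 - ?S) \<le> of_nat (\<beta> ! j) * of_nat v"
        using S1 uv(2) by (simp add: divide_le_eq le_divide_eq mult.commute)
      then show False using lt by linarith
    qed
  qed
qed

end

theorem proposition4p2p4:
  fixes R :: "('a, 'b) ring_scheme" and K M I :: "'a set" and n j :: nat
    and xs :: "'a list" and a :: "rat list" and J Jp :: "'a marked_centre"
  assumes "smooth_local_ring R K M n"
    and "ideal I R" and "I \<subseteq> M" and "pure_positive_codim R I"
    and "length a = j" and "is_centre_of R K M n xs a J"
    and "semi_associated R K M n I j J"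
    and "\<not> admissible I J"
    and "associated_centre R K M n I Jp"
  shows "j < length (centre_inv Jp) \<and>
    centre_inv Jp ! j \<in> next_entries R K xs a I \<and>
    (\<forall>s\<in>next_entries R K xs a I. centre_inv Jp ! j \<le> s)"
proof -
  interpret smooth_local_ring R K M n by fact
  let ?c = "centre_inv Jp" and ?w = "wts J" and ?wp = "wts Jp" and ?N = "next_entries R K xs a I"
  have I: "I \<subseteq> carrier R" using ideal.Icarr[OF assms(2)] by blast
  have J: "is_marked_centre R K M n J" and xl: "length xs = j" and aJ: "centre_inv J = a"
    and comp: "compatible_parameters R K M n J xs"
    using assms(5,6) by (auto simp: is_centre_of_def)
  have wl: "length ?w = j" using aJ assms(5) by (metis length_centre_inv)
  have xs: "parameters R K M xs" and FJ: "filt J = monomial_filtration R xs ?w"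
    using comp xl wl by (auto simp: compatible_parameters_def)
  have xc: "set xs \<subseteq> carrier R" by (rule parameters_carrier[OF xs])
  have w: "\<forall>x\<in>set ?w. 0 < x" and mJ: "0 < mark J" and mJ1: "?w = [] \<Longrightarrow> mark J = 1"
    using J by (auto simp: is_marked_centre_def weighting_def)
  have Jp: "is_marked_centre R K M n Jp" "admissible I Jp"
    using assms(9) by (auto simp: associated_centre_def)
  have wp: "\<forall>x\<in>set ?wp. 0 < x" "sorted_wrt (\<ge>) ?wp" and mp: "0 < mark Jp" and kn: "length ?wp \<le> n"
    using Jp(1) by (auto simp: is_marked_centre_def weighting_def)
  have dominated: "centre_dominates R K M n J' J"
    if "is_marked_centre R K M n J'" "admissible I J'" "preinv_dominates (centre_inv J') (centre_inv J)" for J'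
    using assms(7) that by (auto simp: semi_associated_def)
  \<comment> \<open>Some admissible centre has an invariant dominating \<open>a\<close>;
    semi-association makes it dominate \<open>J\<close>, and this supplies a full system of
    parameters.\<close>
  obtain J0 where J0: "is_marked_centre R K M n J0" "admissible I J0"
    "preinv_dominates (centre_inv J0) (centre_inv J)"
    using assms(7) by (auto simp: semi_associated_def semi_admissible_def admissible_preinv_def)
  obtain ys0 where "parameter_system R K M n ys0"
    using dominated[OF J0] by (auto simp: centre_dominates_def)
  then have dom: "preinv_dominates ?c (centre_inv J)"
    using associated_centre_dominates[OF assms(7,9)] by (auto simp: parameter_system_def)
  then have jk: "j \<le> length ?wp" and ca: "take j ?c = a"
    using aJ assms(5) by (auto simp: preinv_dominates_def)
  obtain ys where ys: "parameters R K M ys" "length ys = n"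
    and compJp: "compatible_parameters R K M n Jp ys" and compJ: "compatible_parameters R K M n J ys"
    using dominated[OF Jp dom] by (auto simp: centre_dominates_def parameter_system_def)
  have FJp: "filt Jp = monomial_filtration R (take (length ?wp) ys) ?wp"
    using compJp by (simp add: compatible_parameters_def)
  have FJ': "filt J = monomial_filtration R (take j ys) ?w"
    using compJ wl by (simp add: compatible_parameters_def)
  have yc: "set (take m ys) \<subseteq> carrier R" for m by (rule parameters_carrier[OF parameters_take[OF ys(1)]])
  have ratio: "mark J * ?wp ! i = mark Jp * ?w ! i" if "i < j" for i
    using marked_centre_weights_proportional[OF J Jp(1) dom] that wl by simp

  \<comment> \<open>With equal lengths the invariants coincide and the weights are proportional. In
    the common parameters admissibility of \<open>Jp\<close> would then pass to
    \<open>J\<close>.\<close>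
  have jlt: "j < length ?wp"
  proof (rule ccontr)
    assume "\<not> j < length ?wp"
    then have k: "length ?wp = j" using jk by simp
    have "monomial_filtration R (take j ys) ?wp (mark Jp) \<subseteq> monomial_filtration R (take j ys) ?w (mark J)"
      by (rule filtration_scale[where d = "mark Jp" and d' = "mark J"])
        (use yc ratio mp k jk kn ys(2) in auto)
    then have "admissible I J" using Jp(2) FJp FJ' k by (auto simp: admissible_def)
    then show False using assms(8) by blast
  qed
  then have jn: "j < n" using kn by simp

  \<comment> \<open>\<open>ys\<close> is compatible with both centres but need not begin with
    \<open>xs\<close>; its first \<open>j\<close> members are exchanged for them.\<close>
  define zs where "zs = xs @ drop j ys"
  have xsub: "set xs \<subseteq> Idl\<^bsub>R\<^esub> (set (take (length xs) ys))"
  proof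
    fix x assume "x \<in> set xs"
    then obtain l where l: "l < j" "x = xs ! l" using xl by (auto simp: in_set_conv_nth)
    have "x \<in> filt J (?w ! l)" unfolding FJ l(2) by (rule parameter_in_filtration[OF xc]) (use l xl in simp)
    moreover have "0 < ?w ! l" using w wl l(1) by auto
    ultimately show "x \<in> Idl\<^bsub>R\<^esub> (set (take (length xs) ys))"
      using filtration_subset_genideal[OF yc] unfolding FJ' xl by blast
  qed
  have zs: "parameters R K M zs" "length zs = n" "take j zs = xs"
    using replace_initial_parameters[OF ys(1) xs _ xsub] xl jn ys(2) by (auto simp: zs_def)
  let ?zk = "take (length ?wp) zs"
  have zk: "parameters R K M ?zk" "length ?wp = length ?zk" "take j ?zk = xs"
    using parameters_take[OF zs(1)] zs kn jlt by (auto simp: min_def)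
  have zkc: "set ?zk \<subseteq> carrier R" by (rule parameters_carrier[OF zk(1)])
  \<comment> \<open>The exchanged members of \<open>ys\<close> lie in the filtration of
    \<open>J\<close> at their weights. Written in terms of \<open>xs\<close> and rescaled to the
    weights of \<open>Jp\<close>, they keep the weight they had for \<open>Jp\<close>.\<close>
  have "monomial_filtration R (take (length ?wp) ys) ?wp (mark Jp)
      \<subseteq> monomial_filtration R ?zk ?wp (mark Jp)"
  proof (rule filtration_subset[OF yc zkc, where q = "\<lambda>l. ?wp ! l"])
    fix l assume l: "l < length (take (length ?wp) ys)"
    then have lk: "l < length ?wp" "l < n" using ys(2) by auto
    show "take (length ?wp) ys ! l \<in> monomial_filtration R ?zk ?wp (?wp ! l)"
    proof (cases "l < j")
      case True
      have "take j ys ! l \<in> filt J (?w ! l)"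
        unfolding FJ' by (rule parameter_in_filtration[OF yc]) (use True lk ys(2) in simp)
      moreover have "filt J (?w ! l) \<subseteq> monomial_filtration R ?zk ?wp (?wp ! l)"
        unfolding FJ
        by (rule filtration_scale[where d = "mark J" and d' = "mark Jp"])
          (use zkc zk(2,3) jlt xl ratio mJ True in auto)
      ultimately show ?thesis using True lk by auto
    next
      case False
      then have "take (length ?wp) ys ! l = ?zk ! l" using lk xl ys(2) by (simp add: zs_def nth_append)
      then show ?thesis using parameter_in_filtration[OF zkc, of l ?wp] lk zk(2) by simp
    qed
  qed (simp add: weight_def)
  then have IF: "I \<subseteq> monomial_filtration R ?zk ?wp (mark Jp)"
    using Jp(2) FJp by (auto simp: admissible_def)
  have ai: "a ! i = of_nat (mark Jp) / of_nat (?wp ! i)" if "i < j" for i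
    using ca that jk by (metis nth_centre_inv nth_take less_le_trans)
  have cj: "?c ! j = of_nat (mark Jp) / of_nat (?wp ! j)" using jlt by (rule nth_centre_inv)
  have lower: "?c ! j \<le> s" if "s \<in> ?N" for s
    using next_entry_lower_bound[OF I zk(1) wp(2) zk(2) wp(1) mp IF, of a xs s] zk assms(5) jlt xl ai that cj
    by simp

  have pc: "pre_invariant n ?c" by (rule marked_centre_pre_invariant[OF Jp(1)])
  have a_le: "r \<le> ?c ! j" if r: "r \<in> set a" for r
  proof -
    obtain i where i: "i < j" "r = a ! i" using r assms(5) by (auto simp: in_set_conv_nth)
    have "a ! i = ?c ! i" using ca i by auto
    also have "\<dots> \<le> ?c ! j"
      using pc jlt i by (intro sorted_nth_mono) (auto simp: pre_invariant_def)
    finally show ?thesis using i by simp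
  qed
  have cpos: "0 < ?c ! j" using cj wp(1) jlt mp by simp
  have apos: "\<forall>r\<in>set a. 0 < r"
    using marked_centre_pre_invariant[OF J] aJ by (simp add: pre_invariant_def)

  \<comment> \<open>The exponent \<open>u * mark J / v\<close> is put on every remaining parameter
    up to length \<open>n\<close>. Assumption \<open>ge\<close> makes the sequence non-decreasing,
    since \<open>?c ! j\<close> bounds all entries of \<open>a\<close>.\<close>
  have upper: "of_nat (u * mark J) / of_nat v \<le> ?c ! j"
    if uv: "coprime u v" "0 < u" "0 < v" "?w = [] \<Longrightarrow> v = 1"
      and ge: "?c ! j \<le> of_nat (u * mark J) / of_nat v"
      and le: "\<And>s. s \<in> ?N \<Longrightarrow> of_nat (u * mark J) / of_nat v \<le> s" for u v :: nat
  proof -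
    let ?W = "map ((*) u) ?w @ replicate (n - length ?w) v"
    let ?J = "\<lparr>filt = monomial_filtration R (take n zs) ?W, wts = ?W, mark = u * mark J\<rparr>"
    have wle: "v \<le> u * x" if x: "x \<in> set ?w" for x
    proof -
      have "of_nat (mark J) / of_nat x \<in> set a" using x aJ by (auto simp: centre_inv_def)
      then have "of_nat (mark J) / of_nat x \<le> (of_nat (u * mark J) / of_nat v :: rat)"
        using a_le ge by fastforce
      then have "of_nat (mark J * v) \<le> (of_nat (u * mark J * x) :: rat)"
        using uv(3) w x by (simp add: frac_le_eq divide_le_eq pos_le_divide_eq field_simps)
      then have "mark J * v \<le> mark J * (u * x)" by (simp only: of_nat_le_iff mult_ac)
      then show ?thesis using mJ by simp
    qed
    have mc: "is_marked_centre R K M n ?J"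
      and inv: "centre_inv ?J = centre_inv J @ replicate (n - length ?w) (of_nat (u * mark J) / of_nat v)"
      using refined_centre[OF J zs(1,2) _ order_refl uv wle] wl jn by auto
    have "I \<subseteq> monomial_filtration R zs (map ((*) u) ?w @ replicate (n - j) v) (u * mark J)"
      by (rule admissible_for_next_entry[OF I zs(1,2) wl w mJ uv(2,3) zs(3) jn _ le])
        (use aJ in \<open>simp_all add: centre_inv_def\<close>)
    then have "admissible I ?J" using zs(2) wl by (simp add: admissible_def)
    then have pl: "preinv_le n (centre_inv ?J) ?c"
      using assms(9) mc by (auto simp: associated_centre_def)
    have "centre_inv ?J ! j \<le> ?c ! j"
      by (rule preinv_le_nth[OF pl]) (use inv aJ ca wl jn jlt kn assms(5) in auto)
    then show ?thesis using inv aJ assms(5) wl jn by (simp add: nth_append)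
  qed

  \<comment> \<open>Without next entries every integral exponent would pass the test, in particular
    one above \<open>?c ! j\<close>.\<close>
  have "?N \<noteq> {}"
  proof
    assume empty: "?N = {}"
    obtain u :: nat where u: "?c ! j < of_nat u" using reals_Archimedean2 by blast
    have u0: "0 < u" using u cpos by (cases u) auto
    have "(of_nat u :: rat) \<le> of_nat (u * mark J)" unfolding of_nat_le_iff using mJ by simp
    then have "?c ! j < of_nat (u * mark J)" using u by linarith
    moreover have "of_nat (u * mark J) / of_nat 1 \<le> ?c ! j"
      by (rule upper) (use u0 empty calculation in auto)
    ultimately show False by simp
  qed
  then obtain m where m: "m \<in> ?N" "\<And>s. s \<in> ?N \<Longrightarrow> m \<le> s"
    using next_entries_has_min[OF _ apos] by blast
  have cm: "?c ! j \<le> m" using lower[OF m(1)] .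
  \<comment> \<open>\<open>u / v\<close> is \<open>m / mark J\<close> in lowest terms. For
    \<open>j = 0\<close> the denominator of a next entry is 1 and the mark of \<open>J\<close> is 1,
    so \<open>m\<close> is an integer and \<open>v = 1\<close>.\<close>
  have "\<exists>u v. coprime u v \<and> 0 < u \<and> 0 < v \<and> (?w = [] \<longrightarrow> v = 1) \<and> m = of_nat (u * mark J) / of_nat v"
  proof (cases "?w = []")
    case True
    then have "a = []" using aJ by (simp add: centre_inv_def)
    then obtain u :: nat where "m = of_nat u" using m(1) by (auto simp: next_entries_def)
    then show ?thesis using True mJ1 cm cpos by (intro exI[of _ u] exI[of _ "1::nat"]) auto
  next
    case False
    have m0: "0 < m / of_nat (mark J)" using cm cpos mJ by simp
    obtain p q where pq: "quotient_of (m / of_nat (mark J)) = (p, q)" by fastforce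
    have q: "0 < q" "coprime p q" "m / of_nat (mark J) = of_int p / of_int q"
      using quotient_of_denom_pos[OF pq] quotient_of_coprime[OF pq] quotient_of_div[OF pq] by auto
    then have p: "0 < p" using m0 by (simp add: zero_less_divide_iff)
    have "m = of_nat (nat p * mark J) / of_nat (nat q)"
      using q p mJ by (simp add: field_simps)
    moreover have "coprime (nat p) (nat q)" using q p by (simp flip: coprime_int_iff)
    ultimately show ?thesis using p q(1) False by (intro exI[of _ "nat p"] exI[of _ "nat q"]) auto
  qed
  then obtain u v where uv: "coprime u v" "0 < u" "0 < v" "?w = [] \<longrightarrow> v = 1"
    and muv: "m = of_nat (u * mark J) / of_nat v" by (elim exE conjE) (rule that)
  have "m \<le> ?c ! j" unfolding muv by (rule upper) (use uv cm m(2) muv in auto)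
  then have "?c ! j = m" using cm by simp
  then show ?thesis using jlt m by simp
qed

end
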